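(* (i) Let $(\pi_{\mathbf x})_{\mathbf x\in\mathbf R_+^n}$ be a family of strategies with $\pi_{\mathbf x}\in\Pi_{\mathbf x}$ for each $\mathbf x$. If the function $W(\mathbf x)=V_{\pi_{\mathbf x}}(\mathbf x)$ is a viscosity supersolution of the Hamilton–Jacobi–Bellman equation $$\max\{\mathbf a-\nabla u(\mathbf x),\ \mathcal L(u)(\mathbf x),\ f(\mathbf x)-u(\mathbf x)\}=0$$ in the interior of $\mathbf R_+^n$, then $W$ is the optimal value function, i.e. $W=V$. (ii) Suppose that for each $k\ge1$ there is a family of strategies $(\pi^k_{\mathbf x})_{\mathbf x\in\mathbf R_+^n}$ with $\pi^k_{\mathbf x}\in\Pi_{\mathbf x}$, such that $W(\mathbf x):=\lim_{k\to\infty}V_{\pi^k_{\mathbf x}}(\mathbf x)$ is a viscosity supersolution of the same equation in the interior of $\mathbf R_+^n$. Then $W=V$.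
   Context: **Notation.** $\mathbf{R}_+^n=[0,\infty)^n$; $\le$ on $\mathbf R^n$ is componentwise. **Model.** Fix $n\ge1$, $\mathbf p=(p_1,\dots,p_n)$ with $p_i>0$, $\mathbf a=(a_1,\dots,a_n)$ with $a_i>0$, $c>0$, $\lambda>0$. Let $(\tau_k)_{k\ge1}$ be the jump times of a Poisson process $N_t$ of intensity $\lambda$, and $(\mathbf U_k)_{k\ge1}$ i.i.d. random vectors in $\mathbf R_+^n$, independent of $N$, with distribution function $F$, $\mathbb E\|\mathbf U_k\|<\infty$, $F(\mathbf 0)=0$. $\mathcal F_t$ is generated by $\{(\tau_k,\mathbf U_k):\tau_k\le t\}$. For initial surplus $\mathbf x\in\mathbf R_+^n$, $\mathbf X_t=\mathbf x+\mathbf p t-\sum_{k=1}^{N_t}\mathbf U_k$. An admissible dividend strategy is a process $\mathbf L_t\in\mathbf R_+^n$, componentwise non-decreasing, càdlàg, adapted, with $\mathbf L_0\ge 0$ (and $\mathbf L_{0^-}=\mathbf 0$), $\mathbf L_t\le\mathbf X_t$ for $0\le t<\tau^{\mathbf L}$, where $\tau^{\mathbf L}:=\inf\{\tau_k:\mathbf X_{\tau_k}-\mathbf L_{\tau_k^-}\notin\mathbf R_+^n\}$, and $\mathbf L_t=\mathbf L_{\tau^{\mathbf L -}}$ for $t\ge\tau^{\mathbf L}$. The controlled surplus is $\mathbf X^{\mathbf L}_t=\mathbf X_t-\mathbf L_t$. $\Pi_{\mathbf x}$ is the set of pairs $\pi=(\mathbf L,\overline\tau)$ with $\mathbf L$ admissible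 and $\overline\tau$ a switch time (a $[0,\infty]$-valued stopping time). Let $B=\{(\mathbf x,\boldsymbol\alpha)\in\mathbf R_+^n\times\mathbf R_+^n:\mathbf x-\boldsymbol\alpha\notin\mathbf R_+^n\}$. The penalty $\upsilon:B\to\mathbf R$ is non-increasing in $\mathbf x$, non-decreasing in $\boldsymbol\alpha$, and $\mathbb E|\upsilon(\mathbf 0,\mathbf U_1)|<\infty$. The switch-value function $f:\mathbf R_+^n\to\mathbf R$ is either right continuous and non-decreasing, or continuous. With $\int_{0^-}^t e^{-cs}\mathbf a\cdot d\mathbf L_s=\mathbf a\cdot\mathbf L_0+\int_0^te^{-cs}\mathbf a\cdot d\mathbf L_s$, define $$V_\pi(\mathbf x)=\mathbb E_{\mathbf x}\Big(\int_{0^-}^{\overline\tau\wedge\tau^{\mathbf L}}e^{-cs}\mathbf a\cdot d\mathbf L_s+I_{\{\overline\tau<\tau^{\mathbf L}\}}e^{-c\overline\tau}f(\mathbf X^{\mathbf L}_{\overline\tau})\Big)-\mathbb E_{\mathbf x}\Big(I_{\{\overline\tau\ge\tau^{\mathbf L}\}}e^{-c\tau^{\mathbf L}}\upsilon(\mathbf X^{\mathbf L}_{\tau^{\mathbf L-}},\mathbf X^{\mathbf L}_{\tau^{\mathbf L-}}-\mathbf X^{\mathbf L}_{\tau^{\mathbf L}})\Big),$$ and the optimal value function $V(\mathbf x)=\sup_{\pi\in\Pi_{\mathbf x}}V_\pi(\mathbf x)$ (terms with $e^{-c\cdot\infty}$ are $0$). **Standing assumptions.** A function $h:\mathbf R_+^n\to\mathbf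 R$ satisfies the growth condition GC if $h/h_0$ is bounded above on $\mathbf R_+^n$, where $h_0(\mathbf x)=e^{\frac{c}{2n}\sum_{i=1}^n x_i/p_i}$. The functions $f$ and $S(\mathbf x):=\sup_{\{\boldsymbol\alpha:(\mathbf x,\boldsymbol\alpha)\in B\}}(-\upsilon(\mathbf x,\boldsymbol\alpha))$ satisfy GC, and $\mathcal R(\mathbf x):=\lambda\int_{\mathbf x-\boldsymbol\alpha\notin\mathbf R_+^n}\upsilon(\mathbf x,\boldsymbol\alpha)\,dF(\boldsymbol\alpha)$ is continuous on $\mathbf R_+^n$. **HJB equation.** $\mathcal L(W)(\mathbf x)=\mathbf p\cdot\nabla W(\mathbf x)-(c+\lambda)W(\mathbf x)+\mathcal I(W)(\mathbf x)-\mathcal R(\mathbf x)$ with $\mathcal I(W)(\mathbf x)=\lambda\int_{\mathbf x-\boldsymbol\alpha\in\mathbf R_+^n}W(\mathbf x-\boldsymbol\alpha)\,dF(\boldsymbol\alpha)$. In $\max\{\mathbf a-\nabla W,\mathcal L(W),f-W\}$ the maximum is over the $n$ components $a_i-\partial_{x_i}W$ together with the two other scalars. **Viscosity supersolution.** A locally Lipschitz $\overline u:\mathbf R_+^n\to\mathbf R$ is a viscosity supersolution at $\mathbf x$ if every continuously differentiable $\varphi:\mathbf R_+^n\to\mathbf R$ with $\varphi(\mathbf x)=\overline u(\mathbf x)$ such that $\overline u-\varphi$ reaches its minimum at $\mathbf x$ satisfies $\max\{\mathbf a-\nabla\varphi(\mathbf x),\mathcal L(\varphi)(\mathbf x),f(\mathbf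 x)-\varphi(\mathbf x)\}\le0$. *)

theory Defs
  imports "HOL-Analysis.Analysis" "HOL-Probability.Probability"
begin

text \<open>
  Throughout, \<open>\<le>\<close> on \<open>real ^ 'n\<close> is the componentwise order, so that \<open>{0..}\<close> is the closed
  orthant \<open>[0, \<infinity>)\<^sup>n\<close> with \<open>n = CARD('n)\<close>.  Sequences indexed by \<open>k \<ge> 1\<close> are functions on
  \<open>nat\<close> whose value at \<open>0\<close> is never used, and processes indexed by \<open>t \<ge> 0\<close> are functions on \<open>real\<close>
  whose values at negative times are never used.
\<close>

section \<open>The uncontrolled surplus\<close>

definition (in prob_space) poisson_process :: "real \<Rightarrow> (real \<Rightarrow> 'a \<Rightarrow> nat) \<Rightarrow> bool" where
  "poisson_process rate N \<longleftrightarrow>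
     (\<forall>t\<ge>0. N t \<in> measurable M (count_space UNIV)) \<and>
     (\<forall>\<omega>\<in>space M. N 0 \<omega> = 0 \<and> mono_on {0..} (\<lambda>t. N t \<omega>) \<and>
        (\<forall>t\<ge>0. ((\<lambda>s. N s \<omega>) \<longlongrightarrow> N t \<omega>) (at_right t))) \<and>
     (\<forall>s t. 0 \<le> s \<and> s < t \<longrightarrow>
        distr M (count_space UNIV) (\<lambda>\<omega>. N t \<omega> - N s \<omega>) = measure_pmf (poisson_pmf (rate * (t - s)))) \<and>
     (\<forall>(m::nat) t. 0 \<le> t 0 \<and> mono t \<longrightarrow>
        indep_vars (\<lambda>_. count_space UNIV) (\<lambda>j \<omega>. N (t (Suc j)) \<omega> - N (t j) \<omega>) {..<m})"

definition counting_process :: "(nat \<Rightarrow> 'w \<Rightarrow> real) \<Rightarrow> real \<Rightarrow> 'w \<Rightarrow> nat" where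
  "counting_process \<tau> t \<omega> = card {k. 1 \<le> k \<and> \<tau> k \<omega> \<le> t}"

definition surplus ::
  "real^'n \<Rightarrow> (nat \<Rightarrow> 'w \<Rightarrow> real) \<Rightarrow> (nat \<Rightarrow> 'w \<Rightarrow> real^'n) \<Rightarrow> real^'n \<Rightarrow> real \<Rightarrow> 'w \<Rightarrow> real^'n" where
  "surplus p \<tau> U x t \<omega> = x + t *\<^sub>R p - (\<Sum>k = 1..counting_process \<tau> t \<omega>. U k \<omega>)"

text \<open>
  The time index is \<open>ennreal\<close> so that \<^const>\<open>stopping_time\<close> can be used for
  \<open>[0, \<infinity>]\<close>-valued stopping times; at index \<open>\<infinity>\<close> its condition is vacuous.
\<close>

definition claim_filtration ::
  "'w measure \<Rightarrow> (nat \<Rightarrow> 'w \<Rightarrow> real) \<Rightarrow> (nat \<Rightarrow> 'w \<Rightarrow> real^'n) \<Rightarrow> ennreal \<Rightarrow> 'w measure" where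
  "claim_filtration M \<tau> U t = sigma (space M)
     {{\<omega> \<in> space M. \<tau> k \<omega> \<le> s \<and> U k \<omega> \<in> A} | k s A.
        1 \<le> k \<and> 0 \<le> s \<and> ennreal s \<le> t \<and> A \<in> sets borel}"

section \<open>Admissible strategies\<close>

definition left_limit :: "(real \<Rightarrow> 'w \<Rightarrow> 'b::t2_space) \<Rightarrow> real \<Rightarrow> 'w \<Rightarrow> 'b" where
  "left_limit Y t \<omega> = Lim (at_left t) (\<lambda>s. Y s \<omega>)"

definition ruin_time ::
  "real^'n \<Rightarrow> (nat \<Rightarrow> 'w \<Rightarrow> real) \<Rightarrow> (nat \<Rightarrow> 'w \<Rightarrow> real^'n) \<Rightarrow> real^'n
    \<Rightarrow> (real \<Rightarrow> 'w \<Rightarrow> real^'n) \<Rightarrow> 'w \<Rightarrow> ennreal" where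
  "ruin_time p \<tau> U x L \<omega> =
     Inf {ennreal (\<tau> k \<omega>) | k. 1 \<le> k \<and>
            surplus p \<tau> U x (\<tau> k \<omega>) \<omega> - left_limit L (\<tau> k \<omega>) \<omega> \<notin> {0..}}"

definition controlled_surplus ::
  "real^'n \<Rightarrow> (nat \<Rightarrow> 'w \<Rightarrow> real) \<Rightarrow> (nat \<Rightarrow> 'w \<Rightarrow> real^'n) \<Rightarrow> real^'n
    \<Rightarrow> (real \<Rightarrow> 'w \<Rightarrow> real^'n) \<Rightarrow> real \<Rightarrow> 'w \<Rightarrow> real^'n" where
  "controlled_surplus p \<tau> U x L t \<omega> = surplus p \<tau> U x t \<omega> - L t \<omega>"

definition admissible ::
  "'w measure \<Rightarrow> real^'n \<Rightarrow> (nat \<Rightarrow> 'w \<Rightarrow> real) \<Rightarrow> (nat \<Rightarrow> 'w \<Rightarrow> real^'n) \<Rightarrow> real^'n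
    \<Rightarrow> (real \<Rightarrow> 'w \<Rightarrow> real^'n) \<Rightarrow> bool" where
  "admissible M p \<tau> U x L \<longleftrightarrow>
     (\<forall>t\<ge>0. L t \<in> borel_measurable (claim_filtration M \<tau> U (ennreal t))) \<and>
     (\<forall>\<omega>\<in>space M.
        (\<forall>t\<ge>0. 0 \<le> L t \<omega>) \<and>
        mono_on {0..} (\<lambda>t. L t \<omega>) \<and>
        (\<forall>t\<ge>0. ((\<lambda>s. L s \<omega>) \<longlongrightarrow> L t \<omega>) (at_right t)) \<and>
        (\<forall>t>0. \<exists>l. ((\<lambda>s. L s \<omega>) \<longlongrightarrow> l) (at_left t)) \<and>
        (\<forall>t\<ge>0. ennreal t < ruin_time p \<tau> U x L \<omega> \<longrightarrow> L t \<omega> \<le> surplus p \<tau> U x t \<omega>) \<and>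
        (\<forall>t\<ge>0. ruin_time p \<tau> U x L \<omega> \<le> ennreal t \<longrightarrow>
           L t \<omega> = left_limit L (enn2real (ruin_time p \<tau> U x L \<omega>)) \<omega>))"

definition strategies ::
  "'w measure \<Rightarrow> real^'n \<Rightarrow> (nat \<Rightarrow> 'w \<Rightarrow> real) \<Rightarrow> (nat \<Rightarrow> 'w \<Rightarrow> real^'n) \<Rightarrow> real^'n
    \<Rightarrow> ((real \<Rightarrow> 'w \<Rightarrow> real^'n) \<times> ('w \<Rightarrow> ennreal)) set" where
  "strategies M p \<tau> U x =
     {(L, T). admissible M p \<tau> U x L \<and> stopping_time (claim_filtration M \<tau> U) T}"

section \<open>Value functions\<close>

definition exit_set :: "((real^'n) \<times> (real^'n)) set" where
  "exit_set = {(x, \<alpha>). x \<in> {0..} \<and> \<alpha> \<in> {0..} \<and> x - \<alpha> \<notin> {0..}}"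

definition discount :: "real \<Rightarrow> ennreal \<Rightarrow> real" where
  "discount c t = (if t = \<infinity> then 0 else exp (- c * enn2real t))"

text \<open>
  The integrator of the \<open>i\<close>-th Stieltjes integral is extended by its value at \<open>0\<close> to negative times,
  so the lump sum \<open>L 0\<close> is carried by the separate summand only.
\<close>

definition discounted_dividends ::
  "real^'n \<Rightarrow> real \<Rightarrow> (real \<Rightarrow> 'w \<Rightarrow> real^'n) \<Rightarrow> ennreal \<Rightarrow> 'w \<Rightarrow> real" where
  "discounted_dividends a c L t \<omega> =
     a \<bullet> L 0 \<omega> +
     (\<Sum>i\<in>UNIV. a $ i *
        (LINT s:{s. 0 < s \<and> ennreal s \<le> t}|interval_measure (\<lambda>r. L (max 0 r) \<omega> $ i). exp (- c * s)))"

definition reward ::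
  "real^'n \<Rightarrow> real^'n \<Rightarrow> real \<Rightarrow> (nat \<Rightarrow> 'w \<Rightarrow> real) \<Rightarrow> (nat \<Rightarrow> 'w \<Rightarrow> real^'n) \<Rightarrow> (real^'n \<Rightarrow> real)
    \<Rightarrow> real^'n \<Rightarrow> (real \<Rightarrow> 'w \<Rightarrow> real^'n) \<times> ('w \<Rightarrow> ennreal) \<Rightarrow> 'w \<Rightarrow> real" where
  "reward p a c \<tau> U f x = (\<lambda>(L, T) \<omega>.
     discounted_dividends a c L (min (T \<omega>) (ruin_time p \<tau> U x L \<omega>)) \<omega> +
     (if T \<omega> < ruin_time p \<tau> U x L \<omega>
      then discount c (T \<omega>) * f (controlled_surplus p \<tau> U x L (enn2real (T \<omega>)) \<omega>) else 0))"

definition ruin_penalty ::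
  "real^'n \<Rightarrow> real \<Rightarrow> (nat \<Rightarrow> 'w \<Rightarrow> real) \<Rightarrow> (nat \<Rightarrow> 'w \<Rightarrow> real^'n) \<Rightarrow> (real^'n \<Rightarrow> real^'n \<Rightarrow> real)
    \<Rightarrow> real^'n \<Rightarrow> (real \<Rightarrow> 'w \<Rightarrow> real^'n) \<times> ('w \<Rightarrow> ennreal) \<Rightarrow> 'w \<Rightarrow> real" where
  "ruin_penalty p c \<tau> U \<upsilon> x = (\<lambda>(L, T) \<omega>.
     let \<rho> = ruin_time p \<tau> U x L \<omega>;
         XL = controlled_surplus p \<tau> U x L;
         r = enn2real \<rho>
     in if \<rho> \<le> T \<omega>
        then discount c \<rho> * \<upsilon> (left_limit XL r \<omega>) (left_limit XL r \<omega> - XL r \<omega>) else 0)"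

text \<open>
  A continuous \<open>f\<close> is only bounded from above by the growth condition, so the expected reward may be
  \<open>-\<infinity>\<close>; the Bochner integral would return \<open>0\<close> there.  Hence expectations and values of strategies
  are extended reals.
\<close>

definition extended_expectation :: "'w measure \<Rightarrow> ('w \<Rightarrow> real) \<Rightarrow> ereal" where
  "extended_expectation M Y =
     enn2ereal (\<integral>\<^sup>+ \<omega>. ennreal (Y \<omega>) \<partial>M) - enn2ereal (\<integral>\<^sup>+ \<omega>. ennreal (- Y \<omega>) \<partial>M)"

definition strategy_value ::
  "'w measure \<Rightarrow> real^'n \<Rightarrow> real^'n \<Rightarrow> real \<Rightarrow> (nat \<Rightarrow> 'w \<Rightarrow> real) \<Rightarrow> (nat \<Rightarrow> 'w \<Rightarrow> real^'n)
    \<Rightarrow> (real^'n \<Rightarrow> real^'n \<Rightarrow> real) \<Rightarrow> (real^'n \<Rightarrow> real)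
    \<Rightarrow> (real \<Rightarrow> 'w \<Rightarrow> real^'n) \<times> ('w \<Rightarrow> ennreal) \<Rightarrow> real^'n \<Rightarrow> ereal" where
  "strategy_value M p a c \<tau> U \<upsilon> f \<pi> x =
     extended_expectation M (reward p a c \<tau> U f x \<pi>) -
     extended_expectation M (ruin_penalty p c \<tau> U \<upsilon> x \<pi>)"

definition optimal_value ::
  "'w measure \<Rightarrow> real^'n \<Rightarrow> real^'n \<Rightarrow> real \<Rightarrow> (nat \<Rightarrow> 'w \<Rightarrow> real) \<Rightarrow> (nat \<Rightarrow> 'w \<Rightarrow> real^'n)
    \<Rightarrow> (real^'n \<Rightarrow> real^'n \<Rightarrow> real) \<Rightarrow> (real^'n \<Rightarrow> real) \<Rightarrow> real^'n \<Rightarrow> ereal" where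
  "optimal_value M p a c \<tau> U \<upsilon> f x =
     (SUP \<pi>\<in>strategies M p \<tau> U x. strategy_value M p a c \<tau> U \<upsilon> f \<pi> x)"

section \<open>The Hamilton-Jacobi-Bellman equation\<close>

text \<open>
  Below, \<open>\<mu>\<close> is the law of a claim, i.e. the measure \<open>dF\<close> for the distribution function \<open>F\<close>.
\<close>

definition R_term ::
  "real \<Rightarrow> (real^'n) measure \<Rightarrow> (real^'n \<Rightarrow> real^'n \<Rightarrow> real) \<Rightarrow> real^'n \<Rightarrow> real" where
  "R_term rate \<mu> \<upsilon> x = rate * (LINT \<alpha>:{\<alpha>. (x, \<alpha>) \<in> exit_set}|\<mu>. \<upsilon> x \<alpha>)"

definition I_term :: "real \<Rightarrow> (real^'n) measure \<Rightarrow> (real^'n \<Rightarrow> real) \<Rightarrow> real^'n \<Rightarrow> real" where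
  "I_term rate \<mu> W x = rate * (LINT \<alpha>:{\<alpha>. \<alpha> \<in> {0..} \<and> x - \<alpha> \<in> {0..}}|\<mu>. W (x - \<alpha>))"

text \<open>In the next two definitions \<open>g\<close> stands for the gradient of \<open>W\<close> at \<open>x\<close>.\<close>

definition HJB_generator ::
  "real^'n \<Rightarrow> real \<Rightarrow> real \<Rightarrow> (real^'n) measure \<Rightarrow> (real^'n \<Rightarrow> real^'n \<Rightarrow> real)
    \<Rightarrow> (real^'n \<Rightarrow> real) \<Rightarrow> real^'n \<Rightarrow> real^'n \<Rightarrow> real" where
  "HJB_generator p c rate \<mu> \<upsilon> W g x =
     p \<bullet> g - (c + rate) * W x + I_term rate \<mu> W x - R_term rate \<mu> \<upsilon> x"

definition HJB_operator ::
  "real^'n \<Rightarrow> real^'n \<Rightarrow> real \<Rightarrow> real \<Rightarrow> (real^'n) measure \<Rightarrow> (real^'n \<Rightarrow> real^'n \<Rightarrow> real)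
    \<Rightarrow> (real^'n \<Rightarrow> real) \<Rightarrow> (real^'n \<Rightarrow> real) \<Rightarrow> real^'n \<Rightarrow> real^'n \<Rightarrow> real" where
  "HJB_operator p a c rate \<mu> \<upsilon> f W g x =
     Max (range (\<lambda>i. a $ i - g $ i) \<union> {HJB_generator p c rate \<mu> \<upsilon> W g x, f x - W x})"

text \<open>
  Derivatives at boundary points are taken within the orthant, where they are still unique.
\<close>

definition C1_with_gradient :: "(real^'n \<Rightarrow> real) \<Rightarrow> (real^'n \<Rightarrow> real^'n) \<Rightarrow> bool" where
  "C1_with_gradient \<phi> G \<longleftrightarrow>
     (\<forall>x\<in>{0..}. (\<phi> has_derivative (\<lambda>h. G x \<bullet> h)) (at x within {0..})) \<and>
     continuous_on {0..} G"

definition locally_lipschitz_on :: "(real^'n) set \<Rightarrow> (real^'n \<Rightarrow> real) \<Rightarrow> bool" where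
  "locally_lipschitz_on X u \<longleftrightarrow> (\<forall>x\<in>X. \<exists>r>0. \<exists>K. K-lipschitz_on (cball x r \<inter> X) u)"

definition viscosity_supersolution_at ::
  "real^'n \<Rightarrow> real^'n \<Rightarrow> real \<Rightarrow> real \<Rightarrow> (real^'n) measure \<Rightarrow> (real^'n \<Rightarrow> real^'n \<Rightarrow> real)
    \<Rightarrow> (real^'n \<Rightarrow> real) \<Rightarrow> (real^'n \<Rightarrow> real) \<Rightarrow> real^'n \<Rightarrow> bool" where
  "viscosity_supersolution_at p a c rate \<mu> \<upsilon> f u x \<longleftrightarrow>
     locally_lipschitz_on {0..} u \<and>
     (\<forall>\<phi> G. C1_with_gradient \<phi> G \<and> \<phi> x = u x \<and> (\<forall>y\<in>{0..}. u x - \<phi> x \<le> u y - \<phi> y) \<longrightarrow>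
        HJB_operator p a c rate \<mu> \<upsilon> f \<phi> (G x) x \<le> 0)"

section \<open>Standing assumptions\<close>

definition growth_condition :: "real^'n \<Rightarrow> real \<Rightarrow> (real^'n \<Rightarrow> real) \<Rightarrow> bool" where
  "growth_condition p c h \<longleftrightarrow>
     (\<exists>K. \<forall>x\<in>{0..}. h x / exp (c / (2 * real CARD('n)) * (\<Sum>i\<in>UNIV. x $ i / p $ i)) \<le> K)"

locale dividend_model = prob_space M
  for M :: "'w measure" +
  fixes p a :: "real^'n" and c rate :: real
    and \<tau> :: "nat \<Rightarrow> 'w \<Rightarrow> real" and U :: "nat \<Rightarrow> 'w \<Rightarrow> real^'n"
    and \<upsilon> :: "real^'n \<Rightarrow> real^'n \<Rightarrow> real" and f :: "real^'n \<Rightarrow> real"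
  assumes p_pos: "\<And>i. 0 < p $ i" and a_pos: "\<And>i. 0 < a $ i"
    and c_pos: "0 < c" and rate_pos: "0 < rate"
  \<comment> \<open>\<open>\<tau>\<close> enumerates the jump times of a Poisson process\<close>
    and tau_pos: "\<And>\<omega>. \<omega> \<in> space M \<Longrightarrow> 0 < \<tau> 1 \<omega>"
    and tau_increasing: "\<And>\<omega> k. \<omega> \<in> space M \<Longrightarrow> 1 \<le> k \<Longrightarrow> \<tau> k \<omega> < \<tau> (Suc k) \<omega>"
    and tau_locally_finite: "\<And>\<omega> t. \<omega> \<in> space M \<Longrightarrow> finite {k. 1 \<le> k \<and> \<tau> k \<omega> \<le> t}"
    and poisson: "poisson_process rate (counting_process \<tau>)"
    and U_nonneg: "\<And>\<omega> k. \<omega> \<in> space M \<Longrightarrow> 1 \<le> k \<Longrightarrow> 0 \<le> U k \<omega>"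
    and U_indep: "indep_vars (\<lambda>_. borel) U {1..}"
    and U_ident: "\<And>k. 1 \<le> k \<Longrightarrow> distr M borel (U k) = distr M borel (U 1)"
    and U_indep_poisson:
      "indep_set
         (sets (vimage_algebra (space M)
            (\<lambda>\<omega>. \<lambda>t\<in>{0..}. counting_process \<tau> t \<omega>) (PiM {0..} (\<lambda>_. count_space UNIV))))
         (sets (vimage_algebra (space M) (\<lambda>\<omega>. \<lambda>k\<in>{1..}. U k \<omega>) (PiM {1..} (\<lambda>_. borel))))"
    and U_mean: "\<And>k. 1 \<le> k \<Longrightarrow> integrable M (\<lambda>\<omega>. norm (U k \<omega>))"
  \<comment> \<open>\<open>F 0 = 0\<close> for the distribution function \<open>F\<close> of the claims\<close>
    and F_zero: "prob {\<omega> \<in> space M. U 1 \<omega> \<le> 0} = 0"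
  \<comment> \<open>only the restriction of \<open>\<upsilon>\<close> to \<^const>\<open>exit_set\<close> matters; componentwise monotonicity does
      not imply Borel measurability in dimension at least two\<close>
    and penalty_measurable: "case_prod \<upsilon> \<in> borel_measurable (restrict_space borel exit_set)"
    and penalty_antimono: "\<And>x y \<alpha>. (x, \<alpha>) \<in> exit_set \<Longrightarrow> (y, \<alpha>) \<in> exit_set \<Longrightarrow> x \<le> y \<Longrightarrow> \<upsilon> y \<alpha> \<le> \<upsilon> x \<alpha>"
    and penalty_mono: "\<And>x \<alpha> \<beta>. (x, \<alpha>) \<in> exit_set \<Longrightarrow> (x, \<beta>) \<in> exit_set \<Longrightarrow> \<alpha> \<le> \<beta> \<Longrightarrow> \<upsilon> x \<alpha> \<le> \<upsilon> x \<beta>"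
    and penalty_integrable: "integrable M (\<lambda>\<omega>. \<upsilon> 0 (U 1 \<omega>))"
    and f_regular:
      "(mono_on {0..} f \<and> (\<forall>x\<in>{0..}. (f \<longlongrightarrow> f x) (at x within {x..}))) \<or> continuous_on {0..} f"
    and f_growth: "growth_condition p c f"
    and S_finite: "\<And>x. x \<in> {0..} \<Longrightarrow> bdd_above ((\<lambda>\<alpha>. - \<upsilon> x \<alpha>) ` {\<alpha>. (x, \<alpha>) \<in> exit_set})"
    and S_growth: "growth_condition p c (\<lambda>x. SUP \<alpha>\<in>{\<alpha>. (x, \<alpha>) \<in> exit_set}. - \<upsilon> x \<alpha>)"
    and R_continuous: "continuous_on {0..} (R_term rate (distr M borel (U 1)) \<upsilon>)"

end

theory Submission
  imports Defs
begin

text \<open>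
  Let \<open>u\<close> be a supersolution and \<open>Y\<close> the controlled surplus of a strategy; the point is that
  \<open>u x\<close> dominates the value of the strategy.  Minimising
  \<open>u(y) + K \<bar>y - x - s v\<bar>\<^sup>2 - q s\<close> over a tube around a segment produces test functions touching \<open>u\<close>
  from below, and the viscosity inequalities then say that \<open>u (x + h) \<ge> u x + a \<bullet> h\<close> for \<open>h \<ge> 0\<close>, that
  \<open>u (x + h p) - u x\<close> is at most the integral over \<open>(0, h]\<close> of \<open>g (x + s p)\<close>, where
  \<open>g = (c + \<lambda>) u - I u + R\<close>, and that \<open>f \<le> u\<close>.  Along a path of \<open>Y\<close> this bounds
  \<open>u (Y\<^sub>t) + a \<bullet> L\<^sub>t\<close> by \<open>u x\<close> plus the integral of \<open>g (Y\<^sub>s\<^sub>-)\<close> plus the jumps of \<open>u\<close> at the claims.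
  Averaging over an independent exponential time horizon of rate \<open>c\<close> introduces the discount factor.
  By the compensation formula for the marked Poisson process the claim jumps and the nonlocal part of
  \<open>g\<close> cancel in expectation.  Since \<open>u\<close> is increasing it is bounded below, so the discounted
  terminal value of \<open>u\<close> is negligible from below as the horizon tends to infinity.
\<close>

section \<open>Test functions\<close>

text \<open>The operator evaluates its nonlocal term at the test function itself, and the test
  function must lie below \<open>u\<close> on the whole orthant. A paraboloid touching
  \<open>u\<close> locally is therefore extended to a global C1 minorant that stays within \<eta> of
  \<open>u\<close> on a large ball, and \<eta> tends to 0. The inequalities are available only at
  interior points; boundary points are reached by sliding along the strictly positive vector
  \<open>p\<close>. Since \<open>u\<close> is merely locally Lipschitz and, for a claim law with
  atoms, \<open>g\<close> is in general only right continuous in the componentwise order, no chain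
  rule along paths is invoked. The drift estimate is a comparison of Riemann sums, and along a path
  dividends are postponed to the ends of short cells, so that \<open>g\<close> is approached from
  above. The clock replaces integration by parts: dividends, claim jumps and running terms all
  receive their discount factors from Fubini applied to one undiscounted inequality. The growth
  condition allows growth at rate c / 2 along the drift, half the discount rate, which keeps the
  positive part of the reward integrable; its negative part may have infinite mean and is treated
  apart.\<close>

lemma C1_const: "C1_with_gradient (\<lambda>_. k) (\<lambda>_. 0)"
  unfolding C1_with_gradient_def by (auto intro!: derivative_eq_intros)

lemma C1_inner: "C1_with_gradient (\<lambda>x. v \<bullet> x) (\<lambda>_. v)"
  unfolding C1_with_gradient_def by (auto intro!: derivative_eq_intros)

lemma C1_add:
  assumes "C1_with_gradient \<phi> G" "C1_with_gradient \<psi> H"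
  shows "C1_with_gradient (\<lambda>x. \<phi> x + \<psi> x) (\<lambda>x. G x + H x)"
  using assms unfolding C1_with_gradient_def
  by (auto intro!: derivative_eq_intros continuous_intros simp: inner_add_left)

lemma C1_continuous: "C1_with_gradient \<phi> G \<Longrightarrow> continuous_on {0..} \<phi>"
  unfolding C1_with_gradient_def
  by (meson continuous_on_eq_continuous_within has_derivative_continuous)

lemma C1_mult:
  assumes "C1_with_gradient \<phi> G" "C1_with_gradient \<psi> H"
  shows "C1_with_gradient (\<lambda>x. \<phi> x * \<psi> x) (\<lambda>x. \<phi> x *\<^sub>R H x + \<psi> x *\<^sub>R G x)"
  using assms C1_continuous[OF assms(1)] C1_continuous[OF assms(2)] unfolding C1_with_gradient_def
  by (auto intro!: derivative_eq_intros continuous_intros simp: inner_add_left algebra_simps)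

lemma C1_compose:
  fixes b b' :: "real \<Rightarrow> real"
  assumes "C1_with_gradient \<phi> G" "\<And>t. (b has_real_derivative b' t) (at t)" "continuous_on UNIV b'"
  shows "C1_with_gradient (\<lambda>x. b (\<phi> x)) (\<lambda>x. b' (\<phi> x) *\<^sub>R G x)"
proof -
  have c: "continuous_on {0..} \<phi>" using C1_continuous[OF assms(1)] .
  have "continuous_on {0..} (\<lambda>x. b' (\<phi> x))"
    using continuous_on_compose2[OF assms(3) c] by auto
  moreover have "((\<lambda>x. b (\<phi> x)) has_derivative (\<lambda>h. (b' (\<phi> x) *\<^sub>R G x) \<bullet> h)) (at x within {0..})"
    if "x \<in> {0..}" for x
  proof -
    have "(\<phi> has_derivative (\<lambda>h. G x \<bullet> h)) (at x within {0..})"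
      using assms(1) that unfolding C1_with_gradient_def by auto
    from has_derivative_compose[OF this, of b "\<lambda>h. b' (\<phi> x) * h"] assms(2)[of "\<phi> x"]
    have "((\<lambda>x. b (\<phi> x)) has_derivative (\<lambda>h. b' (\<phi> x) * (G x \<bullet> h))) (at x within {0..})"
      by (simp add: has_field_derivative_def)
    then show ?thesis by (simp add: inner_scaleR_left)
  qed
  ultimately show ?thesis using assms(1) unfolding C1_with_gradient_def
    by (intro conjI ballI continuous_on_scaleR) (simp_all only:)
qed

lemma C1_sqnorm: "C1_with_gradient (\<lambda>x. (norm (x - z))\<^sup>2) (\<lambda>x. 2 *\<^sub>R (x - z))"
  unfolding C1_with_gradient_def power2_norm_eq_inner
  by (auto intro!: derivative_eq_intros continuous_intros simp: algebra_simps inner_commute)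

section \<open>Polynomials, bump functions and C1 minorants\<close>

lemma C1_polynomial:
  fixes q :: "real^'n \<Rightarrow> real"
  assumes "real_polynomial_function q" shows "\<exists>G. C1_with_gradient q G"
  using assms
proof (induction q rule: real_polynomial_function.induct)
  case (linear h)
  \<comment> \<open>Riesz representation: with 1 viewed as a vector of the real line,
    \<open>adjoint h 1\<close> is the constant gradient of the linear functional.\<close>
  have "h x = (adjoint h 1 :: real^'n) \<bullet> x" for x
    using adjoint_works[OF bounded_linear.linear[OF linear], of x 1]
    by (simp add: inner_commute)
  then have "h = (\<lambda>x. adjoint h 1 \<bullet> x)" by auto
  then show ?case using C1_inner[of "adjoint h 1"] by metis
qed (blast intro: C1_const C1_add C1_mult)+

text \<open>The square of the positive part is C1, so P / (P + Q), with P and Q the squared positive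
  parts of r - t and t - l, is a C1 bump: \<open>P\<close> vanishes beyond \<open>r\<close>,
  \<open>Q\<close> before \<open>l\<close>, and \<open>l < r\<close> keeps the denominator
  positive.\<close>

lemma real_bump:
  fixes l r :: real
  assumes "l < r"
  obtains b b' where "\<And>t. (b has_real_derivative b' t) (at t)" "continuous_on UNIV b'"
    "\<And>t. 0 \<le> b t" "\<And>t. b t \<le> (1::real)" "\<And>t. t \<le> l \<Longrightarrow> b t = 1" "\<And>t. t \<ge> r \<Longrightarrow> b t = 0"
proof -
  have sq: "((\<lambda>t::real. (max 0 t)\<^sup>2) has_real_derivative 2 * max 0 t) (at t)" for t
  proof (cases t "0::real" rule: linorder_cases)
    case less
    have "((\<lambda>_. 0) has_real_derivative 2 * max 0 t) (at t)" using less by simp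
    moreover have "\<forall>\<^sub>F x in nhds t. (\<lambda>t. (max 0 t)\<^sup>2) x = 0"
      using eventually_nhds_in_open[of "{..<0}" t] less by (auto elim!: eventually_mono)
    ultimately show ?thesis by (subst DERIV_cong_ev) auto
  next
    case greater
    have "((\<lambda>t. t\<^sup>2) has_real_derivative 2 * max 0 t) (at t)" using greater
      by (auto intro!: derivative_eq_intros)
    moreover have "\<forall>\<^sub>F x in nhds t. (\<lambda>t. (max 0 t)\<^sup>2) x = x\<^sup>2"
      using eventually_nhds_in_open[of "{0<..}" t] greater by (auto elim!: eventually_mono)
    ultimately show ?thesis by (subst DERIV_cong_ev) auto
  next
    case equal
    have "((\<lambda>h::real. (max 0 h)\<^sup>2 / h) \<longlongrightarrow> 0) (at 0)"
    proof (rule Lim_null_comparison)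
      show "\<forall>\<^sub>F h::real in at 0. norm ((max 0 h)\<^sup>2 / h) \<le> \<bar>h\<bar>"
        by (auto simp: eventually_at_filter max_def power2_eq_square)
      show "((\<lambda>h::real. \<bar>h\<bar>) \<longlongrightarrow> 0) (at 0)" by (auto intro!: tendsto_eq_intros)
    qed
    then show ?thesis using equal by (simp add: DERIV_def)
  qed
  define P where "P t = (max 0 (r - t))\<^sup>2" for t
  define Q where "Q t = (max 0 (t - l))\<^sup>2" for t
  define b where "b t = P t / (P t + Q t)" for t
  define P' where "P' t = - (2 * max 0 (r - t))" for t
  define Q' where "Q' t = 2 * max 0 (t - l)" for t
  define b' where "b' t = (P' t * (P t + Q t) - P t * (P' t + Q' t)) / ((P t + Q t) * (P t + Q t))" for t
  have dP: "(P has_real_derivative P' t) (at t)" for t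
  proof -
    have "((\<lambda>t. r - t) has_real_derivative -1) (at t)" by (auto intro!: derivative_eq_intros)
    from DERIV_chain'[OF this sq] show ?thesis unfolding P_def[abs_def] P'_def by (simp add: algebra_simps)
  qed
  have dQ: "(Q has_real_derivative Q' t) (at t)" for t
  proof -
    have "((\<lambda>t. t - l) has_real_derivative 1) (at t)" by (auto intro!: derivative_eq_intros)
    from DERIV_chain'[OF this sq] show ?thesis unfolding Q_def[abs_def] Q'_def by (simp add: algebra_simps)
  qed
  have pos: "P t + Q t > 0" for t
  proof (cases "t < r")
    case True then have "P t > 0" unfolding P_def by auto
    then show ?thesis unfolding Q_def by (simp add: add_pos_nonneg)
  next
    case False then have "Q t > 0" unfolding Q_def using assms by auto
    then show ?thesis unfolding P_def by (simp add: add_nonneg_pos)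
  qed
  have db: "(b has_real_derivative b' t) (at t)" for t
    unfolding b_def b'_def
    using pos[of t] by (auto intro!: derivative_eq_intros dP dQ)
  have "continuous_on UNIV b'" unfolding b'_def
    using pos unfolding P_def Q_def P'_def Q'_def
    by (auto intro!: continuous_intros simp: less_le)
  moreover have "0 \<le> b t" "b t \<le> 1" for t
    unfolding b_def using pos[of t] by (auto simp: P_def Q_def divide_simps)
  moreover have "b t = 1" if "t \<le> l" for t
    using that pos[of t] unfolding b_def Q_def by (simp add: max_def)
  moreover have "b t = 0" if "t \<ge> r" for t
    using that unfolding b_def P_def by (simp add: max_def)
  ultimately show ?thesis using that db by blast
qed

text \<open>Averaging a decreasing function over \<open>[t, t + 1]\<close> keeps it below its value at \<open>t\<close>; doing so
  twice makes it continuously differentiable.\<close>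

lemma antimono_C1_minorant:
  fixes m :: "real \<Rightarrow> real"
  assumes m: "antimono m"
  obtains J J' where "\<And>t. (J has_real_derivative J' t) (at t)" "continuous_on UNIV J'" "\<And>t. J t \<le> m t"
proof -
  have int: "m integrable_on {s..t}" for s t
  proof -
    have "(\<lambda>x. - m x) integrable_on {s..t}"
    proof (rule integrable_on_mono_on, rule mono_onI)
      fix x y :: real assume "x \<le> y"
      from antimonoD[OF m this] show "- m x \<le> - m y" by (rule le_imp_neg_le)
    qed
    then show ?thesis by (simp add: integrable_neg_iff)
  qed
  define J1 where "J1 t = integral {t..t+1} m" for t
  have c1: "continuous_on UNIV J1"
  proof -
    have "isCont J1 t" for t
    proof -
      \<comment> \<open>With base point -b to the left of all windows near \<open>t\<close>, the
        moving average is locally a difference of two indefinite integrals started at -b.\<close>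
      define b where "b = \<bar>t\<bar> + 2"
      have c: "continuous_on {-b..b} (\<lambda>x. integral {-b..x} m)"
        by (rule indefinite_integral_continuous_1[OF int])
      have e: "J1 s = integral {-b..s+1} m - integral {-b..s} m" if "s > -b" for s
        unfolding J1_def using Henstock_Kurzweil_Integration.integral_combine[of "-b" s "s+1" m, OF _ _ int] that by simp
      have "continuous_on {-b<..<b-1} (\<lambda>s. integral {-b..s+1} m - integral {-b..s} m)"
        by (intro continuous_intros continuous_on_compose2[OF c]) auto
      then have "continuous_on {-b<..<b-1} J1"
        by (rule continuous_on_eq) (auto simp: e)
      then show ?thesis by (rule continuous_on_interior) (auto simp: b_def interior_open)
    qed
    then show ?thesis by (simp add: continuous_at_imp_continuous_on)
  qed
  have int1: "J1 integrable_on {s..t}" for s t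
    using c1 by (intro integrable_continuous_real continuous_on_subset[OF c1]) auto
  define J where "J t = integral {t..t+1} J1" for t
  define J' where "J' t = J1 (t+1) - J1 t" for t
  have "(J has_real_derivative J' t) (at t)" for t
  proof -
    define b where "b = \<bar>t\<bar> + 2"
    have d: "((\<lambda>x. integral {-b..x} J1) has_real_derivative J1 s) (at s)" if "s \<in> {-b<..<b}" for s
    proof -
      have "((\<lambda>x. integral {-b..x} J1) has_real_derivative J1 s) (at s within {-b..b})"
        by (rule integral_has_real_derivative) (use that continuous_on_subset[OF c1] in auto)
      then show ?thesis using that by (simp add: at_within_interior[of s "{-b..b}"])
    qed
    have "((\<lambda>s. integral {-b..s+1} J1 - integral {-b..s} J1) has_real_derivative J' t) (at t)"
      unfolding J'_def
    proof (rule DERIV_diff)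
      have "t + 1 \<in> {-b<..<b}" by (auto simp: b_def)
      from d[OF this] show "((\<lambda>s. integral {-b..s+1} J1) has_real_derivative J1 (t + 1)) (at t)"
        by (rule DERIV_shift[THEN iffD1])
      show "((\<lambda>s. integral {-b..s} J1) has_real_derivative J1 t) (at t)"
        by (rule d) (auto simp: b_def)
    qed
    moreover have "\<forall>\<^sub>F s in nhds t. J s = integral {-b..s+1} J1 - integral {-b..s} J1"
    proof (rule eventually_mono)
      show "\<forall>\<^sub>F s in nhds t. s \<in> {-b<..}"
        by (rule eventually_nhds_in_open) (auto simp: b_def)
      fix s assume "s \<in> {-b<..}"
      then show "J s = integral {-b..s+1} J1 - integral {-b..s} J1"
        unfolding J_def using Henstock_Kurzweil_Integration.integral_combine[of "-b" s "s+1" J1, OF _ _ int1] by simp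
    qed
    ultimately show ?thesis by (rule DERIV_cong_ev[OF refl _ refl, THEN iffD2, rotated])
  qed
  moreover have "continuous_on UNIV J'" unfolding J'_def
    by (intro continuous_intros continuous_on_compose2[OF c1]) auto
  moreover have "J t \<le> m t" for t
  proof -
    have "J1 s \<le> m t" if "s \<ge> t" for s
    proof -
      have "J1 s \<le> integral {s..s+1} (\<lambda>_. m t)" unfolding J1_def
      proof (rule integral_le[OF int])
        fix x assume "x \<in> {s..s+1}"
        then have "t \<le> x" using that by auto
        then show "m x \<le> m t" by (rule antimonoD[OF m])
      qed auto
      then show ?thesis by simp
    qed
    then have "J t \<le> integral {t..t+1} (\<lambda>_. m t)" unfolding J_def
      by (intro integral_le[OF int1]) auto
    then show ?thesis by simp
  qed
  ultimately show ?thesis by (rule that)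
qed

text \<open>The infimum of \<open>u\<close> over the points of the orthant with squared norm at most
  t is decreasing in t and finite by compactness. Its C1 minorant is composed with the squared norm,
  which, unlike the norm, is C1 at the origin.\<close>

lemma continuous_minorant_C1:
  fixes u :: "real^'n \<Rightarrow> real"
  assumes u: "continuous_on {0..} u"
  obtains w G where "C1_with_gradient w G" "\<And>y. y \<in> {0..} \<Longrightarrow> w y \<le> u y"
proof -
  define B where "B t = {0..} \<inter> cball (0::real^'n) (sqrt (max 0 t))" for t
  define m where "m t = Inf (u ` B t)" for t
  have "compact (B t)" for t unfolding B_def by (intro closed_Int_compact) auto
  then have "compact (u ` B t)" for t
    by (intro compact_continuous_image continuous_on_subset[OF u]) (auto simp: B_def)
  then have bd: "bdd_below (u ` B t)" for t by (intro bounded_imp_bdd_below compact_imp_bounded)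
  have "antimono m"
  proof (rule antimonoI)
    fix s t :: real assume "s \<le> t"
    then have "max 0 s \<le> max 0 t" by auto
    then have "sqrt (max 0 s) \<le> sqrt (max 0 t)" by (rule real_sqrt_le_mono)
    then have "B s \<subseteq> B t" unfolding B_def by (intro Int_mono subset_cball) auto
    moreover have "0 \<in> B s" by (auto simp: B_def)
    ultimately show "m t \<le> m s" unfolding m_def by (intro cInf_superset_mono bd image_mono) auto
  qed
  from antimono_C1_minorant[OF this] obtain J J' where
    J: "\<And>t. (J has_real_derivative J' t) (at t)" "continuous_on UNIV J'" "\<And>t. J t \<le> m t" by metis
  have "J ((norm (y - 0))\<^sup>2) \<le> u y" if "y \<in> {0..}" for y
  proof -
    have "m ((norm (y - 0))\<^sup>2) \<le> u y" unfolding m_def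
      by (rule cInf_lower[OF _ bd]) (use that in \<open>auto simp: B_def\<close>)
    then show ?thesis using J(3) order_trans by blast
  qed
  then show ?thesis using that[OF C1_compose[OF C1_sqnorm[of 0] J(1,2)]] by blast
qed

text \<open>Cut-off between two C1 functions: \<open>\<psi>\<close> near \<open>z\<close>,
  \<open>w\<close> far away, a convex combination between them. At \<open>z\<close> the cut-off has
  value 1 and gradient 0, so the gradient there is that of \<open>\<psi>\<close>.\<close>

lemma C1_blend:
  assumes "C1_with_gradient \<psi> G" "C1_with_gradient w H" "r > 0" "r < r'"
  obtains \<theta> \<phi> K where "C1_with_gradient \<phi> K" "\<And>x. \<phi> x = \<theta> x * \<psi> x + (1 - \<theta> x) * w x"
    "\<And>x. 0 \<le> \<theta> x" "\<And>x. \<theta> x \<le> (1::real)" "\<And>x. norm (x - z) \<le> r \<Longrightarrow> \<theta> x = 1"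
    "\<And>x. norm (x - z) \<ge> r' \<Longrightarrow> \<theta> x = 0" "K z = G z"
proof -
  have "r\<^sup>2 < r'\<^sup>2" using assms by (simp add: power_strict_mono)
  from real_bump[OF this] obtain b b' where
    b: "\<And>t. (b has_real_derivative b' t) (at t)" "continuous_on UNIV b'"
    "\<And>t. 0 \<le> b t" "\<And>t. b t \<le> (1::real)" "\<And>t. t \<le> r\<^sup>2 \<Longrightarrow> b t = 1" "\<And>t. t \<ge> r'\<^sup>2 \<Longrightarrow> b t = 0" by metis
  note \<theta> = C1_compose[OF C1_sqnorm[of z] b(1,2)]
  have b1: "b ((norm (x - z))\<^sup>2) = 1" if "norm (x - z) \<le> r" for x
    by (rule b(5)) (use that in \<open>simp add: power_mono\<close>)
  have b0: "b ((norm (x - z))\<^sup>2) = 0" if "norm (x - z) \<ge> r'" for x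
    by (rule b(6)) (use that assms(3,4) in \<open>simp add: power_mono\<close>)
  note c = C1_add[OF C1_mult[OF \<theta> assms(1)] C1_mult[OF C1_add[OF C1_const[of 1] C1_mult[OF C1_const[of "-1"] \<theta>]] assms(2)]]
  show ?thesis
  proof (rule that[OF c, of "\<lambda>x. b ((norm (x - z))\<^sup>2)"])
    have "b 0 = 1" using b1[of z] assms(3) by simp
    then show "b ((norm (z - z))\<^sup>2) *\<^sub>R G z + \<psi> z *\<^sub>R b' ((norm (z - z))\<^sup>2) *\<^sub>R 2 *\<^sub>R (z - z) +
        ((1 + - 1 * b ((norm (z - z))\<^sup>2)) *\<^sub>R H z +
         w z *\<^sub>R (0 + (- 1 *\<^sub>R b' ((norm (z - z))\<^sup>2) *\<^sub>R 2 *\<^sub>R (z - z) + b ((norm (z - z))\<^sup>2) *\<^sub>R 0))) = G z"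
      by simp
  qed (simp_all add: b(3,4) b0 b1)
qed

text \<open>Stone-Weierstrass for u - \<eta>/2 with error below \<eta>/2 yields a polynomial between
  u - \<eta> and u on a ball. Outside the ball a polynomial need not stay below \<open>u\<close>, so
  it is blended into a global C1 minorant; convex combinations remain below
  \<open>u\<close>.\<close>

lemma C1_approx_below:
  fixes u :: "real^'n \<Rightarrow> real"
  assumes u: "continuous_on {0..} u" and \<eta>: "\<eta> > 0"
  obtains w G where "C1_with_gradient w G" "\<And>y. y \<in> {0..} \<Longrightarrow> w y \<le> u y"
    "\<And>y. y \<in> {0..} \<Longrightarrow> norm y \<le> R \<Longrightarrow> u y - \<eta> \<le> w y"
proof -
  \<comment> \<open>Keeps the inner radius of the cut-off positive for any \<open>R\<close>.\<close>
  define R1 where "R1 = max 1 R"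
  obtain m Gm where m: "C1_with_gradient m Gm" "\<And>y. y \<in> {0..} \<Longrightarrow> m y \<le> u y"
    using continuous_minorant_C1[OF u] by metis
  have "compact ({0..} \<inter> cball (0::real^'n) (R1 + 1))" by (intro closed_Int_compact) auto
  then obtain q where q: "real_polynomial_function q"
    "\<And>y. y \<in> {0..} \<inter> cball 0 (R1 + 1) \<Longrightarrow> \<bar>u y - \<eta>/2 - q y\<bar> < \<eta>/2"
  proof (rule Stone_Weierstrass_real_polynomial_function)
    show "continuous_on ({0..} \<inter> cball 0 (R1 + 1)) (\<lambda>y. u y - \<eta>/2)"
      by (intro continuous_intros continuous_on_subset[OF u]) auto
    show "0 < \<eta>/2" using \<eta> by simp
  qed blast
  obtain Gq where Gq: "C1_with_gradient q Gq" using C1_polynomial[OF q(1)] by blast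
  have "0 < R1" "R1 < R1 + 1" by (auto simp: R1_def)
  from C1_blend[OF Gq m(1) this, of "0"] obtain w K \<theta> where w: "C1_with_gradient w K"
    "\<And>x. w x = \<theta> x * q x + (1 - \<theta> x) * m x"
    "\<And>x. 0 \<le> \<theta> x" "\<And>x. \<theta> x \<le> (1::real)" "\<And>x. norm (x - 0) \<le> R1 \<Longrightarrow> \<theta> x = 1"
    "\<And>x. norm (x - 0) \<ge> R1 + 1 \<Longrightarrow> \<theta> x = 0" by metis
  show ?thesis
  proof (rule that[OF w(1)])
    fix y :: "real^'n" assume y: "y \<in> {0..}"
    show "w y \<le> u y"
    proof (cases "norm y \<ge> R1 + 1")
      case True then show ?thesis using w(2,6) m(2)[OF y] by auto
    next
      case False
      then have "\<bar>u y - \<eta>/2 - q y\<bar> < \<eta>/2" using q(2)[of y] y by (simp add: dist_norm)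
      then have "q y \<le> u y" unfolding abs_less_iff by linarith
      then have "w y \<le> \<theta> y * u y + (1 - \<theta> y) * u y" unfolding w(2)
        using w(3,4) m(2)[OF y] by (intro add_mono mult_left_mono) auto
      then show ?thesis by (simp add: algebra_simps)
    qed
    assume "norm y \<le> R"
    then have "norm y \<le> R1" by (simp add: R1_def)
    then have "\<bar>u y - \<eta>/2 - q y\<bar> < \<eta>/2" "w y = q y"
      using q(2)[of y] y w(5)[of y] w(2)[of y] by (simp_all add: dist_norm)
    then show "u y - \<eta> \<le> w y" unfolding abs_less_iff by linarith
  qed
qed

text \<open>Turns a local touching function into a genuine test function. \<open>\<psi>\<close> is
  kept on a ball around \<open>y\<close> so small that it lies below u and above u - \<eta>; further
  out it passes into a global approximation from below. Closeness to \<open>u\<close> up to radius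
  \<open>R\<close> is what makes the nonlocal terms of the two functions comparable.\<close>

lemma C1_touching_extension:
  fixes u :: "real^'n \<Rightarrow> real"
  assumes u: "continuous_on {0..} u" and \<eta>: "\<eta> > 0" and y: "y \<in> {0..}"
    and \<psi>: "C1_with_gradient \<psi> G" "\<psi> y = u y"
    and d: "d > 0" "\<And>z. z \<in> {0..} \<Longrightarrow> norm (z - y) < d \<Longrightarrow> \<psi> z \<le> u z"
  obtains \<phi> H where "C1_with_gradient \<phi> H" "\<phi> y = u y" "H y = G y" "\<And>z. z \<in> {0..} \<Longrightarrow> \<phi> z \<le> u z"
    "\<And>z. z \<in> {0..} \<Longrightarrow> norm z \<le> R \<Longrightarrow> u z - \<eta> \<le> \<phi> z"
proof -
  obtain w Gw where w: "C1_with_gradient w Gw" "\<And>z. z \<in> {0..} \<Longrightarrow> w z \<le> u z"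
    "\<And>z. z \<in> {0..} \<Longrightarrow> norm z \<le> R \<Longrightarrow> u z - \<eta> \<le> w z"
    using C1_approx_below[OF u \<eta>] by metis
  have "continuous_on {0..} (\<lambda>z. u z - \<psi> z)" using u C1_continuous[OF \<psi>(1)] by (intro continuous_intros)
  then obtain d' where d': "d' > 0" "\<And>z. z \<in> {0..} \<Longrightarrow> norm (z - y) < d' \<Longrightarrow> \<bar>(u z - \<psi> z) - (u y - \<psi> y)\<bar> < \<eta>"
    using y \<eta> unfolding continuous_on_iff dist_norm real_norm_def by metis
  define r where "r = min d d' / 2"
  have "0 < r" "r < min d d'" using d d' by (auto simp: r_def)
  from C1_blend[OF \<psi>(1) w(1) this, of y] obtain \<phi> K \<theta> where f: "C1_with_gradient \<phi> K"
    "\<And>x. \<phi> x = \<theta> x * \<psi> x + (1 - \<theta> x) * w x"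
    "\<And>x. 0 \<le> \<theta> x" "\<And>x. \<theta> x \<le> (1::real)" "\<And>x. norm (x - y) \<le> r \<Longrightarrow> \<theta> x = 1"
    "\<And>x. norm (x - y) \<ge> min d d' \<Longrightarrow> \<theta> x = 0" "K y = G y" by metis
  show ?thesis
  proof (rule that[OF f(1)])
    show "\<phi> y = u y" using f(2)[of y] f(5)[of y] \<psi>(2) \<open>0 < r\<close> by auto
    show "K y = G y" by fact
    fix z :: "real^'n" assume z: "z \<in> {0..}"
    show "\<phi> z \<le> u z"
    proof (cases "norm (z - y) \<ge> min d d'")
      case True then show ?thesis using f(2,6) w(2)[OF z] by auto
    next
      case False
      then have "\<phi> z \<le> \<theta> z * u z + (1 - \<theta> z) * u z" unfolding f(2)
        using f(3,4) d(2)[OF z] w(2)[OF z] by (intro add_mono mult_left_mono) auto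
      then show ?thesis by (simp add: algebra_simps)
    qed
    assume R: "norm z \<le> R"
    show "u z - \<eta> \<le> \<phi> z"
    proof (cases "norm (z - y) \<ge> min d d'")
      case True then show ?thesis using f(2,6) w(3)[OF z R] by auto
    next
      case False
      then have "u z - \<eta> \<le> \<psi> z" using d'(2)[OF z] \<psi>(2) unfolding abs_less_iff by (simp add: not_le)
      then have "\<theta> z * (u z - \<eta>) + (1 - \<theta> z) * (u z - \<eta>) \<le> \<phi> z" unfolding f(2)
        using f(3,4) w(3)[OF z R] by (intro add_mono mult_left_mono) auto
      then show ?thesis by (simp add: algebra_simps)
    qed
  qed
qed

text \<open>The penalised minimum lies neither on the lateral surface of the tube, because
  \<open>K\<close> is large, nor at the end s = h, where the objective exceeds its value at the
  start. So the minimiser can be compared with all nearby points at the same s, which gives the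
  paraboloid, and with slightly larger s, which gives the slope. As s = 0 is possible, only forward
  variations are used and the slope is bounded on one side.\<close>

lemma tube_touching:
  fixes u :: "'a::euclidean_space \<Rightarrow> real"
  assumes u: "continuous_on S u" and h: "h \<ge> 0" and r: "r > 0"
    and S: "\<forall>s\<in>{0..h}. cball (x + s *\<^sub>R v) r \<subseteq> S"
    and q: "u (x + h *\<^sub>R v) - u x > q * h"
  obtains s y K d where "s \<in> {0..h}" "norm (y - (x + s *\<^sub>R v)) < r" "d > 0"
    "\<And>z. norm (z - y) < d \<Longrightarrow>
       u y + K * (norm (y - (x + s *\<^sub>R v)))\<^sup>2 - K * (norm (z - (x + s *\<^sub>R v)))\<^sup>2 \<le> u z"
    "- 2 * K * ((y - (x + s *\<^sub>R v)) \<bullet> v) \<ge> q"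
proof -
  define T where "T = {0..h} \<times> cball (0::'a) r"
  have T: "compact T" unfolding T_def by (intro compact_Times) auto
  have inS: "x + s *\<^sub>R v + e \<in> S" if "(s, e) \<in> T" for s e
    using that bspec[OF S, of s] by (auto simp: T_def subset_eq dist_norm)
  have cu: "continuous_on T (\<lambda>(s, e). u (x + s *\<^sub>R v + e))"
    unfolding split_def
  proof (rule continuous_on_compose2[OF u])
    show "continuous_on T (\<lambda>p. x + fst p *\<^sub>R v + snd p)" by (intro continuous_intros)
    show "(\<lambda>p. x + fst p *\<^sub>R v + snd p) ` T \<subseteq> S" using inS by force
  qed
  have "bounded ((\<lambda>(s, e). u (x + s *\<^sub>R v + e)) ` T)"
    by (intro compact_imp_bounded compact_continuous_image cu T)
  then obtain B where B0: "\<forall>z\<in>(\<lambda>(s, e). u (x + s *\<^sub>R v + e)) ` T. norm z \<le> B"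
    unfolding bounded_iff by blast
  have B: "\<bar>u (x + s *\<^sub>R v + e)\<bar> \<le> B" if "(s, e) \<in> T" for s e
    using bspec[OF B0 imageI[OF that]] by simp
  define g where "g = u (x + h *\<^sub>R v) - u x - q * h"
  have g: "g > 0" using q by (simp add: g_def)
  have "x + h *\<^sub>R v \<in> S" using inS[of h 0] h r by (auto simp: T_def)
  then obtain \<rho>0 where \<rho>0: "\<rho>0 > 0" "\<And>y. y \<in> S \<Longrightarrow> norm (y - (x + h *\<^sub>R v)) < \<rho>0 \<Longrightarrow> \<bar>u y - u (x + h *\<^sub>R v)\<bar> < g"
    using u g unfolding continuous_on_iff dist_norm real_norm_def by metis
  define \<rho> where "\<rho> = min \<rho>0 r"
  have \<rho>: "\<rho> > 0" using \<rho>0 r by (auto simp: \<rho>_def)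
  \<comment> \<open>\<open>2 * \<bar>B\<bar>\<close> bounds the variation of \<open>u\<close> on the
    tube, \<open>\<bar>q\<bar> * h\<close> that of the linear term; the extra 1 makes every offset
    of length at least \<rho> strictly worse than the start (0, 0).\<close>
  define K where "K = (2 * \<bar>B\<bar> + \<bar>q\<bar> * h + 1) / \<rho>\<^sup>2"
  have K: "K \<ge> 0" unfolding K_def using h by (intro divide_nonneg_nonneg add_nonneg_nonneg mult_nonneg_nonneg) auto
  have "continuous_on T (\<lambda>(s, e). u (x + s *\<^sub>R v + e) + K * (norm e)\<^sup>2 - q * s)"
    using cu unfolding split_def by (intro continuous_intros) auto
  moreover have T0: "(0, 0) \<in> T" using h r by (auto simp: T_def)
  ultimately obtain p where p: "p \<in> T" "\<forall>p'\<in>T. (\<lambda>(s, e). u (x + s *\<^sub>R v + e) + K * (norm e)\<^sup>2 - q * s) p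
      \<le> (\<lambda>(s, e). u (x + s *\<^sub>R v + e) + K * (norm e)\<^sup>2 - q * s) p'"
    using continuous_attains_inf[OF T] by blast
  obtain s e where pe: "p = (s, e)" by (cases p)
  have se: "(s, e) \<in> T" using p(1) pe by simp
  have min: "u (x + s *\<^sub>R v + e) + K * (norm e)\<^sup>2 - q * s \<le> u (x + s' *\<^sub>R v + e') + K * (norm e')\<^sup>2 - q * s'"
    if "(s', e') \<in> T" for s' e'
    using bspec[OF p(2) that] unfolding pe by simp
  have m0: "u (x + s *\<^sub>R v + e) + K * (norm e)\<^sup>2 - q * s \<le> u x" using min[OF T0] by simp
  have s: "0 \<le> s" "s \<le> h" using se by (auto simp: T_def)
  have qs: "q * s \<le> \<bar>q\<bar> * h" using s by (intro mult_mono) auto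
  have ne: "norm e < \<rho>"
  proof (rule ccontr)
    assume "\<not> norm e < \<rho>"
    then have "\<rho>\<^sup>2 \<le> (norm e)\<^sup>2" using \<rho> by (intro power_mono) auto
    then have "K * \<rho>\<^sup>2 \<le> K * (norm e)\<^sup>2" using K by (rule mult_left_mono)
    then have "2 * \<bar>B\<bar> + \<bar>q\<bar> * h + 1 \<le> K * (norm e)\<^sup>2" using \<rho> by (simp add: K_def)
    then show False using m0 qs B[OF se] B[OF T0] by auto
  qed
  \<comment> \<open>At s = h the value of \<open>u\<close> is within \<open>g\<close> of its value
    on the axis, which exceeds u x + q h by exactly \<open>g\<close>; the minimum would then be
    above the value at the start.\<close>
  have sh: "s < h"
  proof (rule ccontr)
    assume "\<not> s < h" then have "s = h" using s by auto
    have "x + s *\<^sub>R v + e \<in> S" by (rule inS[OF se])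
    then have "\<bar>u (x + h *\<^sub>R v + e) - u (x + h *\<^sub>R v)\<bar> < g"
      using \<rho>0(2)[of "x + h *\<^sub>R v + e"] ne by (auto simp: \<rho>_def \<open>s = h\<close>)
    moreover have "0 \<le> K * (norm e)\<^sup>2" using K by simp
    ultimately show False using m0 unfolding \<open>s = h\<close> g_def by linarith
  qed
  show ?thesis
  proof (rule that[of s "x + s *\<^sub>R v + e" "r - norm e" K])
    show "s \<in> {0..h}" "norm (x + s *\<^sub>R v + e - (x + s *\<^sub>R v)) < r" "0 < r - norm e"
      using s ne by (auto simp: \<rho>_def)
    fix z assume z: "norm (z - (x + s *\<^sub>R v + e)) < r - norm e"
    have "norm (z - (x + s *\<^sub>R v)) \<le> norm (z - (x + s *\<^sub>R v + e)) + norm e"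
      using norm_triangle_ineq[of "z - (x + s *\<^sub>R v + e)" e] by (simp add: algebra_simps)
    then have "(s, z - (x + s *\<^sub>R v)) \<in> T" using z s by (auto simp: T_def)
    from min[OF this] show "u (x + s *\<^sub>R v + e) + K * (norm (x + s *\<^sub>R v + e - (x + s *\<^sub>R v)))\<^sup>2 - K * (norm (z - (x + s *\<^sub>R v)))\<^sup>2 \<le> u z"
      by simp
  next
    have ev: "\<forall>\<^sub>F t in at_right 0. q \<le> - 2 * K * (e \<bullet> v) + K * t * (norm v)\<^sup>2"
    proof -
      have "((\<lambda>t. norm (e - t *\<^sub>R v)) \<longlongrightarrow> norm (e - 0 *\<^sub>R v)) (at_right 0)" by (intro tendsto_intros)
      then have "\<forall>\<^sub>F t in at_right 0. norm (e - t *\<^sub>R v) < r"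
        by (rule order_tendstoD) (use ne in \<open>auto simp: \<rho>_def\<close>)
      moreover have "\<forall>\<^sub>F t in at_right 0. t \<in> {0<..<h - s}"
        by (rule eventually_at_right_real) (use sh in auto)
      ultimately show ?thesis
      proof eventually_elim
        case (elim t)
        \<comment> \<open>Advancing along the axis by t v and moving the offset back by t v leaves
          the point of space unchanged: \<open>u\<close> cancels, and only the quadratic and the
          linear term are compared.\<close>
        then have "(s + t, e - t *\<^sub>R v) \<in> T" using s by (auto simp: T_def)
        from min[OF this] have "K * (norm e)\<^sup>2 + q * t \<le> K * (norm (e - t *\<^sub>R v))\<^sup>2"
          by (simp add: algebra_simps)
        also have "(norm (e - t *\<^sub>R v))\<^sup>2 = (norm e)\<^sup>2 - 2 * t * (e \<bullet> v) + t * t * (norm v)\<^sup>2"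
          unfolding power2_norm_eq_inner by (simp add: algebra_simps inner_commute)
        finally have "t * q \<le> t * (- 2 * K * (e \<bullet> v) + K * t * (norm v)\<^sup>2)"
          by (simp add: algebra_simps)
        then show ?case using elim by (simp add: mult_le_cancel_left)
      qed
    qed
    have "((\<lambda>t. - 2 * K * (e \<bullet> v) + K * t * (norm v)\<^sup>2) \<longlongrightarrow> - 2 * K * (e \<bullet> v) + K * 0 * (norm v)\<^sup>2) (at_right 0)"
      by (intro tendsto_intros)
    from tendsto_lowerbound[OF this ev]
    show "q \<le> - 2 * K * ((x + s *\<^sub>R v + e - (x + s *\<^sub>R v)) \<bullet> v)" by simp
  qed
qed

lemma pos_in_interior: "(\<And>i. 0 < (x::real^'n) $ i) \<Longrightarrow> x \<in> interior {0..}"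
proof (rule interiorI)
  show "open {x::real^'n. \<forall>i. x $ i \<in> {0<..}}" by (rule open_vector_box) auto
qed (auto simp: less_eq_vec_def less_imp_le)

section \<open>Analytic consequences of the viscosity inequalities\<close>

lemma vec_diff_nonneg [simp]: "0 \<le> y - x \<longleftrightarrow> x \<le> (y :: real^'n)"
  by (simp add: less_eq_vec_def)

lemma vec_diff_le [simp]: "y - x \<le> y \<longleftrightarrow> 0 \<le> (x :: real^'n)"
  by (simp add: less_eq_vec_def)

lemma (in pair_sigma_finite) integrable_product_fun:
  fixes h k :: "_ \<Rightarrow> real"
  assumes h: "integrable M1 h" and k: "integrable M2 k"
  shows "integrable (M1 \<Otimes>\<^sub>M M2) (\<lambda>z. h (fst z) * k (snd z))"
proof (rule Fubini_integrable)
  have [measurable]: "h \<in> borel_measurable M1" "k \<in> borel_measurable M2" using h k by auto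
  show "(\<lambda>z. h (fst z) * k (snd z)) \<in> borel_measurable (M1 \<Otimes>\<^sub>M M2)" by measurable
  show "integrable M1 (\<lambda>x. \<integral>y. norm (h (fst (x, y)) * k (snd (x, y))) \<partial>M2)"
    using h by (simp add: abs_mult)
qed (use k in simp)

lemma extended_expectation_integrable:
  assumes "integrable M Y" shows "extended_expectation M Y = ereal (\<integral>\<omega>. Y \<omega> \<partial>M)"
proof -
  have "(\<integral>\<^sup>+ \<omega>. ennreal (Y \<omega>) \<partial>M) < \<infinity>" "(\<integral>\<^sup>+ \<omega>. ennreal (- Y \<omega>) \<partial>M) < \<infinity>"
    using assms by (auto simp: real_integrable_def less_top)
  then obtain s t where st: "0 \<le> s" "0 \<le> t" "(\<integral>\<^sup>+ \<omega>. ennreal (Y \<omega>) \<partial>M) = ennreal s" "(\<integral>\<^sup>+ \<omega>. ennreal (- Y \<omega>) \<partial>M) = ennreal t"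
    by (metis ennreal_cases infinity_ennreal_def less_irrefl)
  then show ?thesis unfolding extended_expectation_def real_lebesgue_integral_def[OF assms] by simp
qed

lemma tendsto_vec_upper:
  fixes h :: "'b \<Rightarrow> real^'n"
  assumes "(h \<longlongrightarrow> l) F" "F \<noteq> bot" "\<forall>\<^sub>F r in F. h r \<le> b" shows "l \<le> b"
  using Lim_in_closed_set[OF closed_eucl_atMost[of b] _ assms(2,1)] assms(3) by simp

lemma tendsto_vec_lower:
  fixes h :: "'b \<Rightarrow> real^'n"
  assumes "(h \<longlongrightarrow> l) F" "F \<noteq> bot" "\<forall>\<^sub>F r in F. b \<le> h r" shows "b \<le> l"
  using Lim_in_closed_set[OF closed_eucl_atLeast[of b] _ assms(2,1)] assms(3) by simp

text \<open>The last point of the grid of mesh \<delta> through \<open>s\<close> that is strictly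
  before \<open>r\<close>. Strictness makes it tend to \<open>r\<close> from the left as \<delta>
  tends to 0, so that left limits appear, and makes step processes built on it predictable.\<close>

definition grid_before :: "real \<Rightarrow> real \<Rightarrow> real \<Rightarrow> real" where
  "grid_before s \<delta> r = s + \<delta> * (of_int \<lceil>(r - s) / \<delta>\<rceil> - 1)"

lemma grid_before_bounds: "\<delta> > 0 \<Longrightarrow> grid_before s \<delta> r < r \<and> r - \<delta> \<le> grid_before s \<delta> r"
proof -
  assume d: "\<delta> > 0"
  have m: "of_int \<lceil>(r - s) / \<delta>\<rceil> - 1 < (r - s) / \<delta>" "(r - s) / \<delta> - 1 \<le> of_int \<lceil>(r - s) / \<delta>\<rceil> - 1"
    using ceiling_correct[of "(r - s) / \<delta>"] by linarith+
  have e: "\<delta> * ((r - s) / \<delta>) = r - s" using d by simp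
  have "\<delta> * (of_int \<lceil>(r - s) / \<delta>\<rceil> - 1) < r - s" using mult_strict_left_mono[OF m(1) d] unfolding e .
  moreover have "r - s - \<delta> \<le> \<delta> * (of_int \<lceil>(r - s) / \<delta>\<rceil> - 1)"
    using mult_left_mono[OF m(2) less_imp_le[OF d]] unfolding right_diff_distrib[of \<delta> _ 1] e by simp
  ultimately show ?thesis unfolding grid_before_def by simp
qed

lemma grid_before_ge: "\<delta> > 0 \<Longrightarrow> s < r \<Longrightarrow> s \<le> grid_before s \<delta> r"
  unfolding grid_before_def by (auto simp: le_ceiling_iff intro!: mult_nonneg_nonneg)

lemma grid_before_cell: "\<delta> > 0 \<Longrightarrow> s + real j * \<delta> < r \<Longrightarrow> r \<le> s + real (Suc j) * \<delta> \<Longrightarrow> grid_before s \<delta> r = s + real j * \<delta>"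
proof -
  assume a: "\<delta> > 0" "s + real j * \<delta> < r" "r \<le> s + real (Suc j) * \<delta>"
  then have "\<lceil>(r - s) / \<delta>\<rceil> = int j + 1" by (intro ceiling_unique) (auto simp: field_simps)
  then show ?thesis by (simp add: grid_before_def mult.commute)
qed

lemma grid_before_filterlim:
  assumes "\<And>n. \<delta> n > 0" "\<delta> \<longlonglongrightarrow> 0"
  shows "filterlim (\<lambda>n. grid_before s (\<delta> n) r) (at_left r) sequentially"
  unfolding filterlim_at
proof
  show "\<forall>\<^sub>F n in sequentially. grid_before s (\<delta> n) r \<in> {..<r} \<and> grid_before s (\<delta> n) r \<noteq> r"
    using grid_before_bounds[OF assms(1)] by (auto simp: less_le)
  have l: "(\<lambda>n. r - \<delta> n) \<longlonglongrightarrow> r" using tendsto_diff[OF tendsto_const assms(2), of r] by simp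
  show "(\<lambda>n. grid_before s (\<delta> n) r) \<longlonglongrightarrow> r"
    by (rule tendsto_sandwich[OF _ _ l tendsto_const])
       (use grid_before_bounds[OF assms(1)] in \<open>auto intro!: always_eventually less_imp_le\<close>)
qed

text \<open>The grid point factors through an integer, so the composite is measurable for every
  function \<open>h\<close>.\<close>

lemma grid_before_compose_measurable:
  "(\<lambda>r. h (grid_before s \<delta> r)) \<in> borel_measurable (borel :: real measure)"
proof -
  have "(\<lambda>r. \<lceil>(r - s) / \<delta>\<rceil>) \<in> measurable borel (count_space UNIV)" by measurable
  from measurable_compose[OF this, of "\<lambda>i. h (s + \<delta> * (of_int i - 1))"]
  show ?thesis by (simp add: grid_before_def)
qed

section \<open>Pointwise inequalities for a supersolution\<close>

locale supersolution = dividend_model M p a c rate \<tau> U \<upsilon> f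
  for M :: "'w measure" and p a :: "real^'n" and c rate :: real
    and \<tau> :: "nat \<Rightarrow> 'w \<Rightarrow> real" and U :: "nat \<Rightarrow> 'w \<Rightarrow> real^'n"
    and \<upsilon> :: "real^'n \<Rightarrow> real^'n \<Rightarrow> real" and f :: "real^'n \<Rightarrow> real" +
  fixes u :: "real^'n \<Rightarrow> real"
  assumes supersolution: "x \<in> interior {0..} \<Longrightarrow>
    viscosity_supersolution_at p a c rate (distr M borel (U 1)) \<upsilon> f u x"
begin

definition \<mu> :: "(real^'n) measure" where "\<mu> = distr M borel (U 1)"

lemma space_\<mu> [simp]: "space \<mu> = UNIV" and sets_\<mu> [simp, measurable_cong]: "sets \<mu> = sets borel"
  by (simp_all add: \<mu>_def)

definition g :: "real^'n \<Rightarrow> real" where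
  "g y = (c + rate) * u y - I_term rate \<mu> u y + R_term rate \<mu> \<upsilon> y"

lemma U_measurable [measurable]: "1 \<le> k \<Longrightarrow> U k \<in> borel_measurable M"
  using U_indep unfolding indep_vars_def by auto

lemma prob_space_\<mu>: "prob_space \<mu>"
  unfolding \<mu>_def by (intro prob_space_distr U_measurable) auto

lemma u_continuous: "continuous_on {0..} u"
proof -
  \<comment> \<open>Local Lipschitz continuity on the whole orthant is part of the supersolution
    property at each single point, so one interior point yields it.\<close>
  have "1 \<in> interior {0::real^'n..}" by (rule pos_in_interior) simp
  from supersolution[OF this] have "locally_lipschitz_on {0..} u"
    by (simp add: viscosity_supersolution_at_def)
  then show ?thesis unfolding continuous_on_eq_continuous_within locally_lipschitz_on_def
  proof (intro ballI)
    fix x :: "real^'n" assume x: "x \<in> {0..}" and "\<forall>x\<in>{0..}. \<exists>r>0. \<exists>K. K-lipschitz_on (cball x r \<inter> {0..}) u"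
    then obtain r K where rK: "r > 0" "K-lipschitz_on (cball x r \<inter> {0..}) u" by blast
    then have "continuous_on (cball x r \<inter> {0..}) u" by (intro lipschitz_on_continuous_on)
    then have "continuous (at x within (cball x r \<inter> {0..})) u"
      using x rK(1) by (simp add: continuous_on_eq_continuous_within)
    moreover have "at x within (cball x r \<inter> {0..}) = at x within {0..}"
      by (rule at_within_nhd[of x "ball x r"]) (use rK in auto)
    ultimately show "continuous (at x within {0..}) u" by simp
  qed
qed

lemma shift_integrable:
  assumes h: "continuous_on {0..} h"
  shows "set_integrable \<mu> {\<alpha>. \<alpha> \<in> {0..} \<and> y - \<alpha> \<in> {0..}} (\<lambda>\<alpha>. h (y - \<alpha>) :: real)"
proof -
  interpret \<mu>: prob_space \<mu> by (rule prob_space_\<mu>)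
  have A: "{\<alpha>. \<alpha> \<in> {0..} \<and> y - \<alpha> \<in> {0..}} = {0..y}" by auto
  have c: "continuous_on {0..y} (\<lambda>\<alpha>. h (y - \<alpha>))"
    by (rule continuous_on_compose2[OF h]) (auto intro!: continuous_intros)
  have "bounded ((\<lambda>\<alpha>. h (y - \<alpha>)) ` {0..y})"
    by (intro compact_imp_bounded compact_continuous_image c) auto
  then obtain B where B: "\<forall>z\<in>(\<lambda>\<alpha>. h (y - \<alpha>)) ` {0..y}. norm z \<le> B" unfolding bounded_iff by blast
  show ?thesis unfolding A set_integrable_def
  proof (rule \<mu>.integrable_const_bound[of _ "\<bar>B\<bar>"])
    show "AE x in \<mu>. norm (indicator {0..y} x *\<^sub>R h (y - x)) \<le> \<bar>B\<bar>"
    proof (intro AE_I2)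
      fix x show "norm (indicator {0..y} x *\<^sub>R h (y - x)) \<le> \<bar>B\<bar>"
      proof (cases "x \<in> {0..y}")
        case True
        then show ?thesis using bspec[OF B imageI[OF True]] by simp
      qed simp
    qed
    show "(\<lambda>x. indicator {0..y} x *\<^sub>R h (y - x)) \<in> borel_measurable \<mu>"
      using borel_measurable_continuous_on_indicator[OF _ c] by simp
  qed
qed

text \<open>\<open>\<Gamma>\<close> is the gradient of the touching paraboloid at \<open>y\<close>.
  For its extension to a test function the maximum in the operator is nonpositive, hence so is each
  member. The generator contains the nonlocal term of the test function; as this function is at
  least u - \<eta> on the box from 0 to \<open>y\<close>, its nonlocal term falls short of that of
  \<open>u\<close> by at most \<open>rate * \<eta>\<close>, and \<eta> tends to 0.\<close>

lemma touching:
  assumes y: "y \<in> interior {0..}" and d: "d > 0"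
    and t: "\<And>z. norm (z - y) < d \<Longrightarrow> u y + K * (norm (y - z0))\<^sup>2 - K * (norm (z - z0))\<^sup>2 \<le> u z"
    and \<Gamma>: "\<Gamma> = (- 2 * K) *\<^sub>R (y - z0)"
  shows "a $ i \<le> \<Gamma> $ i" "p \<bullet> \<Gamma> \<le> g y" "f y \<le> u y"
proof -
  have y0: "y \<in> {0..}" using y interior_subset by blast
  define \<psi> where "\<psi> z = u y + K * (norm (y - z0))\<^sup>2 + - K * (norm (z - z0))\<^sup>2" for z
  note C = C1_add[OF C1_const[of "u y + K * (norm (y - z0))\<^sup>2"] C1_mult[OF C1_const[of "- K"] C1_sqnorm[of z0]]]
  \<comment> \<open>The radius \<open>norm y * CARD('n)\<close> covers every y - \<alpha> with 0
    \<le> \<alpha> \<le> y, by the l1 bound on the norm.\<close>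
  have ex: "\<exists>\<phi> H. C1_with_gradient \<phi> H \<and> \<phi> y = u y \<and> H y = \<Gamma> \<and> (\<forall>z\<in>{0..}. \<phi> z \<le> u z) \<and>
    (\<forall>z\<in>{0..}. norm z \<le> norm y * CARD('n) \<longrightarrow> u z - \<eta> \<le> \<phi> z)" if "\<eta> > 0" for \<eta>
  proof (rule C1_touching_extension[OF u_continuous that y0 C _ d])
    fix \<phi> H assume "C1_with_gradient \<phi> H" "\<phi> y = u y"
      "H y = 0 + (- K *\<^sub>R 2 *\<^sub>R (y - z0) + (norm (y - z0))\<^sup>2 *\<^sub>R 0)" "\<And>z. z \<in> {0..} \<Longrightarrow> \<phi> z \<le> u z"
      "\<And>z. z \<in> {0..} \<Longrightarrow> norm z \<le> norm y * CARD('n) \<Longrightarrow> u z - \<eta> \<le> \<phi> z"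
    then show ?thesis unfolding \<Gamma> by (intro exI[of _ \<phi>] exI[of _ H]) simp
  qed (use t in auto)
  have op: "HJB_operator p a c rate \<mu> \<upsilon> f \<phi> \<Gamma> y \<le> 0"
    if "C1_with_gradient \<phi> H" "\<phi> y = u y" "H y = \<Gamma>" "\<forall>z\<in>{0..}. \<phi> z \<le> u z" for \<phi> H
    using supersolution[OF y, folded \<mu>_def] that unfolding viscosity_supersolution_at_def by force
  have mx: "a $ i - \<Gamma> $ i \<le> 0" "HJB_generator p c rate \<mu> \<upsilon> \<phi> \<Gamma> y \<le> 0" "f y - \<phi> y \<le> 0"
    if "HJB_operator p a c rate \<mu> \<upsilon> f \<phi> \<Gamma> y \<le> 0" for \<phi>
    using that unfolding HJB_operator_def by (simp_all add: Max_le_iff)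
  obtain \<phi> H where "C1_with_gradient \<phi> H" "\<phi> y = u y" "H y = \<Gamma>" "\<forall>z\<in>{0..}. \<phi> z \<le> u z"
    using ex[of 1] by auto
  from mx[OF op[OF this]] this show "a $ i \<le> \<Gamma> $ i" "f y \<le> u y" by auto
  interpret \<mu>: prob_space \<mu> by (rule prob_space_\<mu>)
  have e: "p \<bullet> \<Gamma> \<le> g y + rate * \<eta>" if \<eta>: "\<eta> > 0" for \<eta>
  proof -
    obtain \<phi> H where ph: "C1_with_gradient \<phi> H" "\<phi> y = u y" "H y = \<Gamma>" "\<forall>z\<in>{0..}. \<phi> z \<le> u z"
      "\<forall>z\<in>{0..}. norm z \<le> norm y * CARD('n) \<longrightarrow> u z - \<eta> \<le> \<phi> z" using ex[OF \<eta>] by blast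
    let ?A = "{\<alpha>. \<alpha> \<in> {0..} \<and> y - \<alpha> \<in> {0..}}"
    have le: "u (y - \<alpha>) - \<eta> \<le> \<phi> (y - \<alpha>)" if "\<alpha> \<in> ?A" for \<alpha>
    proof -
      have "norm (y - \<alpha>) \<le> (\<Sum>i\<in>UNIV. \<bar>(y - \<alpha>) $ i\<bar>)" by (rule norm_le_l1_cart)
      also have "\<dots> \<le> (\<Sum>i\<in>(UNIV::'n set). norm y)"
      proof (rule sum_mono)
        fix i
        have "0 \<le> \<alpha> $ i" "\<alpha> $ i \<le> y $ i" using that by (auto simp: less_eq_vec_def)
        then have "\<bar>(y - \<alpha>) $ i\<bar> \<le> \<bar>y $ i\<bar>" by simp
        then show "\<bar>(y - \<alpha>) $ i\<bar> \<le> norm y" using component_le_norm_cart[of y i] by linarith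
      qed
      finally have "norm (y - \<alpha>) \<le> norm y * CARD('n)" by (simp add: mult.commute)
      then show ?thesis using ph(5) that by auto
    qed
    have As: "?A \<in> sets \<mu>" using closed_Int[of "{0..}" "{..y}"] by (simp add: Collect_conj_eq)
    have c: "set_integrable \<mu> ?A (\<lambda>\<alpha>. \<eta>)"
      unfolding set_integrable_def using As by (intro \<mu>.integrable_const_bound[of _ "\<bar>\<eta>\<bar>"]) (auto simp: indicator_def)
    have "(LINT \<alpha>:?A|\<mu>. u (y - \<alpha>)) - (LINT \<alpha>:?A|\<mu>. \<eta>) = (LINT \<alpha>:?A|\<mu>. u (y - \<alpha>) - \<eta>)"
      using set_integral_diff(2)[OF shift_integrable[OF u_continuous] c] by simp
    also have "\<dots> \<le> (LINT \<alpha>:?A|\<mu>. \<phi> (y - \<alpha>))"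
      using le by (intro set_integral_mono set_integral_diff(1) shift_integrable u_continuous c C1_continuous[OF ph(1)]) auto
    finally have "(LINT \<alpha>:?A|\<mu>. u (y - \<alpha>)) - (LINT \<alpha>:?A|\<mu>. \<eta>) \<le> (LINT \<alpha>:?A|\<mu>. \<phi> (y - \<alpha>))" .
    moreover have "(LINT \<alpha>:?A|\<mu>. \<eta>) \<le> \<eta>"
    proof -
      have "(LINT \<alpha>:?A|\<mu>. \<eta>) = measure \<mu> ?A * \<eta>"
        using As unfolding set_lebesgue_integral_def by simp
      also have "\<dots> \<le> 1 * \<eta>" using \<eta> by (intro mult_right_mono \<mu>.prob_le_1) auto
      finally show ?thesis by simp
    qed
    ultimately have "I_term rate \<mu> u y - rate * \<eta> \<le> I_term rate \<mu> \<phi> y"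
      unfolding I_term_def using rate_pos by (simp add: right_diff_distrib[symmetric])
    moreover have "HJB_generator p c rate \<mu> \<upsilon> \<phi> \<Gamma> y \<le> 0" by (rule mx(2)[OF op[OF ph(1-4)]])
    ultimately show ?thesis unfolding HJB_generator_def g_def ph(2) by linarith
  qed
  then have "p \<bullet> \<Gamma> \<le> g y + e" if "e > 0" for e using e[of "e / rate"] that rate_pos by simp
  then show "p \<bullet> \<Gamma> \<le> g y" by (rule field_le_epsilon)
qed

text \<open>A tube contained in the orthant puts the touching point, which is strictly inside the
  tube, into the interior, where the supersolution inequalities hold.\<close>

lemma tube_touching':
  assumes h: "h \<ge> 0" and r: "r > 0" and S: "\<forall>s\<in>{0..h}. cball (x + s *\<^sub>R v) r \<subseteq> {0..}"
    and q: "u (x + h *\<^sub>R v) - u x > q * h"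
  obtains s y \<Gamma> where "s \<in> {0..h}" "norm (y - (x + s *\<^sub>R v)) < r" "y \<in> interior {0..}"
    "\<And>i. a $ i \<le> \<Gamma> $ i" "p \<bullet> \<Gamma> \<le> g y" "f y \<le> u y" "q \<le> \<Gamma> \<bullet> v"
proof -
  obtain s y K d where t: "s \<in> {0..h}" "norm (y - (x + s *\<^sub>R v)) < r" "d > 0"
    "\<And>z. norm (z - y) < d \<Longrightarrow>
       u y + K * (norm (y - (x + s *\<^sub>R v)))\<^sup>2 - K * (norm (z - (x + s *\<^sub>R v)))\<^sup>2 \<le> u z"
    "- 2 * K * ((y - (x + s *\<^sub>R v)) \<bullet> v) \<ge> q"
    using tube_touching[OF u_continuous h r S q] by metis
  have "y \<in> ball (x + s *\<^sub>R v) r" using t(2) by (simp add: dist_norm norm_minus_commute)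
  moreover have "ball (x + s *\<^sub>R v) r \<subseteq> interior {0..}"
    by (rule interior_maximal) (use bspec[OF S t(1)] ball_subset_cball in blast, simp)
  ultimately have y: "y \<in> interior {0..}" by blast
  show ?thesis
    using that[OF t(1,2) y touching[OF y t(3,4) refl]] t(5) by (simp add: inner_scaleR_left)
qed

lemma u_line_continuous: "x \<in> {0..} \<Longrightarrow> continuous_on {0..} (\<lambda>s. u (x + s *\<^sub>R p))"
  by (rule continuous_on_compose2[OF u_continuous])
     (auto intro!: continuous_intros add_nonneg_nonneg simp: less_eq_vec_def p_pos less_imp_le)

lemma u_line_tendsto:
  assumes "x \<in> {0..}" shows "((\<lambda>s. u (x + s *\<^sub>R p)) \<longlongrightarrow> u x) (at_right 0)"
proof -
  have "((\<lambda>s. u (x + s *\<^sub>R p)) \<longlongrightarrow> u (x + 0 *\<^sub>R p)) (at 0 within {0..})"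
    using u_line_continuous[OF assms] unfolding continuous_on_def by (rule bspec) simp
  moreover have "at_right (0::real) \<le> at 0 within {0..}" by (rule at_le) auto
  ultimately show ?thesis by (simp add: tendsto_mono)
qed

lemma cball_nonneg: "(\<And>i. r \<le> x $ i) \<Longrightarrow> cball x r \<subseteq> {0::real^'n..}"
proof
  fix y assume x: "\<And>i. r \<le> x $ i" and y: "y \<in> cball x r"
  have "\<bar>(y - x) $ i\<bar> \<le> r" for i
    using component_le_norm_cart[of "y - x" i] y by (simp add: dist_norm norm_minus_commute)
  then have le: "\<bar>y $ i - x $ i\<bar> \<le> r" for i by simp
  have "0 \<le> y $ i" for i using x[of i] le[of i] by arith
  then show "y \<in> {0..}" by (simp add: less_eq_vec_def)
qed

text \<open>The tube argument runs backwards, from x + h to x, with slope q = -m. An increment of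
  \<open>u\<close> below some m < a \<bullet> h would give a touching gradient with \<Gamma>
  \<bullet> h \<le> m, against \<Gamma> \<ge> a and h \<ge> 0. This takes room around the segment,
  hence positive coordinates of x; the general case follows by shifting along \<open>p\<close> and
  continuity.\<close>

lemma u_increment:
  assumes x: "x \<in> {0..}" and h: "0 \<le> h"
  shows "u x + a \<bullet> h \<le> u (x + h)"
proof -
  have int: "u x + a \<bullet> h \<le> u (x + h)" if pos: "\<And>i. 0 < x $ i" for x
  proof (rule ccontr)
    assume "\<not> ?thesis"
    then have "u (x + h) - u x < a \<bullet> h" by simp
    then obtain m where m: "u (x + h) - u x < m" "m < a \<bullet> h" using dense by blast
    define q where "q = - m"
    have q: "u (x + h) - u x < - q" "- q < a \<bullet> h" using m by (auto simp: q_def)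
    define r where "r = Min (range (($) x))"
    have r: "0 < r" "\<And>i. r \<le> x $ i" using pos by (auto simp: r_def)
    have "\<forall>s\<in>{0..1}. cball (x + h + s *\<^sub>R (- h)) r \<subseteq> {0..}"
    proof (intro ballI cball_nonneg)
      fix s :: real and i assume "s \<in> {0..1}"
      then have "0 \<le> (1 - s) * h $ i" using h by (auto simp: less_eq_vec_def)
      then show "r \<le> (x + h + s *\<^sub>R (- h)) $ i" using r(2)[of i] by (simp add: algebra_simps)
    qed
    note c = this
    have "q * 1 < u (x + h + 1 *\<^sub>R - h) - u (x + h)" using q by simp
    then obtain \<Gamma> :: "real^'n" where \<Gamma>: "\<And>i. a $ i \<le> \<Gamma> $ i" "q \<le> \<Gamma> \<bullet> (- h)"
      using tube_touching'[OF zero_le_one r(1) c] by metis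
    moreover have "a \<bullet> h \<le> \<Gamma> \<bullet> h" using \<Gamma>(1) h unfolding inner_vec_def
      by (intro sum_mono) (auto simp: less_eq_vec_def intro!: mult_right_mono)
    ultimately show False using q(2) by simp
  qed
  have "\<forall>\<^sub>F s in at_right 0. u (x + s *\<^sub>R p) + a \<bullet> h \<le> u (x + h + s *\<^sub>R p)"
  proof (rule eventually_at_right_less[THEN eventually_mono])
    fix s :: real assume "0 < s"
    then have "0 < (x + s *\<^sub>R p) $ i" for i using x p_pos by (auto simp: less_eq_vec_def add_nonneg_pos)
    from int[OF this] show "u (x + s *\<^sub>R p) + a \<bullet> h \<le> u (x + h + s *\<^sub>R p)" by (simp add: algebra_simps)
  qed
  moreover have "x + h \<in> {0..}" using x h by (simp add: less_eq_vec_def)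
  ultimately show ?thesis
    using tendsto_le[OF _ u_line_tendsto[of "x + h"] tendsto_add[OF u_line_tendsto[OF x] tendsto_const[of "a \<bullet> h"]]]
    by simp
qed

lemma a_inner_nonneg: "0 \<le> h \<Longrightarrow> 0 \<le> a \<bullet> h"
  unfolding inner_vec_def using a_pos by (intro sum_nonneg) (auto simp: less_eq_vec_def less_imp_le)

lemma u_mono: "x \<in> {0..} \<Longrightarrow> x \<le> y \<Longrightarrow> u x \<le> u y"
  using u_increment[of x "y - x"] a_inner_nonneg[of "y - x"] by simp

text \<open>A degenerate segment with v = 0 and slope -1: the strict increment condition holds
  trivially, so touching points exist arbitrarily close to x + s p. They are wanted above
  \<open>x\<close>, the side on which a monotone right continuous \<open>f\<close> can be compared
  with \<open>f x\<close>.\<close>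

lemma exists_touched_above:
  assumes x: "x \<in> {0..}" and e: "e > 0"
  obtains y where "x \<le> y" "norm (y - x) < e" "f y \<le> u y"
proof -
  define pm where "pm = Min (range (($) p))"
  have pm: "0 < pm" "\<And>i. pm \<le> p $ i" using p_pos by (auto simp: pm_def)
  define N where "N = norm p + pm"
  \<comment> \<open>Chosen so that shift plus radius, s (norm p + pm), equals e/2; the ball of
    radius s pm around x + s p then lies above \<open>x\<close>.\<close>
  define s where "s = e / 2 / N"
  have np: "N > 0" using pm by (simp add: N_def add_nonneg_pos)
  have "s * N = e / 2" using np by (simp add: s_def)
  then have s: "s > 0" "s * norm p + s * pm < e"
  proof -
    have "s * norm p + s * pm = s * N" by (simp add: N_def distrib_left)
    then show "s * norm p + s * pm < e" using \<open>s * N = e / 2\<close> e by simp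
    show "s > 0" using e np by (simp add: s_def)
  qed
  have c: "\<forall>t\<in>{0..1}. cball (x + s *\<^sub>R p + t *\<^sub>R 0) (s * pm) \<subseteq> {0..}"
  proof (intro ballI cball_nonneg)
    fix t :: real and i have "s * pm \<le> s * p $ i" using pm s by simp
    then show "s * pm \<le> (x + s *\<^sub>R p + t *\<^sub>R 0) $ i" using x by (auto simp: less_eq_vec_def add_increasing)
  qed
  have "0 < s * pm" "-1 * 1 < u (x + s *\<^sub>R p + 1 *\<^sub>R 0) - u (x + s *\<^sub>R p)" using pm s by auto
  from tube_touching'[OF zero_le_one this(1) c this(2)]
  obtain y where y: "norm (y - (x + s *\<^sub>R p)) < s * pm" "f y \<le> u y"
    by (metis scaleR_zero_right add.right_neutral)
  show ?thesis
  proof (rule that[of y])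
    show "f y \<le> u y" by fact
    have "norm (y - x) \<le> norm (y - (x + s *\<^sub>R p)) + norm (s *\<^sub>R p)"
      using norm_triangle_ineq[of "y - (x + s *\<^sub>R p)" "s *\<^sub>R p"] by (simp add: algebra_simps)
    then show "norm (y - x) < e" using y(1) s by simp
    show "x \<le> y" unfolding less_eq_vec_def
    proof
      fix i
      have "s * pm \<le> s * p $ i" using pm s by simp
      then show "x $ i \<le> y $ i" using component_le_norm_cart[of "y - (x + s *\<^sub>R p)" i] y(1) by simp
    qed
  qed
qed

lemma f_le_u:
  assumes x: "x \<in> {0..}" shows "f x \<le> u x"
proof -
  have "\<exists>y. x \<le> y \<and> norm (y - x) < 1 / Suc n \<and> f y \<le> u y" for n
    using exists_touched_above[OF x, of "1 / Suc n"] by (auto simp: Bex_def)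
  then obtain y where y: "\<And>n. x \<le> y n" "\<And>n. norm (y n - x) < 1 / Suc n" "\<And>n. f (y n) \<le> u (y n)" by metis
  have lim: "y \<longlonglongrightarrow> x"
    by (rule Lim_null_comparison[OF _ LIMSEQ_inverse_real_of_nat, THEN LIM_zero_cancel])
       (use y(2) in \<open>auto intro!: always_eventually less_imp_le simp: inverse_eq_divide\<close>)
  have y0: "y n \<in> {0..}" for n using x y(1)[of n] order_trans by auto
  have ul: "(\<lambda>n. u (y n)) \<longlonglongrightarrow> u x"
    by (rule continuous_on_tendsto_compose[OF u_continuous lim x]) (use y0 in auto)
  from f_regular show ?thesis
  proof
    assume "mono_on {0..} f \<and> (\<forall>x\<in>{0..}. (f \<longlongrightarrow> f x) (at x within {x..}))"
    then have "f x \<le> f (y n)" for n using x y0[of n] y(1)[of n] by (auto simp: mono_on_def)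
    then have "f x \<le> u (y n)" for n using y(3) order_trans by blast
    then show ?thesis by (intro LIMSEQ_le_const[OF ul]) auto
  next
    assume "continuous_on {0..} f"
    then have "(\<lambda>n. f (y n)) \<longlonglongrightarrow> f x"
      by (rule continuous_on_tendsto_compose[OF _ lim x]) (use y0 in auto)
    then show ?thesis by (rule LIMSEQ_le[OF _ ul]) (use y(3) in auto)
  qed
qed

text \<open>Cutting length k off both ends leaves a segment whose tube of radius
  \<open>k * pm\<close> lies in the box from x to x + h p. There \<open>g\<close> is at most
  \<open>Q\<close>, so the tube argument excludes slopes above \<open>Q\<close>; then k tends to
  0.\<close>

lemma u_box_increment:
  assumes x: "x \<in> {0..}" and h: "h > 0" and Q: "\<And>y. x \<le> y \<Longrightarrow> y \<le> x + h *\<^sub>R p \<Longrightarrow> g y \<le> Q"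
  shows "u (x + h *\<^sub>R p) - u x \<le> h * Q"
proof -
  define pm where "pm = Min (range (($) p))"
  have pm: "0 < pm" "\<And>i. pm \<le> p $ i" using p_pos by (auto simp: pm_def)
  have "u (x + (h - k) *\<^sub>R p) - u (x + k *\<^sub>R p) \<le> (h - 2 * k) * Q" if k: "0 < k" "2 * k < h" for k
  proof (rule ccontr)
    assume "\<not> ?thesis"
    then have "Q < (u (x + (h - k) *\<^sub>R p) - u (x + k *\<^sub>R p)) / (h - 2 * k)" using k by (simp add: field_simps)
    then obtain q where q0: "Q < q" "q < (u (x + (h - k) *\<^sub>R p) - u (x + k *\<^sub>R p)) / (h - 2 * k)"
      using dense by blast
    have q: "Q < q" "q * (h - 2 * k) < u (x + (h - k) *\<^sub>R p) - u (x + k *\<^sub>R p)"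
      using q0 k by (simp_all add: pos_less_divide_eq)
    have kp: "k * pm \<le> k * p $ i" for i using pm k by simp
    have c: "\<forall>s\<in>{0..h - 2 * k}. cball (x + k *\<^sub>R p + s *\<^sub>R p) (k * pm) \<subseteq> {0..}"
    proof (intro ballI cball_nonneg)
      fix s i assume "s \<in> {0..h - 2 * k}"
      then have "0 \<le> s * p $ i" using p_pos[of i] by simp
      moreover have "0 \<le> x $ i" using x by (simp add: less_eq_vec_def)
      ultimately show "k * pm \<le> (x + k *\<^sub>R p + s *\<^sub>R p) $ i" using kp[of i] by simp
    qed
    have e: "x + k *\<^sub>R p + (h - 2 * k) *\<^sub>R p = x + (h - k) *\<^sub>R p" by (simp add: vec_eq_iff algebra_simps)
    have q2: "q * (h - 2 * k) < u (x + k *\<^sub>R p + (h - 2 * k) *\<^sub>R p) - u (x + k *\<^sub>R p)" unfolding e by (rule q(2))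
    have hk: "0 \<le> h - 2 * k" "0 < k * pm" using k pm by auto
    obtain s y \<Gamma> where t: "s \<in> {0..h - 2 * k}"
      "norm (y - (x + k *\<^sub>R p + s *\<^sub>R p)) < k * pm" "p \<bullet> \<Gamma> \<le> g y" "q \<le> \<Gamma> \<bullet> p"
      using tube_touching'[OF hk c q2] by metis
    have cmp: "\<bar>y $ i - (x $ i + (k + s) * p $ i)\<bar> < k * p $ i" for i
      using component_le_norm_cart[of "y - (x + k *\<^sub>R p + s *\<^sub>R p)" i] t(2) kp[of i] by (simp add: algebra_simps)
    have "x \<le> y" unfolding less_eq_vec_def
    proof
      fix i have "0 \<le> s * p $ i" using t(1) p_pos[of i] by simp
      then show "x $ i \<le> y $ i" using cmp[of i] by (simp add: algebra_simps)
    qed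
    moreover have "y \<le> x + h *\<^sub>R p" unfolding less_eq_vec_def
    proof
      fix i have "(2 * k + s) * p $ i \<le> h * p $ i" using t(1) p_pos[of i] by (intro mult_right_mono) auto
      then show "y $ i \<le> (x + h *\<^sub>R p) $ i" using cmp[of i] by (simp add: algebra_simps)
    qed
    ultimately have "g y \<le> Q" by (rule Q)
    then show False using t(3,4) q(1) by (simp add: inner_commute)
  qed
  then have ev: "\<forall>\<^sub>F k in at_right 0. u (x + (h - k) *\<^sub>R p) - u (x + k *\<^sub>R p) \<le> (h - 2 * k) * Q"
    using eventually_at_right_real[of 0 "h/2"] h by (auto elim!: eventually_mono)
  have l1: "((\<lambda>k. u (x + (h - k) *\<^sub>R p)) \<longlongrightarrow> u (x + (h - 0) *\<^sub>R p)) (at_right 0)"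
  proof (rule continuous_on_tendsto_compose[OF u_line_continuous[OF x], of "\<lambda>k. h - k"])
    show "((\<lambda>k. h - k) \<longlongrightarrow> h - 0) (at_right 0)" by (intro tendsto_intros)
    show "\<forall>\<^sub>F k in at_right 0. h - k \<in> {0..}"
      using eventually_at_right_real[of 0 h] h by (auto elim!: eventually_mono)
  qed (use h in auto)
  have "((\<lambda>k. (h - 2 * k) * Q) \<longlongrightarrow> (h - 2 * 0) * Q) (at_right 0)" by (intro tendsto_intros)
  from tendsto_le[OF _ this tendsto_diff[OF l1 u_line_tendsto[OF x]] ev] show ?thesis by simp
qed

text \<open>Value after a claim \<open>\<alpha>\<close> met with surplus \<open>y\<close>.  The value \<open>0\<close> off the orthants is junk.\<close>

definition payoff :: "real^'n \<Rightarrow> real^'n \<Rightarrow> real" where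
  "payoff y \<alpha> = (if 0 \<le> y \<and> 0 \<le> \<alpha> then if \<alpha> \<le> y then u (y - \<alpha>) else - \<upsilon> y \<alpha> else 0)"

text \<open>\<open>\<upsilon>\<close> is non-increasing in the surplus, so its value at surplus 0
  bounds from above every penalty caused by the claim \<alpha>. Off \<open>exit_set\<close>, where
  \<open>\<upsilon>\<close> is unconstrained, the default is 0.\<close>

definition penalty_bound :: "real^'n \<Rightarrow> real" where
  "penalty_bound \<alpha> = (if (0, \<alpha>) \<in> exit_set then \<bar>\<upsilon> 0 \<alpha>\<bar> else 0)"

section \<open>Measurability and bounds for the payoff at a claim\<close>

lemma exit_set_iff: "(x, \<alpha>) \<in> exit_set \<longleftrightarrow> 0 \<le> x \<and> 0 \<le> \<alpha> \<and> \<not> \<alpha> \<le> x"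
  by (auto simp: exit_set_def)

lemma exit_set_measurable [measurable]: "exit_set \<in> sets (borel :: ((real^'n) \<times> (real^'n)) measure)"
proof -
  have eq: "exit_set = {z :: (real^'n) \<times> (real^'n). 0 \<le> fst z} \<inter> {z. 0 \<le> snd z} - {z. snd z \<le> fst z}"
    by (auto simp: exit_set_iff)
  have cl: "closed {z :: (real^'n) \<times> (real^'n). 0 \<le> fst z}" "closed {z :: (real^'n) \<times> (real^'n). 0 \<le> snd z}"
     "closed {z :: (real^'n) \<times> (real^'n). snd z \<le> fst z}"
    unfolding less_eq_vec_def Collect_all_eq by (intro closed_INT ballI closed_Collect_le continuous_intros)+
  show ?thesis unfolding eq by (intro sets.Diff sets.Int borel_closed cl)
qed

lemma penalty_indicator_measurable:
  "(\<lambda>z. if z \<in> exit_set then case_prod \<upsilon> z else 0) \<in> borel_measurable borel"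
  using penalty_measurable borel_measurable_restrict_space_iff[of exit_set borel "case_prod \<upsilon>"]
  by (simp add: measurable_restrict_space_iff) 

lemma penalty_bound_measurable [measurable]: "penalty_bound \<in> borel_measurable borel"
proof -
  have "(\<lambda>\<alpha>. (0::real^'n, \<alpha>)) \<in> borel_measurable borel" by (intro borel_measurable_continuous_onI continuous_intros)
  from measurable_compose[OF this penalty_indicator_measurable]
  have "(\<lambda>\<alpha>. if (0, \<alpha>) \<in> exit_set then \<upsilon> 0 \<alpha> else 0) \<in> borel_measurable borel" by (simp only: prod.case)
  then have "(\<lambda>\<alpha>. \<bar>if (0, \<alpha>) \<in> exit_set then \<upsilon> 0 \<alpha> else 0\<bar>) \<in> borel_measurable borel" by simp
  also have "(\<lambda>\<alpha>. \<bar>if (0, \<alpha>) \<in> exit_set then \<upsilon> 0 \<alpha> else 0\<bar>) = penalty_bound" by (auto simp: penalty_bound_def)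
  finally show ?thesis .
qed

lemma penalty_bound_integrable: "integrable \<mu> penalty_bound"
  unfolding \<mu>_def
proof (subst integrable_distr_eq)
  \<comment> \<open>A claim is almost surely not \<le> 0, so the pair of surplus 0 and first claim
    lies in \<open>exit_set\<close> and the default 0 of \<open>penalty_bound\<close> is almost
    surely not taken.\<close>
  have "AE \<omega> in M. \<not> U 1 \<omega> \<le> 0"
  proof (rule AE_I)
    show "{\<omega> \<in> space M. \<not> \<not> U 1 \<omega> \<le> 0} \<subseteq> {\<omega> \<in> space M. U 1 \<omega> \<le> 0}" by auto
    show "emeasure M {\<omega> \<in> space M. U 1 \<omega> \<le> 0} = 0" using F_zero by (simp add: emeasure_eq_measure)
    have "{\<omega> \<in> space M. U 1 \<omega> \<in> {..0}} \<in> sets M" by measurable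
    then show "{\<omega> \<in> space M. U 1 \<omega> \<le> 0} \<in> sets M" by simp
  qed
  moreover have "AE \<omega> in M. 0 \<le> U 1 \<omega>" using U_nonneg by (intro AE_I2) auto
  ultimately have ae: "AE \<omega> in M. \<bar>\<upsilon> 0 (U 1 \<omega>)\<bar> = penalty_bound (U 1 \<omega>)"
    by eventually_elim (simp add: penalty_bound_def exit_set_iff)
  have "integrable M (\<lambda>\<omega>. \<bar>\<upsilon> 0 (U 1 \<omega>)\<bar>)" using penalty_integrable by (rule integrable_abs)
  then show "integrable M (\<lambda>\<omega>. penalty_bound (U 1 \<omega>))"
    by (rule integrable_cong_AE_imp[OF _ _ ae]) measurable
qed measurable

lemma u_indicator_measurable: "(\<lambda>y. if 0 \<le> y then u y else 0) \<in> borel_measurable borel"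
proof -
  have "(\<lambda>y. indicator {0..} y *\<^sub>R u y) \<in> borel_measurable borel"
    by (intro borel_measurable_continuous_on_indicator u_continuous) simp
  moreover have "(\<lambda>y. indicator {0..} y *\<^sub>R u y) = (\<lambda>y. if 0 \<le> y then u y else 0)" by auto
  ultimately show ?thesis by (simp only:)
qed

lemma payoff_measurable: "case_prod payoff \<in> borel_measurable borel"
proof -
  have cl: "closed {z :: (real^'n) \<times> (real^'n). 0 \<le> fst z}" "closed {z :: (real^'n) \<times> (real^'n). 0 \<le> snd z}"
     "closed {z :: (real^'n) \<times> (real^'n). snd z \<le> fst z}"
    unfolding less_eq_vec_def Collect_all_eq by (intro closed_INT ballI closed_Collect_le continuous_intros)+
  have d: "(\<lambda>z. fst z - snd z) \<in> borel_measurable (borel :: ((real^'n) \<times> (real^'n)) measure)"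
    by (intro borel_measurable_continuous_onI continuous_intros)
  have eq: "case_prod payoff z = (if z \<in> {z. 0 \<le> fst z} \<inter> {z. 0 \<le> snd z} \<inter> {z. snd z \<le> fst z}
      then (if 0 \<le> fst z - snd z then u (fst z - snd z) else 0)
      else - (if z \<in> exit_set then case_prod \<upsilon> z else 0))" for z
    by (cases z) (auto simp: payoff_def exit_set_iff)
  show ?thesis unfolding eq[abs_def]
    by (intro measurable_If_set borel_measurable_uminus penalty_indicator_measurable
        measurable_compose[OF d u_indicator_measurable])
       (use cl in \<open>auto intro!: borel_closed\<close>)
qed

lemma payoff_measurable' [measurable (raw)]:
  assumes "h \<in> borel_measurable N" "k \<in> borel_measurable N"
  shows "(\<lambda>x. payoff (h x) (k x)) \<in> borel_measurable N"
  using measurable_compose[OF borel_measurable_Pair[OF assms] payoff_measurable] by simp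

lemma nonneg_AE: "AE \<alpha> in \<mu>. 0 \<le> \<alpha>"
  unfolding \<mu>_def
proof (subst AE_distr_iff)
  have "{x \<in> space borel. 0 \<le> x} = {0::real^'n..}" by auto
  then show "{x \<in> space borel. 0 \<le> x} \<in> sets (borel :: (real^'n) measure)" by simp
qed (use U_nonneg in auto)

lemma u_box_bound: "0 \<le> y \<Longrightarrow> y \<le> b \<Longrightarrow> \<bar>u y\<bar> \<le> \<bar>u 0\<bar> + \<bar>u b\<bar>"
  using u_mono[of 0 y] u_mono[of y b] by auto

text \<open>The weight h_0 in the growth condition GC.\<close>

definition growth :: "real^'n \<Rightarrow> real" where
  "growth y = exp (c / (2 * real CARD('n)) * (\<Sum>i\<in>UNIV. y $ i / p $ i))"

lemma growth_mono: "y \<le> z \<Longrightarrow> growth y \<le> growth z"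
  unfolding growth_def exp_le_cancel_iff using c_pos p_pos
  by (intro mult_left_mono sum_mono divide_right_mono) (auto simp: less_eq_vec_def less_imp_le)

lemma penalty_lower: obtains K where "0 \<le> K" "\<And>y \<alpha>. (y, \<alpha>) \<in> exit_set \<Longrightarrow> - \<upsilon> y \<alpha> \<le> K * growth y"
proof -
  obtain K where K: "\<And>x. x \<in> {0..} \<Longrightarrow> (SUP \<alpha>\<in>{\<alpha>. (x, \<alpha>) \<in> exit_set}. - \<upsilon> x \<alpha>) / growth x \<le> K"
    using S_growth unfolding growth_condition_def growth_def by blast
  have g: "0 < growth y" for y by (simp add: growth_def)
  show ?thesis
  proof (rule that[of "\<bar>K\<bar>"])
    fix y \<alpha> :: "real^'n" assume e: "(y, \<alpha>) \<in> exit_set"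
    then have y: "y \<in> {0..}" by (simp add: exit_set_iff)
    have "- \<upsilon> y \<alpha> \<le> (SUP \<alpha>\<in>{\<alpha>. (y, \<alpha>) \<in> exit_set}. - \<upsilon> y \<alpha>)"
      using e by (intro cSUP_upper S_finite y) auto
    also have "\<dots> \<le> K * growth y" using K[OF y] g[of y] by (simp add: divide_le_eq)
    also have "\<dots> \<le> \<bar>K\<bar> * growth y" using g[of y] by (intro mult_right_mono) auto
    finally show "- \<upsilon> y \<alpha> \<le> \<bar>K\<bar> * growth y" .
  qed simp
qed

text \<open>After a survived claim, monotonicity confines \<open>u\<close> between
  \<open>u 0\<close> and \<open>u b\<close>. A fatal claim is bounded from below by the integrable
  \<open>penalty_bound\<close> and from above by the growth condition on the supremum of
  -\<upsilon>. The constant depends only on the corner \<open>b\<close> of the box.\<close>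

lemma payoff_bound:
  obtains C where "C \<ge> 0" "\<And>y \<alpha>. 0 \<le> y \<Longrightarrow> y \<le> b \<Longrightarrow> 0 \<le> \<alpha> \<Longrightarrow> \<bar>payoff y \<alpha>\<bar> \<le> C + penalty_bound \<alpha>"
proof -
  obtain K where K: "0 \<le> K" "\<And>y \<alpha>. (y, \<alpha>) \<in> exit_set \<Longrightarrow> - \<upsilon> y \<alpha> \<le> K * growth y"
    using penalty_lower by blast
  define C where "C = \<bar>u 0\<bar> + \<bar>u b\<bar> + K * growth b"
  have lo: "- \<upsilon> y \<alpha> \<le> K * growth b" if "(y, \<alpha>) \<in> exit_set" "y \<le> b" for y \<alpha>
    using K(2)[OF that(1)] mult_left_mono[OF growth_mono[OF that(2)] K(1)] by linarith
  have E0: "0 \<le> K * growth b" using K(1) by (simp add: growth_def)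
  show ?thesis
  proof (rule that[of C])
    show "C \<ge> 0" unfolding C_def using E0 by simp
    fix y \<alpha> :: "real^'n" assume y: "0 \<le> y" "y \<le> b" "0 \<le> \<alpha>"
    show "\<bar>payoff y \<alpha>\<bar> \<le> C + penalty_bound \<alpha>"
    proof (cases "\<alpha> \<le> y")
      case True
      then have "y - \<alpha> \<le> b" using y by (simp add: less_eq_vec_def) (smt (verit))
      then have "\<bar>u (y - \<alpha>)\<bar> \<le> \<bar>u 0\<bar> + \<bar>u b\<bar>" using True by (intro u_box_bound) auto
      moreover have "0 \<le> K * growth b" "0 \<le> penalty_bound \<alpha>" using E0 by (auto simp: penalty_bound_def)
      ultimately show ?thesis using True y by (simp add: payoff_def C_def)
    next
      case False
      then have e: "(y, \<alpha>) \<in> exit_set" using y by (simp add: exit_set_iff)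
      have "\<not> \<alpha> \<le> 0" using False y order_trans by blast
      then have e0: "(0, \<alpha>) \<in> exit_set" using y by (simp add: exit_set_iff)
      have "\<upsilon> y \<alpha> \<le> penalty_bound \<alpha>" using penalty_antimono[OF e0 e y(1)] e0 by (simp add: penalty_bound_def)
      moreover have "0 \<le> penalty_bound \<alpha>" by (simp add: penalty_bound_def)
      moreover have "0 \<le> K * growth b" by (rule E0)
      moreover have "payoff y \<alpha> = - \<upsilon> y \<alpha>" using False y by (simp add: payoff_def)
      ultimately show ?thesis using lo[OF e y(2)] unfolding C_def abs_le_iff by linarith
    qed
  qed
qed

lemma payoff_integrable: assumes "0 \<le> y" shows "integrable \<mu> (payoff y)"
proof -
  interpret \<mu>: prob_space \<mu> by (rule prob_space_\<mu>)
  obtain C where C: "C \<ge> 0" "\<And>z \<alpha>. 0 \<le> z \<Longrightarrow> z \<le> y \<Longrightarrow> 0 \<le> \<alpha> \<Longrightarrow> \<bar>payoff z \<alpha>\<bar> \<le> C + penalty_bound \<alpha>"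
    using payoff_bound by blast
  show ?thesis
  proof (rule Bochner_Integration.integrable_bound[of _ "\<lambda>\<alpha>. C + penalty_bound \<alpha>"])
    show "AE \<alpha> in \<mu>. norm (payoff y \<alpha>) \<le> norm (C + penalty_bound \<alpha>)"
      using nonneg_AE
    proof eventually_elim
      case (elim \<alpha>)
      then show ?case using C(2)[of y \<alpha>] assms by simp
    qed
  qed (auto intro!: Bochner_Integration.integrable_add penalty_bound_integrable)
qed

text \<open>Survived and fatal claims contribute the two halves of the mean of
  \<open>payoff y\<close>. Read as rate * (mean payoff - u) = c u - g, this is the identity by which
  the running term cancels against the compensated claim jumps.\<close>

lemma g_payoff:
  assumes y: "0 \<le> y" shows "g y = (c + rate) * u y - rate * (\<integral>\<alpha>. payoff y \<alpha> \<partial>\<mu>)"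
proof -
  let ?A = "{\<alpha>. \<alpha> \<in> {0..} \<and> y - \<alpha> \<in> {0..}}" and ?E = "{\<alpha>. (y, \<alpha>) \<in> exit_set}"
  have i1: "integrable \<mu> (\<lambda>\<alpha>. indicator ?A \<alpha> *\<^sub>R u (y - \<alpha>))"
    using shift_integrable[OF u_continuous] by (simp add: set_integrable_def)
  have e: "indicator ?E \<alpha> *\<^sub>R \<upsilon> y \<alpha> = indicator ?A \<alpha> *\<^sub>R u (y - \<alpha>) - payoff y \<alpha>" for \<alpha>
    using y by (auto simp: payoff_def exit_set_iff indicator_def)
  have eq: "(LINT \<alpha>:?E|\<mu>. \<upsilon> y \<alpha>) = (LINT \<alpha>:?A|\<mu>. u (y - \<alpha>)) - (\<integral>\<alpha>. payoff y \<alpha> \<partial>\<mu>)"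
    unfolding set_lebesgue_integral_def e
    by (rule Bochner_Integration.integral_diff[OF i1 payoff_integrable[OF y]])
  show ?thesis unfolding g_def I_term_def R_term_def eq by (simp add: right_diff_distrib)
qed

lemma g_measurable: "(\<lambda>y. if 0 \<le> y then g y else 0) \<in> borel_measurable borel"
proof -
  interpret \<mu>: prob_space \<mu> by (rule prob_space_\<mu>)
  have "(\<lambda>(y, \<alpha>). payoff y \<alpha>) \<in> borel_measurable (borel \<Otimes>\<^sub>M \<mu>)"
    unfolding split_beta by measurable
  then have "(\<lambda>y. \<integral>\<alpha>. payoff y \<alpha> \<partial>\<mu>) \<in> borel_measurable borel"
    by (rule \<mu>.borel_measurable_lebesgue_integral)
  moreover have "(\<lambda>y. if 0 \<le> y then g y else 0) =
     (\<lambda>y. (c + rate) * (if 0 \<le> y then u y else 0) - rate * (\<integral>\<alpha>. payoff y \<alpha> \<partial>\<mu>))"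
    by (auto simp: g_payoff payoff_def fun_eq_iff)
  ultimately show ?thesis using u_indicator_measurable by simp
qed

lemma g_bound:
  obtains C where "C \<ge> 0" "\<And>y. 0 \<le> y \<Longrightarrow> y \<le> b \<Longrightarrow> \<bar>g y\<bar> \<le> C"
proof -
  interpret \<mu>: prob_space \<mu> by (rule prob_space_\<mu>)
  obtain C where C: "C \<ge> 0" "\<And>z \<alpha>. 0 \<le> z \<Longrightarrow> z \<le> b \<Longrightarrow> 0 \<le> \<alpha> \<Longrightarrow> \<bar>payoff z \<alpha>\<bar> \<le> C + penalty_bound \<alpha>"
    using payoff_bound by blast
  define D where "D = (\<integral>\<alpha>. C + penalty_bound \<alpha> \<partial>\<mu>)"
  have D: "\<bar>\<integral>\<alpha>. payoff y \<alpha> \<partial>\<mu>\<bar> \<le> D" if "0 \<le> y" "y \<le> b" for y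
  proof -
    have "\<bar>\<integral>\<alpha>. payoff y \<alpha> \<partial>\<mu>\<bar> \<le> (\<integral>\<alpha>. \<bar>payoff y \<alpha>\<bar> \<partial>\<mu>)" by (rule integral_abs_bound)
    also have "\<dots> \<le> D" unfolding D_def
    proof (rule integral_mono_AE)
      show "AE x in \<mu>. \<bar>payoff y x\<bar> \<le> C + penalty_bound x"
        using nonneg_AE by eventually_elim (use C(2) that in auto)
    qed (auto intro!: payoff_integrable integrable_abs penalty_bound_integrable that)
    finally show ?thesis .
  qed
  show ?thesis
  proof (rule that[of "(c + rate) * (\<bar>u 0\<bar> + \<bar>u b\<bar>) + rate * \<bar>D\<bar>"])
    show "(c + rate) * (\<bar>u 0\<bar> + \<bar>u b\<bar>) + rate * \<bar>D\<bar> \<ge> 0" using c_pos rate_pos by simp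
    fix y assume y: "0 \<le> y" "y \<le> b"
    have "\<bar>g y\<bar> \<le> (c + rate) * \<bar>u y\<bar> + rate * \<bar>\<integral>\<alpha>. payoff y \<alpha> \<partial>\<mu>\<bar>"
      unfolding g_payoff[OF y(1)] using c_pos rate_pos abs_triangle_ineq4[of "(c + rate) * u y" "rate * (\<integral>\<alpha>. payoff y \<alpha> \<partial>\<mu>)"]
      by (simp add: abs_mult)
    also have "\<dots> \<le> (c + rate) * (\<bar>u 0\<bar> + \<bar>u b\<bar>) + rate * \<bar>D\<bar>"
      using c_pos rate_pos u_box_bound[OF y] D[OF y] by (intro add_mono mult_left_mono) auto
    finally show "\<bar>g y\<bar> \<le> (c + rate) * (\<bar>u 0\<bar> + \<bar>u b\<bar>) + rate * \<bar>D\<bar>" .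
  qed
qed

text \<open>Approach from above is essential. Then \<alpha> \<le> x forces \<alpha> \<le> y n, while
  a coordinate of \<alpha> exceeding that of x eventually exceeds that of y n; so the integrands
  converge for every \<alpha>, atoms on the boundary of the box included. From below, a claim
  \<alpha> = x would contribute only in the limit.\<close>

lemma g_right_continuous:
  fixes y :: "nat \<Rightarrow> real^'n"
  assumes lim: "y \<longlonglongrightarrow> x" and x: "0 \<le> x" and y: "\<And>n. x \<le> y n"
  shows "(\<lambda>n. g (y n)) \<longlonglongrightarrow> g x"
proof -
  interpret \<mu>: prob_space \<mu> by (rule prob_space_\<mu>)
  have y0: "0 \<le> y n" for n using x y order_trans by blast
  have ul: "(\<lambda>n. u (y n)) \<longlonglongrightarrow> u x"
    by (rule continuous_on_tendsto_compose[OF u_continuous lim]) (use x y0 in auto)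
  have Rl: "(\<lambda>n. R_term rate (distr M borel (U 1)) \<upsilon> (y n)) \<longlonglongrightarrow> R_term rate (distr M borel (U 1)) \<upsilon> x"
    by (rule continuous_on_tendsto_compose[OF R_continuous lim]) (use x y0 in auto)
  note Rl = Rl[folded \<mu>_def]
  have "bounded (range (\<lambda>n. u (y n)))" using ul convergent_imp_bounded by blast
  then obtain B where B: "\<And>n. \<bar>u (y n)\<bar> \<le> B" unfolding bounded_iff by auto
  let ?A = "\<lambda>y. {\<alpha>. \<alpha> \<in> {0..} \<and> y - \<alpha> \<in> {0..}}"
  have "(\<lambda>n. LINT \<alpha>|\<mu>. indicator (?A (y n)) \<alpha> *\<^sub>R u (y n - \<alpha>)) \<longlonglongrightarrow> (LINT \<alpha>|\<mu>. indicator (?A x) \<alpha> *\<^sub>R u (x - \<alpha>))"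
  proof (rule integral_dominated_convergence[where w="\<lambda>_. \<bar>u 0\<bar> + B"])
    show "(\<lambda>\<alpha>. indicator (?A x) \<alpha> *\<^sub>R u (x - \<alpha>)) \<in> borel_measurable \<mu>"
      using shift_integrable[OF u_continuous, of x] unfolding set_integrable_def by (rule borel_measurable_integrable)
    show "(\<lambda>\<alpha>. indicator (?A (y n)) \<alpha> *\<^sub>R u (y n - \<alpha>)) \<in> borel_measurable \<mu>" for n
      using shift_integrable[OF u_continuous, of "y n"] unfolding set_integrable_def by (rule borel_measurable_integrable)
    show "AE \<alpha> in \<mu>. norm (indicator (?A (y n)) \<alpha> *\<^sub>R u (y n - \<alpha>)) \<le> \<bar>u 0\<bar> + B" for n
    proof (rule AE_I2)
      fix \<alpha> show "norm (indicator (?A (y n)) \<alpha> *\<^sub>R u (y n - \<alpha>)) \<le> \<bar>u 0\<bar> + B"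
      proof (cases "\<alpha> \<in> ?A (y n)")
        case True
        then have "y n - \<alpha> \<le> y n" by (simp add: less_eq_vec_def)
        then have "\<bar>u (y n - \<alpha>)\<bar> \<le> \<bar>u 0\<bar> + \<bar>u (y n)\<bar>" using True by (intro u_box_bound) auto
        then show ?thesis using True B[of n] by simp
      next
        case False then show ?thesis using B[of n] by simp
      qed
    qed
    show "AE \<alpha> in \<mu>. (\<lambda>n. indicator (?A (y n)) \<alpha> *\<^sub>R u (y n - \<alpha>)) \<longlonglongrightarrow> indicator (?A x) \<alpha> *\<^sub>R u (x - \<alpha>)"
    proof (rule AE_I2)
      fix \<alpha> :: "real^'n"
      consider "0 \<le> \<alpha>" "\<alpha> \<le> x" | "\<not> 0 \<le> \<alpha>" | i where "x $ i < \<alpha> $ i" by (meson less_eq_vec_def not_le)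
      then show "(\<lambda>n. indicator (?A (y n)) \<alpha> *\<^sub>R u (y n - \<alpha>)) \<longlonglongrightarrow> indicator (?A x) \<alpha> *\<^sub>R u (x - \<alpha>)"
      proof cases
        case 1
        have *: "\<alpha> \<le> y n" for n using 1(2) y order_trans by blast
        have "(\<lambda>n. u (y n - \<alpha>)) \<longlonglongrightarrow> u (x - \<alpha>)"
          by (rule continuous_on_tendsto_compose[OF u_continuous]) (use 1 * lim in \<open>auto intro!: tendsto_intros\<close>)
        then show ?thesis using 1 * by simp
      next
        case 2 then show ?thesis by simp
      next
        case 3
        have "(\<lambda>n. y n $ i) \<longlonglongrightarrow> x $ i" using lim by (rule tendsto_vec_nth)
        then have "\<forall>\<^sub>F n in sequentially. y n $ i < \<alpha> $ i" using 3 by (rule order_tendstoD(2))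
        then have "\<forall>\<^sub>F n in sequentially. indicator (?A (y n)) \<alpha> *\<^sub>R u (y n - \<alpha>) = 0"
        proof eventually_elim
          case (elim n)
          then have "\<not> \<alpha> \<le> y n" by (auto simp: less_eq_vec_def not_le)
          then show ?case by simp
        qed
        moreover have "\<not> \<alpha> \<le> x" using 3 by (auto simp: less_eq_vec_def not_le)
        ultimately show ?thesis by (simp add: tendsto_eventually)
      qed
    qed
  qed simp
  then have "(\<lambda>n. I_term rate \<mu> u (y n)) \<longlonglongrightarrow> I_term rate \<mu> u x"
    unfolding I_term_def set_lebesgue_integral_def by (rule tendsto_mult_left)
  then show ?thesis unfolding g_def[abs_def] by (intro tendsto_intros ul Rl)
qed

text \<open>The nonlocal term need not be continuous when the claim law has atoms.  Splitting off monotone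
  parts suffices, because the increments of a monotone function telescope along a partition.\<close>

lemma g_decomposition:
  obtains A D E where "continuous_on {0..} A" "\<And>y. 0 \<le> y \<Longrightarrow> g y = A y - D y + (E y :: real)"
    "\<And>y z. 0 \<le> y \<Longrightarrow> y \<le> z \<Longrightarrow> D y \<le> D z" "\<And>y z. 0 \<le> y \<Longrightarrow> y \<le> z \<Longrightarrow> E y \<le> E z"
proof -
  interpret \<mu>: prob_space \<mu> by (rule prob_space_\<mu>)
  let ?A = "\<lambda>y :: real^'n. {\<alpha>. \<alpha> \<in> {0..} \<and> y - \<alpha> \<in> {0..}}"
  define F where "F y = measure \<mu> (?A y)" for y
  \<comment> \<open>Subtracting \<open>u 0\<close> makes the integrand nonnegative on the domain, so
    the integral grows with the domain as well as with the integrand.\<close>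
  define J where "J y = (LINT \<alpha>:?A y|\<mu>. u (y - \<alpha>) - u 0)" for y
  have As: "?A y \<in> sets borel" for y
  proof -
    have "?A y = {0..y}" by auto
    then show ?thesis by simp
  qed
  have iJ: "set_integrable \<mu> (?A y) (\<lambda>\<alpha>. u (y - \<alpha>) - u 0)" for y
    using shift_integrable[of "\<lambda>y. u y - u 0"] u_continuous by (simp add: continuous_on_diff)
  have sub: "?A y \<subseteq> ?A z" if "y \<le> z" for y z using that order_trans by auto
  have Fm: "F y \<le> F z" if "y \<le> z" for y z
    unfolding F_def using sub[OF that] As by (intro \<mu>.finite_measure_mono) auto
  have Jm: "J y \<le> J z" if "0 \<le> y" "y \<le> z" for y z
    unfolding J_def set_lebesgue_integral_def
  proof (rule integral_mono)
    fix \<alpha>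
    show "indicator (?A y) \<alpha> *\<^sub>R (u (y - \<alpha>) - u 0) \<le> indicator (?A z) \<alpha> *\<^sub>R (u (z - \<alpha>) - u 0)"
    proof (cases "\<alpha> \<in> ?A y")
      case True
      then have "\<alpha> \<in> ?A z" using sub[OF that(2)] by blast
      moreover have "u (y - \<alpha>) \<le> u (z - \<alpha>)" using True that by (intro u_mono) auto
      ultimately show ?thesis using True by simp
    next
      case False
      then have "indicator (?A y) \<alpha> *\<^sub>R (u (y - \<alpha>) - u 0) = 0" by simp
      then show ?thesis using u_mono[of 0 "z - \<alpha>"] by (simp only:) (simp add: indicator_def)
    qed
  qed (use iJ in \<open>auto simp: set_integrable_def\<close>)
  have I: "I_term rate \<mu> u y = rate * J y + rate * (u 0 * F y)" for y
  proof -
    have "set_integrable \<mu> (?A y) (\<lambda>\<alpha>. u 0)"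
      unfolding set_integrable_def using As
      by (intro \<mu>.integrable_const_bound[of _ "\<bar>u 0\<bar>"]) (auto simp: indicator_def)
    from set_integral_add(2)[OF iJ this]
    have "(LINT \<alpha>:?A y|\<mu>. u (y - \<alpha>)) = J y + (LINT \<alpha>:?A y|\<mu>. u 0)" by (simp add: J_def)
    also have "(LINT \<alpha>:?A y|\<mu>. u 0) = u 0 * F y"
      using As[of y] unfolding set_lebesgue_integral_def F_def by simp
    finally show ?thesis unfolding I_term_def by (simp add: distrib_left)
  qed
  \<comment> \<open>The coefficient \<open>u 0\<close> of the monotone function \<open>F\<close> may
    have either sign: its positive part goes into \<open>D\<close>, its negative part into
    \<open>E\<close>.\<close>
  define D where "D y = rate * J y + rate * (max (u 0) 0 * F y)" for y
  define E where "E y = rate * (max (- u 0) 0 * F y)" for y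
  show ?thesis
  proof (rule that[of "\<lambda>y. (c + rate) * u y + R_term rate \<mu> \<upsilon> y" D E])
    show "continuous_on {0..} (\<lambda>y. (c + rate) * u y + R_term rate \<mu> \<upsilon> y)"
      using R_continuous[folded \<mu>_def] by (intro continuous_intros u_continuous) 
    fix y :: "real^'n"
    show "g y = (c + rate) * u y + R_term rate \<mu> \<upsilon> y - D y + E y"
      unfolding g_def I D_def E_def by (simp add: max_def algebra_simps)
  next
    fix y z :: "real^'n" assume yz: "0 \<le> y" "y \<le> z"
    show "D y \<le> D z" unfolding D_def using rate_pos Jm[OF yz] Fm[OF yz(2)]
      by (intro add_mono mult_left_mono) auto
    show "E y \<le> E z" unfolding E_def using rate_pos Fm[OF yz(2)] by (intro mult_left_mono) auto
  qed
qed

section \<open>Increments of \<open>u\<close> between claims\<close>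

lemma set_integral_const: "(s::real) \<le> t \<Longrightarrow> (LINT r:{s<..t}|lborel. k) = (t - s) * (k::real)"
  by (simp add: set_lebesgue_integral_def)

lemma set_integrable_const: "set_integrable lborel {s<..(t::real)} (\<lambda>_. k::real)"
  by (cases "s \<le> t") (auto simp: set_integrable_def intro!: integrable_real_indicator)

lemma interval_integrable:
  fixes y :: "real \<Rightarrow> real^'n"
  assumes y: "y \<in> borel_measurable borel" and b: "\<And>r. s < r \<Longrightarrow> r \<le> t \<Longrightarrow> 0 \<le> y r \<and> y r \<le> b"
  shows "set_integrable lborel {s<..t} (\<lambda>r. g (y r))"
proof -
  obtain C where C: "C \<ge> 0" "\<And>y. 0 \<le> y \<Longrightarrow> y \<le> b \<Longrightarrow> \<bar>g y\<bar> \<le> C" using g_bound by metis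
  have "set_integrable lborel {s<..t} (\<lambda>r. if 0 \<le> y r then g (y r) else 0)"
    unfolding set_integrable_def
  proof (rule Bochner_Integration.integrable_bound[of _ "\<lambda>r. indicator {s<..t} r * C"])
    show "integrable lborel (\<lambda>r. indicator {s<..t} r * C)" by (cases "s \<le> t") auto
    show "(\<lambda>r. indicator {s<..t} r *\<^sub>R (if 0 \<le> y r then g (y r) else 0)) \<in> borel_measurable lborel"
      using measurable_compose[OF y g_measurable] by simp
    show "AE r in lborel. norm (indicator {s<..t} r *\<^sub>R (if 0 \<le> y r then g (y r) else 0)) \<le> norm (indicator {s<..t} r * C)"
      using b C by (intro AE_I2) (auto simp: indicator_def)
  qed
  moreover have "indicator {s<..t} r *\<^sub>R (if 0 \<le> y r then g (y r) else 0) = indicator {s<..t} r *\<^sub>R g (y r)" for r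
    using b by (auto simp: indicator_def)
  ultimately show ?thesis unfolding set_integrable_def by (simp only:)
qed

lemma interval_integral_combine:
  assumes "set_integrable lborel {s<..t} h" "s \<le> r" "r \<le> (t::real)"
  shows "(LINT x:{s<..t}|lborel. h x) = (LINT x:{s<..r}|lborel. h x) + (LINT x:{r<..t}|lborel. (h x :: real))"
proof -
  have e: "{s<..t} = {s<..r} \<union> {r<..t}" using assms by auto
  show ?thesis unfolding e
    by (rule set_integral_Un; (rule set_integrable_subset[OF assms(1)])?) (use assms in auto)
qed

text \<open>For r in a cell (s, t], the supremum of \<open>g\<close> over the box between L s and L
  t exceeds g (L r) by at most e, from uniform continuity of the continuous part, plus the increment
  of \<open>Mo\<close>. Over N cells of length h / N the latter add up to h / N times the total
  increment of \<open>Mo\<close>, which vanishes in the limit.\<close>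

lemma u_line_increment:
  assumes x: "0 \<le> x" and h: "0 \<le> h"
  shows "u (x + h *\<^sub>R p) - u x \<le> (LINT s:{0<..h}|lborel. g (x + s *\<^sub>R p))"
proof -
  obtain A D E where dec: "continuous_on {0..} A" "\<And>y. 0 \<le> y \<Longrightarrow> g y = A y - D y + (E y :: real)"
    "\<And>y z. 0 \<le> y \<Longrightarrow> y \<le> z \<Longrightarrow> D y \<le> D z" "\<And>y z. 0 \<le> y \<Longrightarrow> y \<le> z \<Longrightarrow> E y \<le> E z"
    using g_decomposition by blast
  define L where "L s = x + s *\<^sub>R p" for s
  have Lm: "L s \<le> L t" if "s \<le> t" for s t
    using that p_pos by (auto simp: L_def less_eq_vec_def intro!: mult_right_mono less_imp_le)
  have L0: "0 \<le> L s" if "0 \<le> s" for s using Lm[OF that] x order_trans by (auto simp: L_def)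
  have Li: "set_integrable lborel {s<..t} (\<lambda>r. g (L r))" if "0 \<le> s" for s t
  proof (rule interval_integrable)
    show "L \<in> borel_measurable borel" unfolding L_def by measurable
    show "0 \<le> L r \<and> L r \<le> L t" if "s < r" "r \<le> t" for r using that \<open>0 \<le> s\<close> L0 Lm by auto
  qed
  define Mo where "Mo s = D (L s) + E (L s)" for s
  have key: "u (L h) - u (L 0) \<le> (LINT s:{0<..h}|lborel. g (L s)) + h * e" if h: "h > 0" and e: "e > 0" for e
  proof -
    have "uniformly_continuous_on {L 0..L h} A"
      by (intro compact_uniformly_continuous continuous_on_subset[OF dec(1)]) (use L0[of 0] order_trans in auto)
    then obtain d where d: "d > 0" "\<And>y z. y \<in> {L 0..L h} \<Longrightarrow> z \<in> {L 0..L h} \<Longrightarrow> norm (y - z) < d \<Longrightarrow> \<bar>A y - A z\<bar> < e"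
      using e unfolding uniformly_continuous_on_def dist_norm real_norm_def by metis
    have cell: "u (L t) - u (L s) \<le> (LINT r:{s<..t}|lborel. g (L r)) + (t - s) * (e + Mo t - Mo s)"
      if st: "0 \<le> s" "s < t" "t \<le> h" "(t - s) * norm p < d" for s t
    proof -
      have gb: "g y \<le> g (L r) + (e + Mo t - Mo s)" if y: "L s \<le> y" "y \<le> L t" and r: "s < r" "r \<le> t" for y r
      proof -
        have "norm (y - L r) \<le> norm ((t - s) *\<^sub>R p)"
        proof (rule norm_le_componentwise_cart)
          fix i
          have "L s $ i \<le> y $ i" "y $ i \<le> L t $ i" "L s $ i \<le> L r $ i" "L r $ i \<le> L t $ i"
            using y Lm[of s r] Lm[of r t] r by (auto simp: less_eq_vec_def)
          moreover have "L t $ i - L s $ i = (t - s) * p $ i" by (simp add: L_def algebra_simps)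
          moreover have "0 \<le> (t - s) * p $ i" using st p_pos[of i] by simp
          ultimately show "norm ((y - L r) $ i) \<le> norm (((t - s) *\<^sub>R p) $ i)" by simp
        qed
        then have "norm (y - L r) < d" using st by simp
        moreover have "L 0 \<le> L s" "L t \<le> L h" "L 0 \<le> L r" "L r \<le> L h" using st r by (auto intro!: Lm)
        ultimately have "A y < A (L r) + e" using d(2)[of y "L r"] y order_trans by fastforce
        moreover have "D (L s) \<le> D y" "E y \<le> E (L t)" "D (L r) \<le> D (L t)" "E (L s) \<le> E (L r)"
          using y st r L0 Lm order_trans[OF L0[OF st(1)] y(1)] by (auto intro!: dec(3,4))
        ultimately show ?thesis using dec(2)[of y] dec(2)[of "L r"] L0[of r] st r order_trans[OF L0[OF st(1)] y(1)]
          by (simp add: Mo_def)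
      qed
      define Q where "Q = (SUP y\<in>{L s..L t}. g y)"
      have bdd: "bdd_above (g ` {L s..L t})" using gb[of _ t] st by (intro bdd_aboveI2[where M="g (L t) + (e + Mo t - Mo s)"]) auto
      have ne: "L s \<in> {L s..L t}" using Lm[of s t] st by auto
      have Qr: "Q \<le> g (L r) + (e + Mo t - Mo s)" if "s < r" "r \<le> t" for r
        unfolding Q_def using ne gb that by (intro cSUP_least) auto
      have Lt: "L s + (t - s) *\<^sub>R p = L t" by (simp add: L_def algebra_simps)
      have "u (L s + (t - s) *\<^sub>R p) - u (L s) \<le> (t - s) * Q"
        using L0[of s] st unfolding Q_def
        by (intro u_box_increment cSUP_upper bdd) (auto simp: Lt)
      also have "(t - s) * Q = (LINT r:{s<..t}|lborel. Q)" using st by (simp add: set_integral_const)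
      also have "\<dots> \<le> (LINT r:{s<..t}|lborel. g (L r) + (e + Mo t - Mo s))"
        using st by (intro set_integral_mono set_integral_add Li Qr set_integrable_const) auto
      also have "\<dots> = (LINT r:{s<..t}|lborel. g (L r)) + (t - s) * (e + Mo t - Mo s)"
        using st by (subst set_integral_add(2)[OF Li]) (auto intro: set_integrable_const simp: set_integral_const)
      finally show ?thesis unfolding Lt .
    qed
    have Mm: "Mo s \<le> Mo t" if "0 \<le> s" "s \<le> t" for s t
      unfolding Mo_def using that L0 Lm by (intro add_mono dec) auto
    have step: "u (L h) - u (L 0) \<le> (LINT r:{0<..h}|lborel. g (L r)) + h * e + h / N * (Mo h - Mo 0)"
      if N: "N > 0" "h / real N * norm p < d" for N :: nat
    proof -
      define \<delta> where "\<delta> = h / real N"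
      have \<delta>: "\<delta> > 0" "N * \<delta> = h" using h N by (auto simp: \<delta>_def)
      have "u (L (j * \<delta>)) - u (L 0) \<le> (LINT r:{0<..j * \<delta>}|lborel. g (L r)) + j * \<delta> * e + \<delta> * (Mo (j * \<delta>) - Mo 0)"
        if "j \<le> N" for j
        using that
      proof (induction j)
        case 0
        then show ?case by (simp add: set_lebesgue_integral_def)
      next
        case (Suc j)
        have "Suc j * \<delta> \<le> N * \<delta>" using Suc.prems \<delta>(1) by (intro mult_right_mono) auto
        then have "u (L (Suc j * \<delta>)) - u (L (j * \<delta>)) \<le> (LINT r:{j * \<delta><..Suc j * \<delta>}|lborel. g (L r))
          + (Suc j * \<delta> - j * \<delta>) * (e + Mo (Suc j * \<delta>) - Mo (j * \<delta>))"
          using \<delta> N(2) by (intro cell) (auto simp: algebra_simps \<delta>_def[symmetric])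
        moreover have "(LINT r:{0<..Suc j * \<delta>}|lborel. g (L r)) =
            (LINT r:{0<..j * \<delta>}|lborel. g (L r)) + (LINT r:{j * \<delta><..Suc j * \<delta>}|lborel. g (L r))"
          using \<delta>(1) by (intro interval_integral_combine Li) (auto intro!: mult_right_mono)
        ultimately show ?case using Suc by (simp add: algebra_simps)
      qed
      from this[of N] show ?thesis unfolding \<delta>(2) by (simp add: \<delta>_def)
    qed
    have "(\<lambda>N. h / real N) \<longlonglongrightarrow> 0" by (rule lim_const_over_n)
    then have l1: "(\<lambda>N. h / real N * norm p) \<longlonglongrightarrow> 0" and l2: "(\<lambda>N. h / real N * (Mo h - Mo 0)) \<longlonglongrightarrow> 0"
      by (simp_all only: tendsto_mult_left_zero)
    have "\<forall>\<^sub>F N in sequentially. h / real N * norm p < d" using l1 d(1) by (rule order_tendstoD(2))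
    then have "\<forall>\<^sub>F N in sequentially. u (L h) - u (L 0) \<le> (LINT r:{0<..h}|lborel. g (L r)) + h * e + h / real N * (Mo h - Mo 0)"
      using eventually_gt_at_top[of 0] by eventually_elim (intro step)
    from tendsto_le[OF _ tendsto_add[OF tendsto_const l2] tendsto_const this] show ?thesis by simp
  qed
  show ?thesis
  proof (cases "h = 0")
    case False
    then have "u (L h) - u (L 0) \<le> (LINT s:{0<..h}|lborel. g (L s)) + e" if "e > 0" for e
      using key[of "e / h"] h that by simp
    then have "u (L h) - u (L 0) \<le> (LINT s:{0<..h}|lborel. g (L s))" by (rule field_le_epsilon)
    then show ?thesis by (simp add: L_def)
  qed (simp add: set_lebesgue_integral_def)
qed

lemma p_scale_mono: "s \<le> t \<Longrightarrow> s *\<^sub>R p \<le> t *\<^sub>R p"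
  using p_pos by (auto simp: less_eq_vec_def intro!: mult_right_mono less_imp_le)

text \<open>Within a grid cell the dividends are postponed to the right end:
  \<open>u_line_increment\<close> covers the drift and \<open>u_increment\<close> the lump payment.
  The postponed path \<open>z n\<close> lies above the left limits \<open>ym\<close> and converges
  to them, so right continuity of \<open>g\<close> and dominated convergence remove the
  grid.\<close>

lemma claim_free_increment:
  fixes D y ym :: "real \<Rightarrow> real^'n"
  assumes st: "s < t" and D: "\<And>r r'. s \<le> r \<Longrightarrow> r \<le> r' \<Longrightarrow> r' \<le> t \<Longrightarrow> D r \<le> D r'"
    and y: "\<And>r. s \<le> r \<Longrightarrow> r \<le> t \<Longrightarrow> y r = y0 + (r - s) *\<^sub>R p - D r"
    and pos: "\<And>r. s \<le> r \<Longrightarrow> r \<le> t \<Longrightarrow> 0 \<le> y r"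
    and ym: "\<And>r. s < r \<Longrightarrow> r \<le> t \<Longrightarrow> (y \<longlongrightarrow> ym r) (at_left r)"
  shows "u (y t) + a \<bullet> D t \<le> u (y s) + a \<bullet> D s + (LINT r:{s<..t}|lborel. g (ym r))"
proof -
  define gg where "gg z = (if 0 \<le> z then g z else 0)" for z
  have gg [measurable]: "gg \<in> borel_measurable borel" unfolding gg_def[abs_def] by (rule g_measurable)
  define \<delta> where "\<delta> n = (t - s) / real (Suc n)" for n
  have \<delta>: "\<delta> n > 0" "real (Suc n) * \<delta> n = t - s" for n using st by (auto simp: \<delta>_def)
  have \<delta>0: "\<delta> \<longlonglongrightarrow> 0" unfolding \<delta>_def
    by (rule filterlim_compose[OF lim_const_over_n filterlim_Suc])
  define z where "z n r = y (grid_before s (\<delta> n) r) + (r - grid_before s (\<delta> n) r) *\<^sub>R p" for n r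
  define b where "b = y s + (t - s) *\<^sub>R p"
  have yle: "y r' \<le> y r + (r' - r) *\<^sub>R p" if "s \<le> r" "r \<le> r'" "r' \<le> t" for r r'
  proof -
    have "y r + (r' - r) *\<^sub>R p - y r' = D r' - D r" using that y[of r] y[of r']
      by (simp add: scaleR_diff_left)
    moreover have "0 \<le> D r' - D r" using D[OF that] by simp
    ultimately show ?thesis by (metis vec_diff_nonneg)
  qed
  have gb: "s \<le> grid_before s (\<delta> n) r" "grid_before s (\<delta> n) r < r" if "s < r" for n r
    using grid_before_ge[OF \<delta>(1) that] grid_before_bounds[OF \<delta>(1)] by auto
  have z0: "0 \<le> z n r" "z n r \<le> b" if r: "s < r" "r \<le> t" for n r
  proof -
    let ?k = "grid_before s (\<delta> n) r"
    have k: "s \<le> ?k" "?k \<le> r" "?k \<le> t" using gb[OF r(1), of n] r by auto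
    have "0 *\<^sub>R p \<le> (r - ?k) *\<^sub>R p" by (rule p_scale_mono) (use k in simp)
    then show "0 \<le> z n r" unfolding z_def using pos[OF k(1,3)] by (simp add: add_nonneg_nonneg less_eq_vec_def)
    have "z n r \<le> y s + (?k - s) *\<^sub>R p + (r - ?k) *\<^sub>R p"
      unfolding z_def using yle[of s ?k] k by (simp add: less_eq_vec_def)
    also have "\<dots> = y s + (r - s) *\<^sub>R p" by (simp add: algebra_simps)
    also have "\<dots> \<le> b" unfolding b_def using p_scale_mono[of "r - s" "t - s"] r by (simp add: less_eq_vec_def)
    finally show "z n r \<le> b" .
  qed
  obtain B where B: "B \<ge> 0" "\<And>y. 0 \<le> y \<Longrightarrow> y \<le> b \<Longrightarrow> \<bar>g y\<bar> \<le> B" using g_bound by metis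
  have zm: "z n \<in> borel_measurable borel" for n
    unfolding z_def by (intro borel_measurable_add borel_measurable_scaleR borel_measurable_diff
        grid_before_compose_measurable[of y] grid_before_compose_measurable[of "\<lambda>x. x"]) auto
  have intz: "set_integrable lborel {s<..t} (\<lambda>r. g (z n r))" for n
    by (rule interval_integrable[OF zm]) (use z0 in auto)
  have step: "u (y t) + a \<bullet> D t \<le> u (y s) + a \<bullet> D s + (LINT r:{s<..t}|lborel. g (z n r))" for n
  proof -
    define q where "q j = s + real j * \<delta> n" for j
    have qs: "s \<le> q j" "q j \<le> t" if "j \<le> Suc n" for j
    proof -
      show "s \<le> q j" using \<delta>(1)[of n] by (simp add: q_def)
      have "real j * \<delta> n \<le> real (Suc n) * \<delta> n" using \<delta>(1)[of n] that by (intro mult_right_mono) auto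
      then show "q j \<le> t" unfolding q_def \<delta>(2) by simp
    qed
    have qS: "q (Suc j) = q j + \<delta> n" for j by (simp add: q_def algebra_simps)
    have "u (y (q j)) + a \<bullet> D (q j) \<le> u (y s) + a \<bullet> D s + (LINT r:{s<..q j}|lborel. g (z n r))" if "j \<le> Suc n" for j
      using that
    proof (induction j)
      case 0 then show ?case by (simp add: q_def set_lebesgue_integral_def)
    next
      case (Suc j)
      have j: "s \<le> q j" "q j \<le> t" "s \<le> q (Suc j)" "q (Suc j) \<le> t" using qs Suc.prems by auto
      have lt: "q j < q (Suc j)" using \<delta>(1)[of n] by (simp add: qS)
      have e: "y (q (Suc j)) + (D (q (Suc j)) - D (q j)) = y (q j) + \<delta> n *\<^sub>R p"
        unfolding y[OF j(1,2)] y[OF j(3,4)] unfolding qS by (simp add: algebra_simps)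
      have "u (y (q (Suc j))) + a \<bullet> (D (q (Suc j)) - D (q j)) \<le> u (y (q j) + \<delta> n *\<^sub>R p)"
        unfolding e[symmetric] by (rule u_increment) (use pos D j lt in auto)
      also have "\<dots> \<le> u (y (q j)) + (LINT v:{0<..\<delta> n}|lborel. g (y (q j) + v *\<^sub>R p))"
        using u_line_increment[of "y (q j)" "\<delta> n"] pos j \<delta>(1)[of n] by simp
      also have "(LINT v:{0<..\<delta> n}|lborel. g (y (q j) + v *\<^sub>R p)) = (LINT r:{q j<..q (Suc j)}|lborel. g (z n r))"
      proof -
        have "(LINT r|lborel. indicator {q j<..q (Suc j)} r *\<^sub>R g (z n r)) =
            (LINT v|lborel. indicator {q j<..q (Suc j)} (q j + v) *\<^sub>R g (z n (q j + v)))"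
          using lborel_integral_real_affine[of 1 "\<lambda>r. indicator {q j<..q (Suc j)} r *\<^sub>R g (z n r)" "q j"] by simp
        also have "\<dots> = (LINT v|lborel. indicator {0<..\<delta> n} v *\<^sub>R g (y (q j) + v *\<^sub>R p))"
        proof (rule Bochner_Integration.integral_cong[OF refl])
          fix v
          have "z n (q j + v) = y (q j) + v *\<^sub>R p" if "0 < v" "v \<le> \<delta> n"
          proof -
            have "grid_before s (\<delta> n) (q j + v) = q j" unfolding q_def
              by (rule grid_before_cell[OF \<delta>(1)]) (use that in \<open>auto simp: algebra_simps\<close>)
            then show ?thesis by (simp add: z_def)
          qed
          then show "indicator {q j<..q (Suc j)} (q j + v) *\<^sub>R g (z n (q j + v)) = indicator {0<..\<delta> n} v *\<^sub>R g (y (q j) + v *\<^sub>R p)"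
            by (auto simp: indicator_def qS)
        qed
        finally show ?thesis by (simp add: set_lebesgue_integral_def)
      qed
      finally have "u (y (q (Suc j))) + a \<bullet> D (q (Suc j)) \<le> u (y (q j)) + a \<bullet> D (q j) + (LINT r:{q j<..q (Suc j)}|lborel. g (z n r))"
        by (simp add: inner_diff_right)
      moreover have "(LINT r:{s<..q (Suc j)}|lborel. g (z n r)) = (LINT r:{s<..q j}|lborel. g (z n r)) + (LINT r:{q j<..q (Suc j)}|lborel. g (z n r))"
        by (rule interval_integral_combine[OF set_integrable_subset[OF intz]]) (use j lt in auto)
      ultimately show ?case using Suc by simp
    qed
    from this[of "Suc n"] \<delta>(2)[of n] show ?thesis by (simp add: q_def)
  qed
  have zl: "(\<lambda>n. z n r) \<longlonglongrightarrow> ym r" "\<And>n. ym r \<le> z n r" "0 \<le> ym r" if r: "s < r" "r \<le> t" for r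
  proof -
    have f: "filterlim (\<lambda>n. grid_before s (\<delta> n) r) (at_left r) sequentially"
      by (rule grid_before_filterlim[OF \<delta>(1) \<delta>0])
    have "(\<lambda>n. y (grid_before s (\<delta> n) r)) \<longlonglongrightarrow> ym r" by (rule filterlim_compose[OF ym[OF r] f])
    moreover have "(\<lambda>n. grid_before s (\<delta> n) r) \<longlonglongrightarrow> r" using f by (simp add: filterlim_at)
    then have "(\<lambda>n. (r - grid_before s (\<delta> n) r) *\<^sub>R p) \<longlonglongrightarrow> (r - r) *\<^sub>R p" by (intro tendsto_intros)
    ultimately show "(\<lambda>n. z n r) \<longlonglongrightarrow> ym r" unfolding z_def using tendsto_add by fastforce
    have ne: "at_left r \<noteq> bot" by simp
    \<comment> \<open>Since the last grid point the true path has gained at most the drift, and the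
      drift is all that \<open>z n\<close> has gained.\<close>
    show "ym r \<le> z n r" for n
    proof (rule tendsto_vec_upper[OF ym[OF r] ne])
      let ?k = "grid_before s (\<delta> n) r"
      show "\<forall>\<^sub>F q in at_left r. y q \<le> z n r"
        using eventually_at_left_real[OF gb(2)[OF r(1), of n]]
      proof eventually_elim
        case (elim q)
        then have "y q \<le> y ?k + (q - ?k) *\<^sub>R p" using gb(1)[OF r(1), of n] r by (intro yle) auto
        also have "\<dots> \<le> z n r" unfolding z_def using elim p_scale_mono[of "q - ?k" "r - ?k"] by (simp add: less_eq_vec_def)
        finally show ?case .
      qed
    qed
    show "0 \<le> ym r"
      by (rule tendsto_vec_lower[OF ym[OF r] ne], rule eventually_mono[OF eventually_at_left_real[OF r(1)]])
         (use pos r in auto)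
  qed
  have "(\<lambda>n. LINT r|lborel. indicator {s<..t} r *\<^sub>R g (z n r)) \<longlonglongrightarrow> (LINT r|lborel. indicator {s<..t} r *\<^sub>R g (ym r))"
  proof (rule integral_dominated_convergence[where w="\<lambda>r. indicator {s<..t} r * B"])
    have pt: "(\<lambda>n. indicator {s<..t} r *\<^sub>R g (z n r)) \<longlonglongrightarrow> indicator {s<..t} r *\<^sub>R g (ym r)" for r
      using g_right_continuous[OF zl(1,3,2)] by (cases "r \<in> {s<..t}") auto
    then show "AE r in lborel. (\<lambda>n. indicator {s<..t} r *\<^sub>R g (z n r)) \<longlonglongrightarrow> indicator {s<..t} r *\<^sub>R g (ym r)" by simp
    show m: "(\<lambda>r. indicator {s<..t} r *\<^sub>R g (z n r)) \<in> borel_measurable lborel" for n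
      using intz[of n] unfolding set_integrable_def by (rule borel_measurable_integrable)
    show "(\<lambda>r. indicator {s<..t} r *\<^sub>R g (ym r)) \<in> borel_measurable lborel"
      by (rule borel_measurable_LIMSEQ_real[OF pt m])
    show "integrable lborel (\<lambda>r. indicator {s<..t} r * B)" using st by auto
    show "AE r in lborel. norm (indicator {s<..t} r *\<^sub>R g (z n r)) \<le> indicator {s<..t} r * B" for n
      using B(2)[OF z0] by (intro AE_I2) (auto simp: indicator_def)
  qed
  then have "(\<lambda>n. u (y s) + a \<bullet> D s + (LINT r:{s<..t}|lborel. g (z n r))) \<longlonglongrightarrow> u (y s) + a \<bullet> D s + (LINT r:{s<..t}|lborel. g (ym r))"
    unfolding set_lebesgue_integral_def by (intro tendsto_intros)
  from LIMSEQ_le_const[OF this] step show ?thesis by blast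
qed

section \<open>Compensation formula\<close>

abbreviation N :: "real \<Rightarrow> 'w \<Rightarrow> nat" where "N \<equiv> counting_process \<tau>"

section \<open>Arrival counts and their independent increments\<close>

lemma tau_mono:
  assumes "\<omega> \<in> space M" "1 \<le> j" "j \<le> k" shows "\<tau> j \<omega> \<le> \<tau> k \<omega>"
  using assms(3)
proof (induction k rule: dec_induct)
  case (step n)
  then show ?case using tau_increasing[OF assms(1), of n] assms(2) by auto
qed simp

lemma tau_positive: "\<omega> \<in> space M \<Longrightarrow> 1 \<le> k \<Longrightarrow> 0 < \<tau> k \<omega>"
  using tau_mono[of \<omega> 1 k] tau_pos[of \<omega>] by simp

lemma le_N_iff:
  assumes w: "\<omega> \<in> space M" and k: "1 \<le> k"
  shows "k \<le> N t \<omega> \<longleftrightarrow> \<tau> k \<omega> \<le> t"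
proof -
  let ?S = "{k. 1 \<le> k \<and> \<tau> k \<omega> \<le> t}"
  have fin: "finite ?S" by (rule tau_locally_finite[OF w])
  show ?thesis
  proof
    assume "\<tau> k \<omega> \<le> t"
    then have "{1..k} \<subseteq> ?S" using tau_mono[OF w, of _ k] by force
    from card_mono[OF fin this] show "k \<le> N t \<omega>" by (simp add: counting_process_def)
  next
    assume "k \<le> N t \<omega>"
    show "\<tau> k \<omega> \<le> t"
    proof (rule ccontr)
      assume n: "\<not> \<tau> k \<omega> \<le> t"
      have "?S \<subseteq> {1..<k}"
      proof
        fix j assume j: "j \<in> ?S"
        then have "\<not> k \<le> j" using n tau_mono[OF w k, of j] by auto
        then show "j \<in> {1..<k}" using j by auto
      qed
      from card_mono[OF _ this] have "N t \<omega> \<le> k - 1" by (simp add: counting_process_def)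
      then show False using \<open>k \<le> N t \<omega>\<close> k by simp
    qed
  qed
qed

lemma N_measurable: "0 \<le> t \<Longrightarrow> N t \<in> measurable M (count_space UNIV)"
  using poisson unfolding poisson_process_def by blast

lemma N_zero: "\<omega> \<in> space M \<Longrightarrow> N 0 \<omega> = 0"
  using poisson unfolding poisson_process_def by blast

lemma N_mono: "\<omega> \<in> space M \<Longrightarrow> 0 \<le> s \<Longrightarrow> s \<le> t \<Longrightarrow> N s \<omega> \<le> N t \<omega>"
  using poisson unfolding poisson_process_def mono_on_def by auto

lemma tau_measurable [measurable]:
  assumes k: "1 \<le> k" shows "\<tau> k \<in> borel_measurable M"
proof (rule borel_measurableI_le)
  fix t :: real
  show "{\<omega> \<in> space M. \<tau> k \<omega> \<le> t} \<in> sets M"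
  proof (cases "0 \<le> t")
    case True
    note [measurable] = N_measurable[OF True]
    have "{\<omega> \<in> space M. \<tau> k \<omega> \<le> t} = {\<omega> \<in> space M. k \<le> N t \<omega>}" using le_N_iff k by auto
    also have "\<dots> \<in> sets M" by measurable
    finally show ?thesis .
  next
    case False
    then have "{\<omega> \<in> space M. \<tau> k \<omega> \<le> t} = {}" using tau_positive[OF _ k] by force
    then show ?thesis by (simp only: sets.empty_sets)
  qed
qed

text \<open>The mean of the Poisson law with parameter l, from k pmf(k) = l pmf(k - 1).\<close>

lemma N_mean:
  assumes "0 \<le> s" "s < t"
  shows "(\<integral>\<^sup>+\<omega>. of_nat (N t \<omega> - N s \<omega>) \<partial>M) = ennreal (rate * (t - s))"
proof -
  define l where "l = rate * (t - s)"
  have l: "0 < l" using rate_pos assms by (simp add: l_def)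
  have [measurable]: "N s \<in> measurable M (count_space UNIV)" "N t \<in> measurable M (count_space UNIV)"
    using assms by (auto intro: N_measurable)
  have m: "(\<lambda>\<omega>. N t \<omega> - N s \<omega>) \<in> measurable M (count_space UNIV)" by measurable
  have "(\<integral>\<^sup>+\<omega>. of_nat (N t \<omega> - N s \<omega>) \<partial>M) = (\<integral>\<^sup>+k. of_nat k \<partial>distr M (count_space UNIV) (\<lambda>\<omega>. N t \<omega> - N s \<omega>))"
    by (subst nn_integral_distr[OF m]) auto
  also have "distr M (count_space UNIV) (\<lambda>\<omega>. N t \<omega> - N s \<omega>) = measure_pmf (poisson_pmf l)"
    using poisson assms unfolding poisson_process_def l_def by blast
  also have "(\<integral>\<^sup>+k. of_nat k \<partial>measure_pmf (poisson_pmf l)) = (\<Sum>k. ennreal (pmf (poisson_pmf l) k) * of_nat k)"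
    by (simp add: nn_integral_measure_pmf nn_integral_count_space_nat)
  also have "\<dots> = (\<Sum>k. ennreal (pmf (poisson_pmf l) (Suc k)) * of_nat (Suc k))"
    by (subst suminf_offset[where i=1]) auto
  also have "\<dots> = (\<Sum>k. ennreal l * ennreal (pmf (poisson_pmf l) k))"
  proof (rule suminf_cong)
    fix k
    have "pmf (poisson_pmf l) (Suc k) * real (Suc k) = l * pmf (poisson_pmf l) k"
      unfolding pmf_poisson[OF l] by (simp add: divide_simps del: of_nat_Suc)
    then show "ennreal (pmf (poisson_pmf l) (Suc k)) * of_nat (Suc k) = ennreal l * ennreal (pmf (poisson_pmf l) k)"
      using l by (simp add: ennreal_mult'[symmetric] ennreal_of_nat_eq_real_of_nat del: of_nat_Suc pmf_poisson)
  qed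
  also have "\<dots> = ennreal l * (\<Sum>k. ennreal (pmf (poisson_pmf l) k))" by (rule ennreal_suminf_cmult)
  also have "(\<Sum>k. ennreal (pmf (poisson_pmf l) k)) = 1"
    unfolding nn_integral_count_space_nat[symmetric] by (subst nn_integral_pmf) (simp add: measure_pmf.emeasure_eq_1_AE)
  finally show ?thesis by (simp add: l_def)
qed

text \<open>The past event involves counts at finitely many times up to s. These times, together
  with 0 and s, are sorted into a mesh and t is appended. Past counts are then partial sums of the
  first m - 1 increments, and N t - N s is the last increment, so independence is applied to two
  disjoint index sets.\<close>

lemma increment_indep:
  assumes K: "finite K" "\<And>k. k \<in> K \<Longrightarrow> 0 \<le> r k \<and> r k \<le> s" and st: "0 \<le> s" "s < t"
  shows "prob ({\<omega> \<in> space M. \<forall>k\<in>K. k \<le> N (r k) \<omega>} \<inter> {\<omega> \<in> space M. n < N t \<omega> - N s \<omega>}) =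
    prob {\<omega> \<in> space M. \<forall>k\<in>K. k \<le> N (r k) \<omega>} * prob {\<omega> \<in> space M. n < N t \<omega> - N s \<omega>}"
proof -
  define S where "S = insert 0 (insert s (r ` K))"
  define l where "l = sorted_list_of_set S"
  define m where "m = length l"
  have finS: "finite S" using K by (simp add: S_def)
  have setl: "set l = S" and sl: "sorted l" using finS by (simp_all add: l_def)
  have S: "0 \<le> x \<and> x \<le> s" if "x \<in> S" for x using that K st by (auto simp: S_def)
  have mpos: "m > 0" using setl by (auto simp: m_def S_def)
  \<comment> \<open>Beyond the mesh the times are constantly \<open>t\<close>, so that
    \<open>tt\<close> is monotone on all of \<open>nat\<close>, as the definition of a Poisson
    process demands.\<close>
  define tt where "tt j = (if j < m then l ! j else t)" for j
  have lS: "l ! j \<in> S" if "j < m" for j using that setl nth_mem by (auto simp: m_def)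
  have ex: "\<exists>j<m. tt j = x" if "x \<in> S" for x
  proof -
    have "x \<in> set l" using that by (simp add: setl)
    then obtain j where "j < length l" "l ! j = x" unfolding in_set_conv_nth by blast
    then show ?thesis by (intro exI[of _ j]) (simp add: tt_def m_def)
  qed
  have mono: "mono tt"
  proof (rule monoI)
    fix i j :: nat assume "i \<le> j"
    then consider "j < m" | "i < m" "\<not> j < m" | "\<not> i < m" "\<not> j < m" by blast
    then show "tt i \<le> tt j"
    proof cases
      case 1
      then show ?thesis using sorted_nth_mono[OF sl \<open>i \<le> j\<close>] \<open>i \<le> j\<close> by (simp add: tt_def m_def)
    next
      case 2
      then show ?thesis using S[OF lS[of i]] st(2) by (simp add: tt_def)
    qed (simp add: tt_def)
  qed
  have t0: "tt 0 = 0"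
  proof -
    obtain j where "j < m" "tt j = 0" using ex[of 0] by (auto simp: S_def)
    then have "tt 0 \<le> 0" using monoD[OF mono, of 0 j] by simp
    moreover have "0 \<le> tt 0" using lS[of 0] S mpos by (auto simp: tt_def)
    ultimately show ?thesis by simp
  qed
  have ts: "tt (m - 1) = s"
  proof -
    obtain j where j: "j < m" "tt j = s" using ex[of s] by (auto simp: S_def)
    then have "s \<le> tt (m - 1)" using monoD[OF mono, of j "m - 1"] by simp
    moreover have "tt (m - 1) \<le> s" using lS[of "m - 1"] S mpos by (auto simp: tt_def)
    ultimately show ?thesis by simp
  qed
  have tm: "tt m = t" by (simp add: tt_def)
  have "\<forall>k\<in>K. \<exists>j<m. tt j = r k" using ex by (auto simp: S_def)
  then obtain J where J: "\<And>k. k \<in> K \<Longrightarrow> J k < m \<and> tt (J k) = r k" by metis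
  define X where "X j \<omega> = N (tt (Suc j)) \<omega> - N (tt j) \<omega>" for j \<omega>
  have tt0: "0 \<le> tt j" for j using monoD[OF mono, of 0 j] t0 by simp
  have tel: "(\<Sum>i<j. X i \<omega>) = N (tt j) \<omega>" if "\<omega> \<in> space M" for j \<omega>
  proof (induction j)
    case 0 then show ?case using N_zero[OF that] by (simp add: t0)
  next
    case (Suc j)
    have "N (tt j) \<omega> \<le> N (tt (Suc j)) \<omega>" using monoD[OF mono, of j "Suc j"] by (intro N_mono that tt0) auto
    then show ?case using Suc by (simp add: X_def)
  qed
  have iv: "indep_vars (\<lambda>_. count_space UNIV) X {..<m}"
    using poisson mono tt0[of 0] unfolding poisson_process_def X_def[abs_def] by blast
  have "indep_var (PiM {..<m-1} (\<lambda>_. count_space UNIV)) (\<lambda>\<omega>. restrict (\<lambda>i. X i \<omega>) {..<m-1})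
     (PiM {m-1} (\<lambda>_. count_space UNIV)) (\<lambda>\<omega>. restrict (\<lambda>i. X i \<omega>) {m-1})"
    by (rule indep_var_restrict[OF iv]) (use mpos in auto)
  from indep_varD[OF this, of "{x \<in> {..<m-1} \<rightarrow>\<^sub>E UNIV. \<forall>k\<in>K. k \<le> (\<Sum>i<J k. x i)}" "{x \<in> {m-1} \<rightarrow>\<^sub>E UNIV. n < x (m - 1)}"]
  have e: "prob ((\<lambda>x. (restrict (\<lambda>i. X i x) {..<m-1}, restrict (\<lambda>i. X i x) {m-1})) -`
        ({x \<in> {..<m-1} \<rightarrow>\<^sub>E UNIV. \<forall>k\<in>K. k \<le> (\<Sum>i<J k. x i)} \<times> {x \<in> {m-1} \<rightarrow>\<^sub>E UNIV. n < x (m - 1)}) \<inter> space M) =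
      prob ((\<lambda>\<omega>. restrict (\<lambda>i. X i \<omega>) {..<m-1}) -` {x \<in> {..<m-1} \<rightarrow>\<^sub>E UNIV. \<forall>k\<in>K. k \<le> (\<Sum>i<J k. x i)} \<inter> space M) *
      prob ((\<lambda>\<omega>. restrict (\<lambda>i. X i \<omega>) {m-1}) -` {x \<in> {m-1} \<rightarrow>\<^sub>E UNIV. n < x (m - 1)} \<inter> space M)"
    by (simp add: count_space_PiM_finite)
  have sumr: "(\<Sum>i<J k. restrict (\<lambda>i. X i \<omega>) {..<m-1} i) = N (r k) \<omega>" if "k \<in> K" "\<omega> \<in> space M" for k \<omega>
  proof -
    have "(\<Sum>i<J k. restrict (\<lambda>i. X i \<omega>) {..<m-1} i) = (\<Sum>i<J k. X i \<omega>)"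
      using J[OF that(1)] by (intro sum.cong) auto
    then show ?thesis using tel[OF that(2)] J[OF that(1)] by simp
  qed
  have e1: "(\<lambda>\<omega>. restrict (\<lambda>i. X i \<omega>) {..<m-1}) -` {x \<in> {..<m-1} \<rightarrow>\<^sub>E UNIV. \<forall>k\<in>K. k \<le> (\<Sum>i<J k. x i)} \<inter> space M =
      {\<omega> \<in> space M. \<forall>k\<in>K. k \<le> N (r k) \<omega>}"
    using sumr by (auto simp del: restrict_apply)
  have Xm: "X (m - 1) \<omega> = N t \<omega> - N s \<omega>" for \<omega>
    unfolding X_def ts using mpos tm by simp
  have e2: "(\<lambda>\<omega>. restrict (\<lambda>i. X i \<omega>) {m-1}) -` {x \<in> {m-1} \<rightarrow>\<^sub>E UNIV. n < x (m - 1)} \<inter> space M =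
      {\<omega> \<in> space M. n < N t \<omega> - N s \<omega>}"
    by (auto simp: Xm simp del: One_nat_def)
  have v: "(\<lambda>x. (h x, k x)) -` (A \<times> B) \<inter> space M = (h -` A \<inter> space M) \<inter> (k -` B \<inter> space M)"
    for h k :: "'w \<Rightarrow> nat \<Rightarrow> nat" and A B by auto
  show ?thesis using e unfolding v e1 e2 .
qed

text \<open>An intersection-stable generator of the claim filtration at time \<open>s\<close>.\<close>

definition history :: "real \<Rightarrow> 'w set set" where
  "history s = {{\<omega> \<in> space M. \<forall>k\<in>K. \<tau> k \<omega> \<le> r k \<and> U k \<omega> \<in> B k} | K r B.
     finite K \<and> (\<forall>k\<in>K. 1 \<le> k \<and> 0 \<le> r k \<and> r k \<le> s \<and> B k \<in> sets borel)}"

lemma history_sets: "A \<in> history s \<Longrightarrow> A \<in> sets M"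
proof -
  assume "A \<in> history s"
  then obtain K r B where A: "A = {\<omega> \<in> space M. \<forall>k\<in>K. \<tau> k \<omega> \<le> r k \<and> U k \<omega> \<in> B k}" "finite K"
    "\<forall>k\<in>K. 1 \<le> k \<and> 0 \<le> r k \<and> r k \<le> s \<and> B k \<in> sets borel" unfolding history_def by blast
  have "{\<omega> \<in> space M. \<tau> k \<omega> \<le> r k \<and> U k \<omega> \<in> B k} \<in> sets M" if "k \<in> K" for k
  proof -
    have [measurable]: "B k \<in> sets borel" "\<tau> k \<in> borel_measurable M" "U k \<in> borel_measurable M"
      using A(3) that by auto
    show ?thesis by measurable
  qed
  then show ?thesis unfolding A(1) using A(2) by (intro sets.sets_Collect_finite_All)
qed

lemma history_Int: "A \<in> history s \<Longrightarrow> A' \<in> history s' \<Longrightarrow> A \<inter> A' \<in> history (max s s')"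
proof -
  assume "A \<in> history s" "A' \<in> history s'"
  then obtain K r B K' r' B' where A: "A = {\<omega> \<in> space M. \<forall>k\<in>K. \<tau> k \<omega> \<le> r k \<and> U k \<omega> \<in> B k}" "finite K"
    "\<forall>k\<in>K. 1 \<le> k \<and> 0 \<le> r k \<and> r k \<le> s \<and> B k \<in> sets borel"
    and A': "A' = {\<omega> \<in> space M. \<forall>k\<in>K'. \<tau> k \<omega> \<le> r' k \<and> U k \<omega> \<in> B' k}" "finite K'"
    "\<forall>k\<in>K'. 1 \<le> k \<and> 0 \<le> r' k \<and> r' k \<le> s' \<and> B' k \<in> sets borel" unfolding history_def by blast
  define R where "R k = (if k \<in> K then if k \<in> K' then min (r k) (r' k) else r k else r' k)" for k
  define C where "C k = (if k \<in> K then if k \<in> K' then B k \<inter> B' k else B k else B' k)" for k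
  have "A \<inter> A' = {\<omega> \<in> space M. \<forall>k\<in>K \<union> K'. \<tau> k \<omega> \<le> R k \<and> U k \<omega> \<in> C k}"
    unfolding A(1) A'(1) R_def C_def by auto
  moreover have "\<forall>k\<in>K \<union> K'. 1 \<le> k \<and> 0 \<le> R k \<and> R k \<le> max s s' \<and> C k \<in> sets borel"
    using A(3) A'(3) by (auto simp: R_def C_def)
  ultimately show ?thesis unfolding history_def using A(2) A'(2) by blast
qed

lemma filtration_history:
  assumes "0 \<le> s" shows "sets (claim_filtration M \<tau> U (ennreal s)) \<subseteq> sigma_sets (space M) (history s)"
proof -
  define \<G> where "\<G> = {{\<omega> \<in> space M. \<tau> k \<omega> \<le> r \<and> U k \<omega> \<in> A} |k r A. 1 \<le> k \<and> 0 \<le> r \<and> ennreal r \<le> ennreal s \<and> A \<in> sets borel}"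
  have sub: "\<G> \<subseteq> history s" unfolding \<G>_def
  proof safe
    fix k :: nat and r and A :: "(real^'n) set" assume a: "1 \<le> k" "0 \<le> r" "ennreal r \<le> ennreal s" "A \<in> sets borel"
    then have "r \<le> s" using assms by simp
    then show "{\<omega> \<in> space M. \<tau> k \<omega> \<le> r \<and> U k \<omega> \<in> A} \<in> history s"
      unfolding history_def using a by (intro CollectI exI[of _ "{k}"] exI[of _ "\<lambda>_. r"] exI[of _ "\<lambda>_. A"]) auto
  qed
  have "\<G> \<subseteq> Pow (space M)" by (auto simp: \<G>_def)
  then show ?thesis unfolding claim_filtration_def \<G>_def[symmetric]
    using sigma_sets_mono'[OF sub] by simp
qed

text \<open>\<open>A\<close> is the intersection of an event \<open>G\<close> about counts and an
  event \<open>H\<close> about marks, and counts are independent of marks. On \<open>A\<close> a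
  claim with index in \<open>K\<close> has occurred by s and contributes nothing; for any other
  index the mark is independent of \<open>H\<close>. What remains is the mean of N t - N s on
  \<open>G\<close>, evaluated by independence of increments.\<close>

lemma compensator_rectangle:
  assumes A: "A \<in> history s" and st: "0 \<le> s" "s \<le> t" and C: "C \<in> sets borel"
  shows "(\<Sum>k. emeasure M (A \<inter> {\<omega> \<in> space M. s < \<tau> (Suc k) \<omega> \<and> \<tau> (Suc k) \<omega> \<le> t \<and> U (Suc k) \<omega> \<in> C})) =
    emeasure M A * ennreal (rate * (t - s)) * emeasure \<mu> C"
proof (cases "s = t")
  case True
  then have "A \<inter> {\<omega> \<in> space M. s < \<tau> (Suc k) \<omega> \<and> \<tau> (Suc k) \<omega> \<le> t \<and> U (Suc k) \<omega> \<in> C} = {}" for k by auto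
  then show ?thesis using True by simp
next
  case False
  then have lt: "s < t" using st by simp
  obtain K r B where A: "A = {\<omega> \<in> space M. \<forall>k\<in>K. \<tau> k \<omega> \<le> r k \<and> U k \<omega> \<in> B k}" "finite K"
    and K: "\<And>k. k \<in> K \<Longrightarrow> 1 \<le> k \<and> 0 \<le> r k \<and> r k \<le> s \<and> B k \<in> sets borel" using assms(1) unfolding history_def by blast
  \<comment> \<open>The sigma-algebras of the counting process and of the marks, exactly as in the
    independence assumption of the model.\<close>
  define VN where "VN = vimage_algebra (space M) (\<lambda>\<omega>. \<lambda>t\<in>{0..}. N t \<omega>) (PiM {0..} (\<lambda>_. count_space UNIV))"
  define VU where "VU = vimage_algebra (space M) (\<lambda>\<omega>. \<lambda>k\<in>{1..}. U k \<omega>) (PiM {1..} (\<lambda>_. borel :: (real^'n) measure))"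
  have spV: "space VN = space M" "space VU = space M" by (simp_all add: VN_def VU_def)
  have mN: "N t \<in> measurable VN (count_space UNIV)" if "0 \<le> t" for t
  proof -
    have "(\<lambda>\<omega>. \<lambda>t\<in>{0..}. N t \<omega>) \<in> measurable VN (PiM {0..} (\<lambda>_. count_space UNIV))"
      unfolding VN_def by (rule measurable_vimage_algebra1) (auto simp: space_PiM)
    from measurable_compose[OF this measurable_component_singleton[of t]] that show ?thesis by simp
  qed
  have mU: "U k \<in> borel_measurable VU" if "1 \<le> k" for k
  proof -
    have "(\<lambda>\<omega>. \<lambda>k\<in>{1..}. U k \<omega>) \<in> measurable VU (PiM {1..} (\<lambda>_. borel))"
      unfolding VU_def by (rule measurable_vimage_algebra1) (auto simp: space_PiM)
    from measurable_compose[OF this measurable_component_singleton[of k]] that show ?thesis by simp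
  qed
  note ind = indep_setD[OF U_indep_poisson[folded VN_def VU_def]]
  define G where "G = {\<omega> \<in> space M. \<forall>k\<in>K. k \<le> N (r k) \<omega>}"
  define H where "H = {\<omega> \<in> space M. \<forall>k\<in>K. U k \<omega> \<in> B k}"
  define D where "D k = {\<omega> \<in> space M. N s \<omega> < k \<and> k \<le> N t \<omega>}" for k
  define V where "V k = {\<omega> \<in> space M. U k \<omega> \<in> C}" for k
  have AGH: "A = G \<inter> H" unfolding A(1) G_def H_def using le_N_iff K by auto
  have G: "G \<in> sets VN" unfolding G_def spV[symmetric] using A(2)
  proof (intro sets.sets_Collect_finite_All)
    fix k assume "k \<in> K"
    then have [measurable]: "N (r k) \<in> measurable VN (count_space UNIV)" using K mN by blast
    show "{\<omega> \<in> space VN. k \<le> N (r k) \<omega>} \<in> sets VN" by measurable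
  qed
  have H: "H \<in> sets VU" unfolding H_def spV(2)[symmetric] using A(2)
  proof (intro sets.sets_Collect_finite_All)
    fix k assume "k \<in> K"
    then have [measurable]: "U k \<in> borel_measurable VU" "B k \<in> sets borel" using K mU by blast+
    show "{\<omega> \<in> space VU. U k \<omega> \<in> B k} \<in> sets VU" by measurable
  qed
  have D: "D k \<in> sets VN" for k
  proof -
    have [measurable]: "N s \<in> measurable VN (count_space UNIV)" "N t \<in> measurable VN (count_space UNIV)"
      using st mN by auto
    show ?thesis unfolding D_def spV(1)[symmetric] by measurable
  qed
  have V: "V k \<in> sets VU" if "1 \<le> k" for k
  proof -
    have [measurable]: "U k \<in> borel_measurable VU" using that mU by auto
    show ?thesis unfolding V_def spV(2)[symmetric] using C by measurable
  qed
  have PV: "prob (V k) = measure \<mu> C" if k: "1 \<le> k" for k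
  proof -
    have "measure \<mu> C = measure (distr M borel (U k)) C" unfolding \<mu>_def U_ident[OF k] ..
    also have "\<dots> = prob (U k -` C \<inter> space M)" using k C by (intro measure_distr) auto
    also have "U k -` C \<inter> space M = V k" by (auto simp: V_def)
    finally show ?thesis ..
  qed
  have HV: "prob (H \<inter> V k) = prob H * measure \<mu> C" if k: "1 \<le> k" "k \<notin> K" for k
  \<comment> \<open>Without past marks \<open>H\<close> is the whole space; otherwise the product
    rule is applied to \<open>K\<close> with and without the index \<open>k\<close>.\<close>
  proof (cases "K = {}")
    case True
    then have "H = space M" by (simp add: H_def)
    moreover have "V k \<subseteq> space M" by (auto simp: V_def)
    ultimately show ?thesis using PV[OF k(1)] by (simp add: Int_absorb1 prob_space)
  next
    case False
    let ?B = "\<lambda>j. if j = k then C else B j"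
    have Bs: "?B j \<in> sets borel" if "j \<in> insert k K" for j using that K C by auto
    have "prob (\<Inter>i\<in>insert k K. U i -` ?B i \<inter> space M) = (\<Prod>i\<in>insert k K. prob (U i -` ?B i \<inter> space M))"
      by (rule indep_varsD[OF U_indep]) (use A(2) K k Bs in auto)
    also have "(\<Inter>i\<in>insert k K. U i -` ?B i \<inter> space M) = H \<inter> V k"
      using k(2) by (auto simp: H_def V_def split: if_splits)
    also have "(\<Prod>i\<in>insert k K. prob (U i -` ?B i \<inter> space M)) = prob (U k -` C \<inter> space M) * (\<Prod>i\<in>K. prob (U i -` ?B i \<inter> space M))"
      using A(2) k(2) by (subst prod.insert) auto
    also have "(\<Prod>i\<in>K. prob (U i -` ?B i \<inter> space M)) = (\<Prod>i\<in>K. prob (U i -` B i \<inter> space M))"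
      using k(2) by (intro prod.cong) auto
    also have "\<dots> = prob (\<Inter>i\<in>K. U i -` B i \<inter> space M)"
      by (rule indep_varsD[OF U_indep, symmetric]) (use A(2) K False in auto)
    also have "(\<Inter>i\<in>K. U i -` B i \<inter> space M) = H" using False by (auto simp: H_def)
    also have "U k -` C \<inter> space M = V k" by (auto simp: V_def)
    finally show ?thesis using PV[OF k(1)] by simp
  qed
  interpret \<mu>: prob_space \<mu> by (rule prob_space_\<mu>)
  have e1: "emeasure M (A \<inter> {\<omega> \<in> space M. s < \<tau> k \<omega> \<and> \<tau> k \<omega> \<le> t \<and> U k \<omega> \<in> C}) =
      emeasure M (G \<inter> D k) * (emeasure M H * emeasure \<mu> C)" if k: "1 \<le> k" for k
  proof (cases "k \<in> K")
    case True
    have "A \<inter> {\<omega> \<in> space M. s < \<tau> k \<omega> \<and> \<tau> k \<omega> \<le> t \<and> U k \<omega> \<in> C} = {}"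
      using True K[OF True] unfolding A(1) by force
    moreover have "G \<inter> D k = {}"
    proof -
      have "k \<le> N s \<omega>" if "\<omega> \<in> G" for \<omega>
        using that True K[OF True] N_mono[of \<omega> "r k" s] unfolding G_def by force
      then show ?thesis by (force simp: D_def)
    qed
    ultimately show ?thesis by simp
  next
    case False
    have "A \<inter> {\<omega> \<in> space M. s < \<tau> k \<omega> \<and> \<tau> k \<omega> \<le> t \<and> U k \<omega> \<in> C} = (G \<inter> D k) \<inter> (H \<inter> V k)"
      unfolding AGH D_def V_def using le_N_iff[OF _ k] by (auto simp: not_le[symmetric])
    moreover have "prob ((G \<inter> D k) \<inter> (H \<inter> V k)) = prob (G \<inter> D k) * (prob H * measure \<mu> C)"
      using ind[of "G \<inter> D k" "H \<inter> V k"] G D H V[OF k] HV[OF k False] by auto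
    ultimately show ?thesis
      by (simp add: emeasure_eq_measure \<mu>.emeasure_eq_measure ennreal_mult)
  qed
  have [measurable]: "N s \<in> measurable M (count_space UNIV)" "N t \<in> measurable M (count_space UNIV)" using st by (auto intro: N_measurable)
  have GM: "G \<in> sets M" unfolding G_def using A(2)
  proof (intro sets.sets_Collect_finite_All)
    fix k assume "k \<in> K"
    then have [measurable]: "N (r k) \<in> measurable M (count_space UNIV)" using K by (auto intro: N_measurable)
    show "{\<omega> \<in> space M. k \<le> N (r k) \<omega>} \<in> sets M" by measurable
  qed
  have DM: "D k \<in> sets M" for k unfolding D_def by measurable
  have e2: "(\<Sum>k. emeasure M (G \<inter> D (Suc k))) = emeasure M G * ennreal (rate * (t - s))"
  proof -
    have cnt: "(\<Sum>k. indicator (D (Suc k)) \<omega> :: ennreal) = of_nat (N t \<omega> - N s \<omega>)" if "\<omega> \<in> space M" for \<omega>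
    proof -
      have "(\<Sum>k. indicator (D (Suc k)) \<omega> :: ennreal) = (\<Sum>k\<in>{N s \<omega>..<N t \<omega>}. indicator (D (Suc k)) \<omega>)"
        by (rule suminf_finite) (auto simp: D_def indicator_def)
      also have "\<dots> = (\<Sum>k\<in>{N s \<omega>..<N t \<omega>}. 1)"
        using that by (intro sum.cong) (auto simp: D_def indicator_def)
      finally show ?thesis by simp
    qed
    have "(\<Sum>k. emeasure M (G \<inter> D (Suc k))) = (\<Sum>k. \<integral>\<^sup>+\<omega>. indicator G \<omega> * indicator (D (Suc k)) \<omega> \<partial>M)"
      using GM DM by (intro suminf_cong) (simp add: indicator_inter_arith[symmetric])
    also have "\<dots> = (\<integral>\<^sup>+\<omega>. (\<Sum>k. indicator G \<omega> * indicator (D (Suc k)) \<omega>) \<partial>M)"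
      using GM DM by (intro nn_integral_suminf[symmetric]) auto
    also have "\<dots> = (\<integral>\<^sup>+\<omega>. of_nat (N t \<omega> - N s \<omega>) * indicator G \<omega> \<partial>M)"
      by (intro nn_integral_cong) (simp add: ennreal_suminf_cmult cnt mult.commute)
    also have "\<dots> = (\<integral>\<^sup>+\<omega>. of_nat (if \<omega> \<in> G then N t \<omega> - N s \<omega> else 0) \<partial>M)"
      by (intro nn_integral_cong) (simp add: indicator_def)
    \<comment> \<open>The mean of an integer variable is the sum of its tail probabilities, and
      tails are the events for which \<open>increment_indep\<close> is stated.\<close>
    also have "\<dots> = (\<Sum>n. emeasure M {\<omega> \<in> space M. n < (if \<omega> \<in> G then N t \<omega> - N s \<omega> else 0)})"
      by (intro nn_integral_nat_function) (use GM in measurable)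
    also have "\<dots> = (\<Sum>n. emeasure M G * emeasure M {\<omega> \<in> space M. n < N t \<omega> - N s \<omega>})"
    proof (rule suminf_cong)
      fix n
      have "{\<omega> \<in> space M. n < (if \<omega> \<in> G then N t \<omega> - N s \<omega> else 0)} = G \<inter> {\<omega> \<in> space M. n < N t \<omega> - N s \<omega>}"
        by (auto simp: G_def)
      moreover have "prob (G \<inter> {\<omega> \<in> space M. n < N t \<omega> - N s \<omega>}) = prob G * prob {\<omega> \<in> space M. n < N t \<omega> - N s \<omega>}"
        unfolding G_def by (rule increment_indep) (use A(2) K st(1) lt in auto)
      ultimately show "emeasure M {\<omega> \<in> space M. n < (if \<omega> \<in> G then N t \<omega> - N s \<omega> else 0)} =
          emeasure M G * emeasure M {\<omega> \<in> space M. n < N t \<omega> - N s \<omega>}"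
        by (simp add: emeasure_eq_measure ennreal_mult)
    qed
    also have "\<dots> = emeasure M G * (\<Sum>n. emeasure M {\<omega> \<in> space M. n < N t \<omega> - N s \<omega>})" by (rule ennreal_suminf_cmult)
    also have "(\<Sum>n. emeasure M {\<omega> \<in> space M. n < N t \<omega> - N s \<omega>}) = (\<integral>\<^sup>+\<omega>. of_nat (N t \<omega> - N s \<omega>) \<partial>M)"
      by (intro nn_integral_nat_function[symmetric]) measurable
    finally show ?thesis using N_mean[OF st(1) lt] by simp
  qed
  have "emeasure M A = emeasure M G * emeasure M H"
    using ind[OF G H] unfolding AGH by (simp add: emeasure_eq_measure ennreal_mult)
  moreover have "(\<Sum>k. emeasure M (A \<inter> {\<omega> \<in> space M. s < \<tau> (Suc k) \<omega> \<and> \<tau> (Suc k) \<omega> \<le> t \<and> U (Suc k) \<omega> \<in> C})) =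
     (\<Sum>k. emeasure M (G \<inter> D (Suc k))) * (emeasure M H * emeasure \<mu> C)"
    by (subst e1) (auto simp: ennreal_suminf_multc)
  ultimately show ?thesis unfolding e2 by (simp add: ac_simps)
qed

section \<open>The predictable sigma-algebra and the two measures on it\<close>

definition predictable_rectangles :: "('w \<times> real \<times> (real^'n)) set set" where
  "predictable_rectangles = {A \<times> {s<..t} \<times> C | A s t C. 0 \<le> s \<and> s \<le> t \<and> A \<in> history s \<and> C \<in> sets borel}"

text \<open>Generated by rectangles over (s, t] whose event is already known at s: the usual
  predictable sigma-algebra on positive time, with a free Borel coordinate for the claim
  size.\<close>

definition predictable :: "('w \<times> real \<times> (real^'n)) measure" where
  "predictable = sigma (space M \<times> {0<..} \<times> UNIV) predictable_rectangles"

lemma rectangles_Pow: "predictable_rectangles \<subseteq> Pow (space M \<times> {0<..} \<times> UNIV)"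
  unfolding predictable_rectangles_def history_def by fastforce

lemma space_predictable [simp]: "space predictable = space M \<times> {0<..} \<times> UNIV"
  unfolding predictable_def using rectangles_Pow by (rule space_measure_of)

lemma sets_predictable: "sets predictable = sigma_sets (space M \<times> {0<..} \<times> UNIV) predictable_rectangles"
  unfolding predictable_def using rectangles_Pow by (rule sets_measure_of)

text \<open>Induction over the sigma-algebra generated by \<open>history s\<close>, which contains
  the claim filtration at \<open>s\<close>.\<close>

lemma predictable_rectangle:
  assumes A: "A \<in> sets (claim_filtration M \<tau> U (ennreal s))" and s: "0 \<le> s" and C: "C \<in> sets borel"
  shows "A \<times> {s<..t} \<times> C \<in> sets predictable"
proof (cases "s \<le> t")
  case True
  have *: "A \<times> {s<..t} \<times> C \<in> sets predictable" if "A \<in> history s" for A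
    unfolding sets_predictable
    by (rule sigma_sets.Basic) (use that True s C in \<open>auto simp: predictable_rectangles_def\<close>)
  have "space M \<in> history s" unfolding history_def by (intro CollectI exI[of _ "{}"]) auto
  from *[OF this] have sp: "space M \<times> {s<..t} \<times> C \<in> sets predictable" .
  have "A \<in> sigma_sets (space M) (history s)" using A filtration_history[OF s] by blast
  then show ?thesis
  proof (induction rule: sigma_sets.induct)
    case (Basic a) then show ?case by (rule *)
  next
    case (Compl a)
    have "(space M - a) \<times> {s<..t} \<times> C = space M \<times> {s<..t} \<times> C - a \<times> {s<..t} \<times> C" by auto
    then show ?case using sp Compl by auto
  next
    case (Union a)
    have "(\<Union>i. a i) \<times> {s<..t} \<times> C = (\<Union>i. a i \<times> {s<..t} \<times> C)" by auto
    then show ?case using Union by auto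
  qed simp
qed simp

text \<open>The successor appears because claims are numbered from 1.\<close>

definition claim_mark :: "nat \<Rightarrow> 'w \<Rightarrow> 'w \<times> real \<times> (real^'n)" where
  "claim_mark k \<omega> = (\<omega>, \<tau> (Suc k) \<omega>, U (Suc k) \<omega>)"

lemma claim_mark_measurable [measurable]: "claim_mark k \<in> measurable M predictable"
  unfolding predictable_def
proof (rule measurable_measure_of[OF rectangles_Pow])
  show "claim_mark k \<in> space M \<rightarrow> space M \<times> {0<..} \<times> UNIV"
    using tau_positive by (auto simp: claim_mark_def)
  fix X assume "X \<in> predictable_rectangles"
  then obtain A s t C where X: "X = A \<times> {s<..t} \<times> C" "A \<in> history s" "C \<in> sets borel"
    unfolding predictable_rectangles_def by blast
  have [measurable]: "A \<in> sets M" "C \<in> sets borel" "\<tau> (Suc k) \<in> borel_measurable M" "U (Suc k) \<in> borel_measurable M"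
    using X history_sets by auto
  have "claim_mark k -` X \<inter> space M = {\<omega> \<in> space M. \<omega> \<in> A \<and> \<tau> (Suc k) \<omega> \<in> {s<..t} \<and> U (Suc k) \<omega> \<in> C}"
    by (auto simp: claim_mark_def X(1))
  also have "\<dots> \<in> sets M" by measurable
  finally show "claim_mark k -` X \<inter> space M \<in> sets M" .
qed

definition compensator_space :: "('w \<times> real \<times> (real^'n)) measure" where
  "compensator_space = M \<Otimes>\<^sub>M (restrict_space lborel {0<..} \<Otimes>\<^sub>M \<mu>)"

lemma sigma_finite_time: "sigma_finite_measure (restrict_space lborel {0::real<..})"
  by (intro sigma_finite_measure_restrict_space lborel.sigma_finite_measure_axioms) simp

lemma sigma_finite_time_mark: "sigma_finite_measure (restrict_space lborel {0::real<..} \<Otimes>\<^sub>M \<mu>)"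
proof -
  interpret T: sigma_finite_measure "restrict_space lborel {0::real<..}" by (rule sigma_finite_time)
  interpret \<mu>: prob_space \<mu> by (rule prob_space_\<mu>)
  interpret pair_sigma_finite "restrict_space lborel {0::real<..}" \<mu> ..
  show ?thesis by unfold_locales
qed

lemma compensator_measurable [measurable]: "(\<lambda>x. x) \<in> measurable compensator_space predictable"
  unfolding predictable_def
proof (rule measurable_measure_of[OF rectangles_Pow])
  have sp: "space compensator_space = space M \<times> {0<..} \<times> UNIV"
    by (simp add: compensator_space_def space_pair_measure space_restrict_space)
  then show "(\<lambda>x. x) \<in> space compensator_space \<rightarrow> space M \<times> {0<..} \<times> UNIV" by auto
  fix X assume X0: "X \<in> predictable_rectangles"
  then obtain A s t C where X: "X = A \<times> {s<..t} \<times> C" "0 \<le> s" "A \<in> history s" "C \<in> sets borel"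
    unfolding predictable_rectangles_def by blast
  have "X \<in> sets compensator_space" unfolding X(1) compensator_space_def using X history_sets
    by (intro pair_measureI) (auto simp: sets_restrict_space_iff)
  then show "(\<lambda>x. x) -` X \<inter> space compensator_space \<in> sets compensator_space"
    using sets.sets_into_space by (simp add: Int_absorb2)
qed

text \<open>The Campbell measure of the marked point process: the mass of a set is the expected
  number of claims that fall into it.\<close>

definition claim_measure :: "('w \<times> real \<times> (real^'n)) measure" where
  "claim_measure = distr (count_space UNIV \<Otimes>\<^sub>M M) predictable (\<lambda>(k, \<omega>). claim_mark k \<omega>)"

lemma claim_mark_measurable2 [measurable]:
  "(\<lambda>(k, \<omega>). claim_mark k \<omega>) \<in> measurable (count_space UNIV \<Otimes>\<^sub>M M) predictable"
  by (rule measurable_pair_measure_countable1) auto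

lemma emeasure_claim_measure:
  assumes "X \<in> sets predictable"
  shows "emeasure claim_measure X = (\<Sum>k. emeasure M (claim_mark k -` X \<inter> space M))"
proof -
  have "emeasure claim_measure X = (\<integral>\<^sup>+ x. indicator X ((\<lambda>(k, \<omega>). claim_mark k \<omega>) x) \<partial>(count_space UNIV \<Otimes>\<^sub>M M))"
    using assms by (subst nn_integral_distr[OF claim_mark_measurable2, symmetric]) (simp_all add: claim_measure_def)
  also have "\<dots> = (\<integral>\<^sup>+k. \<integral>\<^sup>+\<omega>. indicator X (claim_mark k \<omega>) \<partial>M \<partial>count_space UNIV)"
    using assms by (subst nn_integral_fst[symmetric]) (auto simp: split_beta)
  also have "\<dots> = (\<Sum>k. emeasure M (claim_mark k -` X \<inter> space M))"
    unfolding nn_integral_count_space_nat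
  proof (rule suminf_cong)
    fix k
    have "(\<integral>\<^sup>+\<omega>. indicator X (claim_mark k \<omega>) \<partial>M) = (\<integral>\<^sup>+\<omega>. indicator (claim_mark k -` X \<inter> space M) \<omega> \<partial>M)"
      by (intro nn_integral_cong) (simp add: indicator_def)
    then show "(\<integral>\<^sup>+\<omega>. indicator X (claim_mark k \<omega>) \<partial>M) = emeasure M (claim_mark k -` X \<inter> space M)"
      using measurable_sets[OF claim_mark_measurable assms] by simp
  qed
  finally show ?thesis .
qed

text \<open>Both measures give a predictable rectangle the mass found in
  \<open>compensator_rectangle\<close>; the rectangles are intersection stable and exhaust the space
  by sets of finite mass. So rate times Lebesgue measure times the claim law compensates the claims
  on every predictable set.\<close>

lemma claim_measure_eq: "claim_measure = scale_measure (ennreal rate) (distr compensator_space predictable (\<lambda>x. x))"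
proof (rule measure_eqI_generator_eq[where A="\<lambda>i. space M \<times> {0<..real i} \<times> UNIV" and \<Omega>="space M \<times> {0<..} \<times> UNIV" and E=predictable_rectangles])
  show "Int_stable predictable_rectangles"
  proof (rule Int_stableI)
    fix X Y assume "X \<in> predictable_rectangles" "Y \<in> predictable_rectangles"
    then obtain A s t C A' s' t' C' where X: "X = A \<times> {s<..t} \<times> C" "0 \<le> s" "s \<le> t" "A \<in> history s" "C \<in> sets borel"
      and Y: "Y = A' \<times> {s'<..t'} \<times> C'" "0 \<le> s'" "s' \<le> t'" "A' \<in> history s'" "C' \<in> sets borel"
      unfolding predictable_rectangles_def by blast
    \<comment> \<open>If the time intervals are disjoint, the right end is raised to the left end,
      which keeps the required s \<le> t and describes an empty interval.\<close>
    have "X \<inter> Y = (A \<inter> A') \<times> {max s s'<..max (max s s') (min t t')} \<times> (C \<inter> C')"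
      unfolding X(1) Y(1) by auto
    moreover have "0 \<le> max s s'" "max s s' \<le> max (max s s') (min t t')" "C \<inter> C' \<in> sets borel"
      using X Y by auto
    ultimately show "X \<inter> Y \<in> predictable_rectangles" unfolding predictable_rectangles_def
      using history_Int[OF X(4) Y(4)] by blast
  qed
  show "predictable_rectangles \<subseteq> Pow (space M \<times> {0<..} \<times> UNIV)" by (rule rectangles_Pow)
  show s1: "sets claim_measure = sigma_sets (space M \<times> {0<..} \<times> UNIV) predictable_rectangles"
    by (simp add: claim_measure_def sets_predictable)
  show "sets (scale_measure (ennreal rate) (distr compensator_space predictable (\<lambda>x. x))) = sigma_sets (space M \<times> {0<..} \<times> UNIV) predictable_rectangles"
    by (simp add: sets_predictable)
  have eq: "emeasure claim_measure X = emeasure M A * ennreal (rate * (t - s)) * emeasure \<mu> C"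
    "emeasure (scale_measure (ennreal rate) (distr compensator_space predictable (\<lambda>x. x))) X =
      emeasure M A * ennreal (rate * (t - s)) * emeasure \<mu> C"
    if X: "X = A \<times> {s<..t} \<times> C" "0 \<le> s" "s \<le> t" "A \<in> history s" "C \<in> sets borel" for X A s t C
  proof -
    have XP: "X \<in> sets predictable" unfolding sets_predictable
      by (rule sigma_sets.Basic) (use X in \<open>auto simp: predictable_rectangles_def\<close>)
    have "claim_mark k -` X \<inter> space M = A \<inter> {\<omega> \<in> space M. s < \<tau> (Suc k) \<omega> \<and> \<tau> (Suc k) \<omega> \<le> t \<and> U (Suc k) \<omega> \<in> C}" for k
      by (auto simp: claim_mark_def X(1))
    then show "emeasure claim_measure X = emeasure M A * ennreal (rate * (t - s)) * emeasure \<mu> C"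
      unfolding emeasure_claim_measure[OF XP] by (simp add: compensator_rectangle[OF X(4,2,3,5)])
    interpret TM: sigma_finite_measure "restrict_space lborel {0::real<..} \<Otimes>\<^sub>M \<mu>" by (rule sigma_finite_time_mark)
    interpret \<mu>: prob_space \<mu> by (rule prob_space_\<mu>)
    have T: "{s<..t} \<in> sets (restrict_space lborel {0<..})" using X by (auto simp: sets_restrict_space_iff)
    have Xs: "X = space compensator_space \<inter> X"
      using sets.sets_into_space[OF XP] by (auto simp: compensator_space_def space_pair_measure space_restrict_space)
    have "emeasure (distr compensator_space predictable (\<lambda>x. x)) X = emeasure compensator_space X"
      using XP Xs by (subst emeasure_distr) (auto simp: Int_commute)
    also have "\<dots> = emeasure M A * (emeasure (restrict_space lborel {0<..}) {s<..t} * emeasure \<mu> C)"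
      unfolding compensator_space_def X(1) using T X history_sets
      by (subst TM.emeasure_pair_measure_Times) (auto simp: \<mu>.emeasure_pair_measure_Times)
    also have "emeasure (restrict_space lborel {0<..}) {s<..t} = ennreal (t - s)"
      using X by (subst emeasure_restrict_space) auto
    finally have "emeasure (scale_measure (ennreal rate) (distr compensator_space predictable (\<lambda>x. x))) X
      = ennreal rate * (emeasure M A * (ennreal (t - s) * emeasure \<mu> C))" by simp
    then show "emeasure (scale_measure (ennreal rate) (distr compensator_space predictable (\<lambda>x. x))) X =
      emeasure M A * ennreal (rate * (t - s)) * emeasure \<mu> C"
      using rate_pos X by (simp add: ennreal_mult ac_simps)
  qed
  fix X assume "X \<in> predictable_rectangles"
  then obtain A s t C where X: "X = A \<times> {s<..t} \<times> C" "0 \<le> s" "s \<le> t" "A \<in> history s" "C \<in> sets borel"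
    unfolding predictable_rectangles_def by blast
  from eq[OF this] show "emeasure claim_measure X = emeasure (scale_measure (ennreal rate) (distr compensator_space predictable (\<lambda>x. x))) X" by simp
next
  have h: "space M \<in> history 0" unfolding history_def by (intro CollectI exI[of _ "{}"]) auto
  show "range (\<lambda>i. space M \<times> {0<..real i} \<times> UNIV) \<subseteq> predictable_rectangles"
  proof safe
    fix i :: nat
    show "space M \<times> {0<..real i} \<times> UNIV \<in> predictable_rectangles" unfolding predictable_rectangles_def
      by (intro CollectI exI[of _ "space M"] exI[of _ 0] exI[of _ "real i"] exI[of _ UNIV]) (use h in auto)
  qed
  show "(\<Union>i. space M \<times> {0<..real i} \<times> UNIV) = space M \<times> {0<..} \<times> UNIV"
    using real_arch_simple by force
  fix i :: nat
  have XP: "space M \<times> {0<..real i} \<times> UNIV \<in> sets predictable" unfolding sets_predictable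
    by (rule sigma_sets.Basic) (use h in \<open>force simp: predictable_rectangles_def\<close>)
  have "claim_mark k -` (space M \<times> {0<..real i} \<times> UNIV) \<inter> space M =
     space M \<inter> {\<omega> \<in> space M. 0 < \<tau> (Suc k) \<omega> \<and> \<tau> (Suc k) \<omega> \<le> real i \<and> U (Suc k) \<omega> \<in> UNIV}" for k
      by (auto simp: claim_mark_def)
  then have "emeasure claim_measure (space M \<times> {0<..real i} \<times> UNIV) = emeasure M (space M) * ennreal (rate * (real i - 0)) * emeasure \<mu> UNIV"
    unfolding emeasure_claim_measure[OF XP] using compensator_rectangle[OF h, of "real i" UNIV] by simp
  also have "\<dots> < \<infinity>"
  proof -
    interpret \<mu>: prob_space \<mu> by (rule prob_space_\<mu>)
    show ?thesis using \<mu>.emeasure_space_1 by (simp add: emeasure_space_1)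
  qed
  finally show "emeasure claim_measure (space M \<times> {0<..real i} \<times> UNIV) \<noteq> \<infinity>" by simp
qed

text \<open>The integral against the Campbell measure is written in two ways: as a mean of sums over
  the claims and, by \<open>claim_measure_eq\<close>, as an integral over time and the claim law.
  The last part, with absolute values, serves to dominate the penalty at ruin.\<close>

lemma compensation:
  fixes H :: "'w \<times> real \<times> (real^'n) \<Rightarrow> real"
  assumes H: "H \<in> borel_measurable predictable" and int: "integrable compensator_space H"
  shows "integrable M (\<lambda>\<omega>. \<integral>k. H (claim_mark k \<omega>) \<partial>count_space UNIV)"
    "integrable M (\<lambda>\<omega>. \<integral>x. H (\<omega>, x) \<partial>(restrict_space lborel {0<..} \<Otimes>\<^sub>M \<mu>))"
    "(\<integral>\<omega>. (\<integral>k. H (claim_mark k \<omega>) \<partial>count_space UNIV) \<partial>M) =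
      rate * (\<integral>\<omega>. (\<integral>x. H (\<omega>, x) \<partial>(restrict_space lborel {0<..} \<Otimes>\<^sub>M \<mu>)) \<partial>M)"
    "(\<integral>\<^sup>+\<omega>. (\<Sum>k. ennreal (norm (H (claim_mark k \<omega>)))) \<partial>M) < \<infinity>"
proof -
  interpret TM: sigma_finite_measure "restrict_space lborel {0::real<..} \<Otimes>\<^sub>M \<mu>" by (rule sigma_finite_time_mark)
  interpret P: pair_sigma_finite M "restrict_space lborel {0::real<..} \<Otimes>\<^sub>M \<mu>" ..
  interpret C: sigma_finite_measure "count_space (UNIV :: nat set)" by (rule sigma_finite_measure_count_space)
  interpret Q: pair_sigma_finite "count_space (UNIV :: nat set)" M ..
  let ?D = "distr compensator_space predictable (\<lambda>x. x)"
  have Hc: "integrable ?D H" using H int by (subst integrable_distr_eq) auto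
  have dens: "scale_measure (ennreal rate) ?D = density ?D (\<lambda>_. ennreal rate)"
  proof (rule measure_eqI)
    fix A assume "A \<in> sets (scale_measure (ennreal rate) ?D)"
    then show "emeasure (scale_measure (ennreal rate) ?D) A = emeasure (density ?D (\<lambda>_. ennreal rate)) A"
      by (subst emeasure_density) (auto simp: nn_integral_cmult_indicator)
  qed simp
  have "integrable (density ?D (\<lambda>_. ennreal rate)) H"
    using H Hc rate_pos by (subst integrable_density) auto
  then have ic: "integrable claim_measure H" unfolding claim_measure_eq dens .
  then have iq: "integrable (count_space UNIV \<Otimes>\<^sub>M M) (\<lambda>(k, \<omega>). H (claim_mark k \<omega>))"
    unfolding claim_measure_def using H
    by (subst (asm) integrable_distr_eq[OF claim_mark_measurable2]) (simp_all add: case_prod_beta')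
  have Hk: "(\<lambda>\<omega>. H (claim_mark k \<omega>)) \<in> borel_measurable M" for k using measurable_compose[OF claim_mark_measurable H] .
  have "(\<integral>\<^sup>+\<omega>. (\<Sum>k. ennreal (norm (H (claim_mark k \<omega>)))) \<partial>M) = (\<Sum>k. \<integral>\<^sup>+\<omega>. ennreal (norm (H (claim_mark k \<omega>))) \<partial>M)"
    using Hk by (intro nn_integral_suminf) auto
  also have "\<dots> = (\<integral>\<^sup>+k. \<integral>\<^sup>+\<omega>. ennreal (norm (case_prod (\<lambda>k \<omega>. H (claim_mark k \<omega>)) (k, \<omega>))) \<partial>M \<partial>count_space UNIV)"
    by (simp add: nn_integral_count_space_nat)
  also have "\<dots> = (\<integral>\<^sup>+z. ennreal (norm (case_prod (\<lambda>k \<omega>. H (claim_mark k \<omega>)) z)) \<partial>(count_space UNIV \<Otimes>\<^sub>M M))"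
    by (rule nn_integral_fst) (use borel_measurable_integrable[OF iq] in measurable)
  also have "\<dots> < \<infinity>" using iq unfolding integrable_iff_bounded by blast
  finally show "(\<integral>\<^sup>+\<omega>. (\<Sum>k. ennreal (norm (H (claim_mark k \<omega>)))) \<partial>M) < \<infinity>" .
  show "integrable M (\<lambda>\<omega>. \<integral>k. H (claim_mark k \<omega>) \<partial>count_space UNIV)"
    using Q.integrable_snd[OF iq] by simp
  show "integrable M (\<lambda>\<omega>. \<integral>x. H (\<omega>, x) \<partial>(restrict_space lborel {0<..} \<Otimes>\<^sub>M \<mu>))"
    using P.integrable_fst'[OF int[unfolded compensator_space_def]] .
  have "(\<integral>\<omega>. (\<integral>k. H (claim_mark k \<omega>) \<partial>count_space UNIV) \<partial>M) = (\<integral>x. (\<lambda>(k, \<omega>). H (claim_mark k \<omega>)) x \<partial>(count_space UNIV \<Otimes>\<^sub>M M))"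
    using Q.integral_snd[OF iq] by simp
  also have "\<dots> = integral\<^sup>L claim_measure H" unfolding claim_measure_def using H
    by (subst integral_distr[OF claim_mark_measurable2]) (simp_all add: case_prod_beta')
  also have "\<dots> = rate * integral\<^sup>L ?D H"
    unfolding claim_measure_eq dens using H rate_pos by (subst integral_density) auto
  also have "integral\<^sup>L ?D H = integral\<^sup>L compensator_space H" using H by (subst integral_distr) auto
  also have "\<dots> = (\<integral>\<omega>. (\<integral>x. H (\<omega>, x) \<partial>(restrict_space lborel {0<..} \<Otimes>\<^sub>M \<mu>)) \<partial>M)"
    using P.integral_fst'[OF int[unfolded compensator_space_def]] by (simp add: compensator_space_def)
  finally show "(\<integral>\<omega>. (\<integral>k. H (claim_mark k \<omega>) \<partial>count_space UNIV) \<partial>M) =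
      rate * (\<integral>\<omega>. (\<integral>x. H (\<omega>, x) \<partial>(restrict_space lborel {0<..} \<Otimes>\<^sub>M \<mu>)) \<partial>M)" .
qed

section \<open>Discounting by an exponential clock\<close>

text \<open>The discount factor \<open>exp (- c s)\<close> is the probability that the clock exceeds \<open>s\<close>.\<close>

definition clock :: "real measure" where "clock = density lborel (exponential_density c)"

lemma prob_space_clock: "prob_space clock"
  unfolding clock_def by (rule prob_space_exponential_density[OF c_pos])

lemma sets_clock [simp, measurable_cong]: "sets clock = sets borel" and space_clock [simp]: "space clock = UNIV"
  by (simp_all add: clock_def)

lemma clock_distributed: "distributed clock lborel (\<lambda>v. v) (exponential_density c)"
  unfolding distributed_def clock_def
  by (auto simp: distr_id2[OF sets_density] c_pos intro!: distr_id2)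

lemma AE_clock:
  assumes "AE v in lborel. 0 < v \<longrightarrow> P v" shows "AE v in clock. 0 < v \<and> P v"
  unfolding clock_def
proof (subst AE_density)
  show "(\<lambda>v. ennreal (exponential_density c v)) \<in> borel_measurable lborel" by measurable
  show "AE v in lborel. 0 < ennreal (exponential_density c v) \<longrightarrow> 0 < v \<and> P v"
    using assms AE_lborel_singleton[of 0]
    by eventually_elim (auto simp: exponential_density_def less_le split: if_splits)
qed

lemma clock_tail: assumes "0 \<le> s" shows "measure clock {s..} = exp (- c * s)"
proof -
  interpret E: prob_space clock by (rule prob_space_clock)
  have "E.prob {v \<in> space clock. s < v} = exp (- s * c)"
    by (rule E.exponential_distributedD_gt[OF clock_distributed assms c_pos])
  moreover have "E.prob {s..} = E.prob {v \<in> space clock. s < v}"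
  proof (rule measure_eq_AE)
    have "AE v in clock. 0 < v \<and> v \<noteq> s" by (rule AE_clock) (use AE_lborel_singleton[of s] in auto)
    then show "AE v in clock. (v \<in> {s..}) = (v \<in> {v \<in> space clock. s < v})"
      by eventually_elim auto
  qed auto
  ultimately show ?thesis by (simp add: mult.commute)
qed

lemma clock_mean_integrable: "integrable clock (\<lambda>v. v)"
proof -
  interpret E: prob_space clock by (rule prob_space_clock)
  show ?thesis using E.erlang_ith_moment_integrable[OF c_pos clock_distributed, of 1] by simp
qed

text \<open>Fubini on the pairs with s \<le> v: time s is counted exactly when the clock value v is
  at least s, which has probability exp (-c s).\<close>

lemma clock_fubini:
  assumes h: "set_integrable lborel {0<..e} h"
  shows "integrable clock (\<lambda>v. LINT s:{0<..min v e}|lborel. h s)"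
    "(\<integral>v. (LINT s:{0<..min v e}|lborel. h s) \<partial>clock) = (LINT s:{0<..e}|lborel. exp (- c * s) * (h s :: real))"
proof -
  interpret E: prob_space clock by (rule prob_space_clock)
  interpret P: pair_sigma_finite clock lborel ..
  define k where "k s = indicator {0<..e} s * h s" for s
  have k: "integrable lborel k" using h by (simp add: set_integrable_def k_def[abs_def])
  have [measurable]: "k \<in> borel_measurable borel" using k by (simp add: borel_measurable_integrable)
  define F where "F v s = k s * (if s \<le> v then 1 else 0)" for v s :: real
  have [measurable]: "F v \<in> borel_measurable borel" for v unfolding F_def[abs_def] by measurable
  have Fi: "integrable lborel (F v)" for v
    by (rule Bochner_Integration.integrable_bound[OF k]) (auto simp: F_def)
  have Fm: "case_prod F \<in> borel_measurable (clock \<Otimes>\<^sub>M lborel)"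
    unfolding F_def[abs_def] by measurable
  have F: "integrable (clock \<Otimes>\<^sub>M lborel) (case_prod F)"
  proof (rule P.Fubini_integrable[OF Fm])
    show "AE v in clock. integrable lborel (\<lambda>s. case_prod F (v, s))" using Fi by simp
    show "integrable clock (\<lambda>v. \<integral>s. norm (case_prod F (v, s)) \<partial>lborel)"
    proof (rule E.integrable_const_bound[of _ "\<integral>s. norm (k s) \<partial>lborel"])
      show "(\<lambda>v. \<integral>s. norm (case_prod F (v, s)) \<partial>lborel) \<in> borel_measurable clock"
        using Fm by measurable
      show "AE v in clock. norm (\<integral>s. norm (case_prod F (v, s)) \<partial>lborel) \<le> (\<integral>s. norm (k s) \<partial>lborel)"
      proof (rule AE_I2)
        fix v
        have "(\<integral>s. norm (F v s) \<partial>lborel) \<le> (\<integral>s. norm (k s) \<partial>lborel)"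
          by (intro integral_mono integrable_norm Fi k) (auto simp: F_def)
        then show "norm (\<integral>s. norm (case_prod F (v, s)) \<partial>lborel) \<le> (\<integral>s. norm (k s) \<partial>lborel)" by simp
      qed
    qed
  qed
  have e1: "(\<integral>s. F v s \<partial>lborel) = (LINT s:{0<..min v e}|lborel. h s)" for v
    unfolding set_lebesgue_integral_def
    by (rule Bochner_Integration.integral_cong) (auto simp: F_def k_def indicator_def)
  show "integrable clock (\<lambda>v. LINT s:{0<..min v e}|lborel. h s)"
    using P.integrable_fst'[OF F] by (simp add: e1)
  have "(\<integral>v. (LINT s:{0<..min v e}|lborel. h s) \<partial>clock) = (\<integral>s. (\<integral>v. F v s \<partial>clock) \<partial>lborel)"
    unfolding e1[symmetric] using P.Fubini_integral[OF F] by simp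
  also have "\<dots> = (\<integral>s. indicator {0<..e} s *\<^sub>R (exp (- c * s) * h s) \<partial>lborel)"
  proof (rule Bochner_Integration.integral_cong[OF refl])
    fix s
    have "F v s = k s * indicator {s..} v" for v by (simp add: F_def indicator_def)
    then have "(\<integral>v. F v s \<partial>clock) = k s * measure clock {s..}" by simp
    then show "(\<integral>v. F v s \<partial>clock) = indicator {0<..e} s *\<^sub>R (exp (- c * s) * h s)"
      using clock_tail[of s] by (auto simp: k_def indicator_def)
  qed
  finally show "(\<integral>v. (LINT s:{0<..min v e}|lborel. h s) \<partial>clock) = (LINT s:{0<..e}|lborel. exp (- c * s) * h s)"
    by (simp add: set_lebesgue_integral_def)
qed

lemma clock_integral:
  assumes [measurable]: "h \<in> borel_measurable borel"
  shows "(\<integral>v. indicator {0<..e} v * h v \<partial>clock) = (LINT s:{0<..e}|lborel. c * exp (- c * s) * (h s :: real))"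
proof -
  have "(\<integral>v. indicator {0<..e} v * h v \<partial>clock) = (\<integral>v. exponential_density c v *\<^sub>R (indicator {0<..e} v * h v) \<partial>lborel)"
    unfolding clock_def by (rule integral_density) (auto simp: exponential_density_def c_pos less_imp_le)
  also have "\<dots> = (LINT s:{0<..e}|lborel. c * exp (- c * s) * h s)"
    unfolding set_lebesgue_integral_def
    by (rule Bochner_Integration.integral_cong) (auto simp: exponential_density_def indicator_def mult.commute)
  finally show ?thesis .
qed

section \<open>Predictable processes\<close>

abbreviation claims_upto :: "ennreal \<Rightarrow> 'w measure" where "claims_upto \<equiv> claim_filtration M \<tau> U"

lemma space_claims_upto [simp]: "space (claims_upto t) = space M"
  unfolding claim_filtration_def by (rule space_measure_of) auto

lemma claim_event: "1 \<le> k \<Longrightarrow> 0 \<le> s \<Longrightarrow> ennreal s \<le> t \<Longrightarrow> A \<in> sets borel \<Longrightarrow>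
    {\<omega> \<in> space M. \<tau> k \<omega> \<le> s \<and> U k \<omega> \<in> A} \<in> sets (claims_upto t)"
  unfolding claim_filtration_def by (subst sets_measure_of) (auto intro!: sigma_sets.Basic)

lemma claims_upto_sets: "sets (claims_upto t) \<subseteq> sets M"
  unfolding claim_filtration_def
proof (rule sets.sigma_sets_subset[THEN subset_trans[rotated]])
  show "{{\<omega> \<in> space M. \<tau> k \<omega> \<le> s \<and> U k \<omega> \<in> A} |k s A. 1 \<le> k \<and> 0 \<le> s \<and> ennreal s \<le> t \<and> A \<in> sets borel} \<subseteq> sets M"
  proof safe
    fix k :: nat and s :: real and A :: "(real^'n) set" assume k: "1 \<le> k" and [measurable]: "A \<in> sets borel"
    have [measurable]: "\<tau> k \<in> borel_measurable M" "U k \<in> borel_measurable M" using k by auto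
    show "{\<omega> \<in> space M. \<tau> k \<omega> \<le> s \<and> U k \<omega> \<in> A} \<in> sets M" by measurable
  qed
qed (subst sets_measure_of, auto)

lemma claims_upto_measurable: "h \<in> measurable (claims_upto t) N' \<Longrightarrow> h \<in> measurable M N'"
  by (rule measurable_mono[THEN subsetD]) (use claims_upto_sets in auto)

lemma stopped_claim_measurable:
  assumes k: "1 \<le> k" and t: "0 \<le> t"
  shows "(\<lambda>\<omega>. if \<tau> k \<omega> \<le> t then U k \<omega> else 0) \<in> borel_measurable (claims_upto (ennreal t))"
proof (rule measurableI)
  fix A :: "(real^'n) set" assume A: "A \<in> sets borel"
  have e: "{\<omega> \<in> space M. \<tau> k \<omega> \<le> t \<and> U k \<omega> \<in> UNIV} \<in> sets (claims_upto (ennreal t))"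
    "{\<omega> \<in> space M. \<tau> k \<omega> \<le> t \<and> U k \<omega> \<in> A} \<in> sets (claims_upto (ennreal t))"
    by (rule claim_event; use k t A in simp)+
  have "(\<lambda>\<omega>. if \<tau> k \<omega> \<le> t then U k \<omega> else 0) -` A \<inter> space (claims_upto (ennreal t)) =
     {\<omega> \<in> space M. \<tau> k \<omega> \<le> t \<and> U k \<omega> \<in> A} \<union>
     (if 0 \<in> A then space (claims_upto (ennreal t)) - {\<omega> \<in> space M. \<tau> k \<omega> \<le> t \<and> U k \<omega> \<in> UNIV} else {})" by (auto split: if_splits)
  also have "\<dots> \<in> sets (claims_upto (ennreal t))"
    by (cases "0 \<in> A") (simp_all only: if_True if_False sets.Un sets.compl_sets e sets.empty_sets)
  finally show "(\<lambda>\<omega>. if \<tau> k \<omega> \<le> t then U k \<omega> else 0) -` A \<inter> space (claims_upto (ennreal t)) \<in> sets (claims_upto (ennreal t))" .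
qed simp

text \<open>Replacing claims after t by 0 turns the sum with a random upper index into a limit of
  sums with a fixed one, each measurable at time t; the sequence is constant from N t on.\<close>

lemma surplus_limit:
  assumes w: "\<omega> \<in> space M"
  shows "(\<lambda>n. z + t *\<^sub>R p - (\<Sum>k = 1..n. if \<tau> k \<omega> \<le> t then U k \<omega> else 0)) \<longlonglongrightarrow> surplus p \<tau> U z t \<omega>"
proof (rule tendsto_eventually, rule eventually_mono[OF eventually_ge_at_top[of "N t \<omega>"]])
  fix n assume n: "N t \<omega> \<le> n"
  have "(\<Sum>k = 1..n. if \<tau> k \<omega> \<le> t then U k \<omega> else 0) = (\<Sum>k = 1..N t \<omega>. if \<tau> k \<omega> \<le> t then U k \<omega> else 0)"
    by (rule sum.mono_neutral_right) (use n le_N_iff[OF w, of _ t] in auto)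
  also have "\<dots> = (\<Sum>k = 1..N t \<omega>. U k \<omega>)"
    by (rule sum.cong[OF refl]) (use le_N_iff[OF w, of _ t] in auto)
  finally show "z + t *\<^sub>R p - (\<Sum>k = 1..n. if \<tau> k \<omega> \<le> t then U k \<omega> else 0) = surplus p \<tau> U z t \<omega>"
    by (simp add: surplus_def)
qed

lemma surplus_adapted:
  assumes t: "0 \<le> t" shows "surplus p \<tau> U z t \<in> borel_measurable (claims_upto (ennreal t))"
proof (rule borel_measurable_LIMSEQ_metric)
  fix n show "(\<lambda>\<omega>. z + t *\<^sub>R p - (\<Sum>k = 1..n. if \<tau> k \<omega> \<le> t then U k \<omega> else 0)) \<in> borel_measurable (claims_upto (ennreal t))"
    by (intro borel_measurable_diff borel_measurable_sum stopped_claim_measurable t) auto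
qed (use surplus_limit in simp)

lemma surplus_random_time:
  assumes S [measurable]: "S \<in> borel_measurable M"
  shows "(\<lambda>\<omega>. surplus p \<tau> U z (S \<omega>) \<omega>) \<in> borel_measurable M"
proof (rule borel_measurable_LIMSEQ_metric)
  fix n
  have "(\<lambda>\<omega>. if \<tau> k \<omega> \<le> S \<omega> then U k \<omega> else 0) \<in> borel_measurable M" if "k \<in> {1..n}" for k
  proof -
    have [measurable]: "\<tau> k \<in> borel_measurable M" "U k \<in> borel_measurable M" using that by auto
    show ?thesis by measurable
  qed
  then show "(\<lambda>\<omega>. z + S \<omega> *\<^sub>R p - (\<Sum>k = 1..n. if \<tau> k \<omega> \<le> S \<omega> then U k \<omega> else 0)) \<in> borel_measurable M"
    by (intro borel_measurable_diff borel_measurable_sum borel_measurable_add) auto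
qed (use surplus_limit in simp)

text \<open>An event observed at some rational time strictly before the current one depends on the
  strict past only. Complements of such sets express that ruin, or the switch, has not happened
  before the current time.\<close>

lemma predictable_set:
  assumes A: "\<And>q. q \<in> \<rat> \<Longrightarrow> 0 \<le> q \<Longrightarrow> A q \<in> sets (claims_upto (ennreal q))"
  shows "{z \<in> space predictable. \<exists>q\<in>\<rat>. 0 \<le> q \<and> q < fst (snd z) \<and> fst z \<in> A q} \<in> sets predictable"
proof -
  have "{z \<in> space predictable. \<exists>q\<in>\<rat>. 0 \<le> q \<and> q < fst (snd z) \<and> fst z \<in> A q} =
      (\<Union>q\<in>{q\<in>\<rat>. 0 \<le> q}. \<Union>n::nat. A q \<times> {q<..q + real n} \<times> UNIV)" (is "?L = ?R")
  proof
    show "?L \<subseteq> ?R"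
    proof
      fix z assume z: "z \<in> ?L"
      then obtain q where q: "q \<in> \<rat>" "0 \<le> q" "q < fst (snd z)" "fst z \<in> A q" by auto
      obtain n :: nat where "fst (snd z) - q \<le> real n" using real_arch_simple by blast
      then have "z \<in> A q \<times> {q<..q + real n} \<times> UNIV" using q by (cases z) auto
      then show "z \<in> ?R" using q by blast
    qed
    show "?R \<subseteq> ?L" using A[THEN sets.sets_into_space] by fastforce
  qed
  also have "\<dots> \<in> sets predictable"
    by (intro sets.countable_UN'' countable_subset[OF _ countable_rat] predictable_rectangle A) auto
  finally show ?thesis .
qed

lemma predictable_time [measurable]: "(\<lambda>z. fst (snd z)) \<in> borel_measurable predictable"
proof (rule borel_measurableI_less)
  fix y :: real
  have "space predictable - {z \<in> space predictable. fst (snd z) < y} \<in> sets predictable"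
  proof -
    have "{z \<in> space predictable. fst (snd z) \<le> q} \<in> sets predictable" for q
    proof (cases "0 \<le> q")
      case True
      have "{z \<in> space predictable. fst (snd z) \<le> q} = space (claims_upto (ennreal 0)) \<times> {0<..q} \<times> UNIV" by auto
      also have "\<dots> \<in> sets predictable" by (rule predictable_rectangle[OF sets.top]) auto
      finally show ?thesis .
    next
      case False
      then have "{z \<in> space predictable. fst (snd z) \<le> q} = {}" by auto
      then show ?thesis by (simp only: sets.empty_sets)
    qed
    then have "(\<Union>n::nat. {z \<in> space predictable. fst (snd z) \<le> y - 1 / Suc n}) \<in> sets predictable" by blast
    also have "(\<Union>n::nat. {z \<in> space predictable. fst (snd z) \<le> y - 1 / Suc n}) = {z \<in> space predictable. fst (snd z) < y}"
    proof safe
      fix \<omega> s \<alpha> assume a: "(\<omega>, s, \<alpha>) \<in> space predictable" "fst (snd (\<omega>, s, \<alpha>)) < y"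
      then obtain n where "inverse (real (Suc n)) < y - s" using reals_Archimedean[of "y - s"] by auto
      then show "(\<omega>, s, \<alpha>) \<in> (\<Union>n::nat. {z \<in> space predictable. fst (snd z) \<le> y - 1 / Suc n})"
        using a by (intro UN_I[of n]) (auto simp: inverse_eq_divide)
    next
      fix n :: nat and \<omega> s and \<alpha> :: "real^'n" assume "fst (snd (\<omega>, s, \<alpha>)) \<le> y - 1 / Suc n"
      moreover have "0 < 1 / real (Suc n)" by simp
      ultimately show "fst (snd (\<omega>, s, \<alpha>)) < y" by linarith
    qed
    finally show ?thesis by blast
  qed
  then have "space predictable - (space predictable - {z \<in> space predictable. fst (snd z) < y}) \<in> sets predictable" by blast
  also have "space predictable - (space predictable - {z \<in> space predictable. fst (snd z) < y}) = {z \<in> space predictable. fst (snd z) < y}" by blast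
  finally show "{z \<in> space predictable. fst (snd z) < y} \<in> sets predictable" .
qed

lemma predictable_mark [measurable]: "(\<lambda>z. snd (snd z)) \<in> borel_measurable predictable"
proof (rule measurableI)
  fix C :: "(real^'n) set" assume C: "C \<in> sets borel"
  have "(\<lambda>z. snd (snd z)) -` C \<inter> space predictable = (\<Union>n::nat. space (claims_upto (ennreal 0)) \<times> {0<..real n} \<times> C)"
    using real_arch_simple by fastforce
  also have "\<dots> \<in> sets predictable"
    by (intro sets.countable_UN'' predictable_rectangle[OF sets.top] C) auto
  finally show "(\<lambda>z. snd (snd z)) -` C \<inter> space predictable \<in> sets predictable" .
qed simp

text \<open>On the cell from j \<delta> (excluded) to (j + 1) \<delta> the process is frozen at its
  value at j \<delta>, known at the left end. Left limits of adapted processes are limits of such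
  steps.\<close>

lemma predictable_step:
  fixes Z :: "real \<Rightarrow> 'w \<Rightarrow> real^'n"
  assumes Z: "\<And>t. 0 \<le> t \<Longrightarrow> Z t \<in> borel_measurable (claims_upto (ennreal t))" and \<delta>: "\<delta> > 0"
  shows "(\<lambda>z. Z (grid_before 0 \<delta> (fst (snd z))) (fst z)) \<in> borel_measurable predictable"
proof (rule measurableI)
  fix B :: "(real^'n) set" assume B: "B \<in> sets borel"
  have cell: "\<exists>j::nat. real j * \<delta> < s \<and> s \<le> real (Suc j) * \<delta>" if "0 < s" for s
  proof -
    define j where "j = nat (\<lceil>s / \<delta>\<rceil> - 1)"
    have "0 < \<lceil>s / \<delta>\<rceil>" using that \<delta> by simp
    then have "real j = of_int \<lceil>s / \<delta>\<rceil> - 1" by (simp add: j_def)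
    then have "real j < s / \<delta>" "s / \<delta> \<le> real (Suc j)" using ceiling_correct[of "s / \<delta>"] by auto
    then show ?thesis using \<delta> by (auto simp: field_simps)
  qed
  have "(\<lambda>z. Z (grid_before 0 \<delta> (fst (snd z))) (fst z)) -` B \<inter> space predictable =
      (\<Union>j::nat. (Z (real j * \<delta>) -` B \<inter> space (claims_upto (ennreal (real j * \<delta>)))) \<times> {real j * \<delta><..real (Suc j) * \<delta>} \<times> UNIV)" (is "?L = ?R")
  proof
    show "?L \<subseteq> ?R"
    proof
      fix z assume z: "z \<in> ?L"
      obtain \<omega> s \<alpha> where zz: "z = (\<omega>, s, \<alpha>)" by (cases z)
      have a: "\<omega> \<in> space M" "0 < s" "Z (grid_before 0 \<delta> s) \<omega> \<in> B" using z by (auto simp: zz)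
      then obtain j :: nat where j: "real j * \<delta> < s" "s \<le> real (Suc j) * \<delta>" using cell[of s] by auto
      then show "z \<in> ?R" using a grid_before_cell[OF \<delta>, of 0 j s] by (intro UN_I[of j]) (auto simp: zz)
    qed
    show "?R \<subseteq> ?L"
    proof
      fix z assume z: "z \<in> ?R"
      obtain \<omega> s \<alpha> where zz: "z = (\<omega>, s, \<alpha>)" by (cases z)
      obtain j :: nat where a: "\<omega> \<in> space M" "Z (real j * \<delta>) \<omega> \<in> B" "real j * \<delta> < s" "s \<le> real (Suc j) * \<delta>"
        using z by (auto simp: zz)
      have "0 \<le> real j * \<delta>" using \<delta> by simp
      then have "0 < s" using a(3) by simp
      moreover have "grid_before 0 \<delta> s = real j * \<delta>" using grid_before_cell[OF \<delta>, of 0 j s] a by simp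
      ultimately show "z \<in> ?L" using a by (simp add: zz)
    qed
  qed
  also have "\<dots> \<in> sets predictable"
    by (intro sets.countable_UN'' predictable_rectangle measurable_sets[OF Z B]) (use \<delta> in auto)
  finally show "(\<lambda>z. Z (grid_before 0 \<delta> (fst (snd z))) (fst z)) -` B \<inter> space predictable \<in> sets predictable" .
qed simp

section \<open>Growth bounds and measurability of the switch value\<close>

lemma growth_line: "growth (y + t *\<^sub>R p) = growth y * exp (c * t / 2)"
proof -
  have "(\<Sum>i\<in>UNIV. (y + t *\<^sub>R p) $ i / p $ i) = (\<Sum>i\<in>UNIV. y $ i / p $ i + t)"
    by (rule sum.cong[OF refl]) (use p_pos in \<open>simp add: add_divide_distrib less_imp_neq[symmetric]\<close>)
  also have "\<dots> = (\<Sum>i\<in>UNIV. y $ i / p $ i) + real CARD('n) * t" by (simp add: sum.distrib)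
  finally show ?thesis unfolding growth_def exp_add[symmetric] by (simp add: field_simps)
qed

text \<open>Along \<open>p\<close> each of the n terms y_i / p_i grows by t, so the factor c / (2 n)
  in the weight yields growth at rate c / 2. Discounting at rate c outweighs this, and the weight of
  the initial surplus is an upper bound at all times.\<close>

lemma discounted_growth:
  assumes K: "0 \<le> K" and t: "0 \<le> t" and y: "y \<le> x + t *\<^sub>R p"
  shows "exp (- c * t) * (K * growth y) \<le> K * growth x"
proof -
  have "K * growth y \<le> K * (growth x * exp (c * t / 2))"
    using growth_mono[OF y] K unfolding growth_line by (intro mult_left_mono)
  then have "exp (- c * t) * (K * growth y) \<le> exp (- c * t) * (K * (growth x * exp (c * t / 2)))" by simp
  also have "\<dots> = K * growth x * (exp (- c * t) * exp (c * t / 2))" by simp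
  also have "exp (- c * t) * exp (c * t / 2) = exp (- (c * t / 2))" unfolding exp_add[symmetric] by simp
  also have "K * growth x * exp (- (c * t / 2)) \<le> K * growth x * 1"
    using K c_pos t by (intro mult_left_mono) (auto simp: growth_def)
  finally show ?thesis by simp
qed

lemma f_upper: obtains K where "0 \<le> K" "\<And>y. 0 \<le> y \<Longrightarrow> f y \<le> K * growth y"
proof -
  obtain K where K: "\<And>y. y \<in> {0..} \<Longrightarrow> f y / growth y \<le> K"
    using f_growth unfolding growth_condition_def growth_def by blast
  have g: "0 < growth y" for y by (simp add: growth_def)
  show ?thesis
  proof (rule that[of "\<bar>K\<bar>"])
    fix y :: "real^'n" assume "0 \<le> y"
    then have "f y \<le> K * growth y" using K[of y] g[of y] by (simp add: divide_le_eq)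
    also have "\<dots> \<le> \<bar>K\<bar> * growth y" using g[of y] by (intro mult_right_mono) auto
    finally show "f y \<le> \<bar>K\<bar> * growth y" .
  qed simp
qed

text \<open>The continuous case is immediate. In the monotone case \<open>f\<close> is evaluated at
  a grid point strictly above y in every coordinate: the grid is countable, so these functions are
  measurable, and right continuity makes them converge to \<open>f y\<close>.\<close>

lemma f_measurable: "(\<lambda>y. if 0 \<le> y then f y else 0) \<in> borel_measurable borel"
  using f_regular
proof
  assume "continuous_on {0..} f"
  then have "(\<lambda>y. indicator {0..} y *\<^sub>R f y) \<in> borel_measurable borel"
    by (intro borel_measurable_continuous_on_indicator) simp
  moreover have "(\<lambda>y. indicator {0..} y *\<^sub>R f y) = (\<lambda>y. if 0 \<le> y then f y else 0)" by auto
  ultimately show ?thesis by (simp only:)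
next
  assume f: "mono_on {0..} f \<and> (\<forall>x\<in>{0..}. (f \<longlongrightarrow> f x) (at x within {x..}))"
  define up :: "nat \<Rightarrow> real^'n \<Rightarrow> real^'n" where "up n y = (\<chi> i. (of_int \<lfloor>y $ i * real (Suc n)\<rfloor> + 1) / real (Suc n))" for n y
  have up: "y $ i < up n y $ i" "up n y $ i \<le> y $ i + 1 / real (Suc n)" for n y i
  proof -
    have "y $ i * real (Suc n) < of_int \<lfloor>y $ i * real (Suc n)\<rfloor> + 1" by linarith
    then show "y $ i < up n y $ i" by (simp add: up_def pos_less_divide_eq del: of_nat_Suc)
    have "of_int \<lfloor>y $ i * real (Suc n)\<rfloor> + 1 \<le> (y $ i + 1 / real (Suc n)) * real (Suc n)"
      by (simp add: distrib_right del: of_nat_Suc)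
    then show "up n y $ i \<le> y $ i + 1 / real (Suc n)" by (simp add: up_def pos_divide_le_eq del: of_nat_Suc)
  qed
  have m: "(\<lambda>y. f (up n y)) \<in> borel_measurable borel" for n
  proof -
    define fl :: "real^'n \<Rightarrow> int^'n" where "fl y = (\<chi> i. \<lfloor>y $ i * real (Suc n)\<rfloor>)" for y
    have "fl \<in> measurable borel (count_space UNIV)"
    proof (subst measurable_count_space_eq2_countable, safe)
      fix z
      have "fl -` {z} \<inter> space borel = {y \<in> space borel. \<forall>i\<in>UNIV. \<lfloor>y $ i * real (Suc n)\<rfloor> = z $ i}"
        by (auto simp: fl_def vec_eq_iff)
      also have "\<dots> \<in> sets borel" by measurable
      finally show "fl -` {z} \<inter> space borel \<in> sets borel" .
    qed auto
    from measurable_compose[OF this, of "\<lambda>z. f (\<chi> i. (of_int (z $ i) + 1) / real (Suc n))"]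
    show ?thesis by (simp add: up_def fl_def)
  qed
  show ?thesis
  proof (rule borel_measurable_LIMSEQ_metric)
    have "{0::real^'n..} \<in> sets borel" by simp
    then show "(\<lambda>y. if y \<in> {0..} then f (up n y) else 0) \<in> borel_measurable borel" for n
      using m by (intro measurable_If_set) auto
    fix y :: "real^'n"
    show "(\<lambda>n. if y \<in> {0..} then f (up n y) else 0) \<longlonglongrightarrow> (if 0 \<le> y then f y else 0)"
    proof (cases "0 \<le> y")
      case True
      have "(\<lambda>n. up n y) \<longlonglongrightarrow> y"
      proof (rule vec_tendstoI)
        fix i
        have l: "(\<lambda>n. y $ i + 1 / real (Suc n)) \<longlonglongrightarrow> y $ i"
          using tendsto_add[OF tendsto_const LIMSEQ_inverse_real_of_nat, of "y $ i"] by (simp add: inverse_eq_divide)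
        show "(\<lambda>n. up n y $ i) \<longlonglongrightarrow> y $ i"
          by (rule tendsto_sandwich[OF _ _ tendsto_const l]) (use up in \<open>auto intro!: always_eventually less_imp_le\<close>)
      qed
      moreover have "up n y \<in> {y..} \<and> up n y \<noteq> y" for n
        using up(1)[of y _ n] by (auto simp: less_eq_vec_def less_imp_le)
      ultimately have "filterlim (\<lambda>n. up n y) (at y within {y..}) sequentially"
        by (auto simp: filterlim_at intro!: always_eventually)
      from filterlim_compose[OF _ this, of f] f True show ?thesis by auto
    qed simp
  qed
qed

end

section \<open>Paths of the controlled surplus\<close>

locale controlled = supersolution M p a c rate \<tau> U \<upsilon> f u
  for M :: "'w measure" and p a :: "real^'n" and c rate :: real
    and \<tau> :: "nat \<Rightarrow> 'w \<Rightarrow> real" and U :: "nat \<Rightarrow> 'w \<Rightarrow> real^'n"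
    and \<upsilon> :: "real^'n \<Rightarrow> real^'n \<Rightarrow> real" and f u :: "real^'n \<Rightarrow> real" +
  fixes x :: "real^'n" and L :: "real \<Rightarrow> 'w \<Rightarrow> real^'n"
  assumes x_nonneg: "0 \<le> x" and admissible: "admissible M p \<tau> U x L"
begin

abbreviation X where "X \<equiv> surplus p \<tau> U x"
abbreviation Y where "Y \<equiv> controlled_surplus p \<tau> U x L"
abbreviation \<rho> where "\<rho> \<equiv> ruin_time p \<tau> U x L"
abbreviation Lm where "Lm \<equiv> left_limit L"

text \<open>At t \<le> 0 a left limit would involve negative times, where processes are arbitrary; 0
  is a default.\<close>

definition Ym :: "real \<Rightarrow> 'w \<Rightarrow> real^'n" where
  "Ym t \<omega> = (if 0 < t then left_limit Y t \<omega> else 0)"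

text \<open>Change of value at claim k; \<open>payoff\<close> counts minus the penalty if the claim
  is fatal. Dividends paid at the same instant are not included.\<close>

definition jump_gain :: "nat \<Rightarrow> 'w \<Rightarrow> real" where
  "jump_gain k \<omega> = payoff (Ym (\<tau> k \<omega>) \<omega>) (U k \<omega>) - u (Ym (\<tau> k \<omega>) \<omega>)"

text \<open>Left end of the n-th interval between claims; interval 0 starts at time 0, since
  \<open>\<tau> 0\<close> is arbitrary.\<close>

definition last_claim :: "nat \<Rightarrow> 'w \<Rightarrow> real" where
  "last_claim n \<omega> = (if n = 0 then 0 else \<tau> n \<omega>)"

context
  fixes \<omega> assumes w: "\<omega> \<in> space M"
begin

lemma L_nonneg: "0 \<le> t \<Longrightarrow> 0 \<le> L t \<omega>"
  using admissible w unfolding admissible_def by blast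

lemma L_mono: "0 \<le> s \<Longrightarrow> s \<le> t \<Longrightarrow> L s \<omega> \<le> L t \<omega>"
  using admissible w unfolding admissible_def mono_on_def by auto

lemma L_right: "0 \<le> t \<Longrightarrow> ((\<lambda>s. L s \<omega>) \<longlongrightarrow> L t \<omega>) (at_right t)"
  using admissible w unfolding admissible_def by blast

lemma L_left: assumes "0 < t" shows "((\<lambda>s. L s \<omega>) \<longlongrightarrow> Lm t \<omega>) (at_left t)"
proof -
  obtain l where l: "((\<lambda>s. L s \<omega>) \<longlongrightarrow> l) (at_left t)"
    using admissible w assms unfolding admissible_def by blast
  then have "Lm t \<omega> = l" unfolding left_limit_def by (intro tendsto_Lim) auto
  then show ?thesis using l by simp
qed

lemma L_le_Lm: assumes "0 \<le> s" "s < t" shows "L s \<omega> \<le> Lm t \<omega>"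
  by (rule tendsto_vec_lower[OF L_left], use assms in simp, simp,
      rule eventually_mono[OF eventually_at_left_real[OF assms(2)]]) (use assms in \<open>auto intro!: L_mono\<close>)

lemma Lm_le_L: assumes "0 < t" shows "Lm t \<omega> \<le> L t \<omega>"
  by (rule tendsto_vec_upper[OF L_left[OF assms]], simp,
      rule eventually_mono[OF eventually_at_left_real[OF assms]]) (auto intro!: L_mono)

lemma before_ruin: "0 \<le> t \<Longrightarrow> ennreal t < \<rho> \<omega> \<Longrightarrow> 0 \<le> Y t \<omega>"
  using admissible w unfolding admissible_def controlled_surplus_def by simp

lemma after_ruin: "0 \<le> t \<Longrightarrow> \<rho> \<omega> \<le> ennreal t \<Longrightarrow> L t \<omega> = Lm (enn2real (\<rho> \<omega>)) \<omega>"
  using admissible w unfolding admissible_def by blast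

lemma ruin_le: "1 \<le> k \<Longrightarrow> \<not> 0 \<le> X (\<tau> k \<omega>) \<omega> - Lm (\<tau> k \<omega>) \<omega> \<Longrightarrow> \<rho> \<omega> \<le> ennreal (\<tau> k \<omega>)"
  unfolding ruin_time_def by (rule Inf_lower) auto

text \<open>The infimum is a minimum: claim times increase with the index, so it is reached at the
  least index of a fatal claim.\<close>

lemma ruin_attained:
  assumes "\<rho> \<omega> < \<infinity>"
  obtains k where "1 \<le> k" "\<rho> \<omega> = ennreal (\<tau> k \<omega>)" "\<not> 0 \<le> X (\<tau> k \<omega>) \<omega> - Lm (\<tau> k \<omega>) \<omega>"
proof -
  let ?P = "\<lambda>k. 1 \<le> k \<and> \<not> 0 \<le> X (\<tau> k \<omega>) \<omega> - Lm (\<tau> k \<omega>) \<omega>"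
  have "\<exists>k. ?P k"
  proof (rule ccontr)
    assume "\<nexists>k. ?P k"
    then have "{ennreal (\<tau> k \<omega>) | k. 1 \<le> k \<and> X (\<tau> k \<omega>) \<omega> - Lm (\<tau> k \<omega>) \<omega> \<notin> {0..}} = {}" by auto
    then have "\<rho> \<omega> = \<infinity>" unfolding ruin_time_def by (simp only: Inf_empty) simp
    then show False using assms by simp
  qed
  then have k: "?P (LEAST k. ?P k)" by (rule LeastI_ex)
  have "\<rho> \<omega> = ennreal (\<tau> (LEAST k. ?P k) \<omega>)"
  proof (rule antisym)
    show "\<rho> \<omega> \<le> ennreal (\<tau> (LEAST k. ?P k) \<omega>)" using k ruin_le by blast
    show "ennreal (\<tau> (LEAST k. ?P k) \<omega>) \<le> \<rho> \<omega>" unfolding ruin_time_def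
    proof (rule Inf_greatest)
      fix z assume "z \<in> {ennreal (\<tau> k \<omega>) | k. 1 \<le> k \<and> X (\<tau> k \<omega>) \<omega> - Lm (\<tau> k \<omega>) \<omega> \<notin> {0..}}"
      then obtain j where j: "z = ennreal (\<tau> j \<omega>)" "1 \<le> j" "X (\<tau> j \<omega>) \<omega> - Lm (\<tau> j \<omega>) \<omega> \<notin> {0..}" by blast
      then have "(LEAST k. ?P k) \<le> j" by (intro Least_le) auto
      then show "ennreal (\<tau> (LEAST k. ?P k) \<omega>) \<le> z" unfolding j(1) using k by (intro ennreal_leI tau_mono[OF w]) auto
    qed
  qed
  then show ?thesis using k that by blast
qed

lemma last_claim_nonneg: "0 \<le> last_claim n \<omega>"
  using tau_positive[OF w, of n] by (cases n) (auto simp: last_claim_def)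

lemma N_eq: "last_claim n \<omega> \<le> r \<Longrightarrow> r < \<tau> (Suc n) \<omega> \<Longrightarrow> N r \<omega> = n"
proof -
  assume a: "last_claim n \<omega> \<le> r" "r < \<tau> (Suc n) \<omega>"
  have "\<not> Suc n \<le> N r \<omega>" using le_N_iff[OF w, of "Suc n" r] a by simp
  moreover have "n \<le> N r \<omega>" using le_N_iff[OF w, of n r] a by (cases "n = 0") (auto simp: last_claim_def)
  ultimately show ?thesis by simp
qed

lemma claim_interval: assumes "0 < t" obtains n where "last_claim n \<omega> < t" "t \<le> \<tau> (Suc n) \<omega>"
proof -
  have "\<exists>n. t \<le> \<tau> (Suc n) \<omega>"
  proof (rule ccontr)
    assume "\<nexists>n. t \<le> \<tau> (Suc n) \<omega>"
    then have "\<tau> k \<omega> \<le> t" if "1 \<le> k" for k using that by (cases k) (auto simp: not_le intro: less_imp_le)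
    then have "{1..} \<subseteq> {k. 1 \<le> k \<and> \<tau> k \<omega> \<le> t}" by auto
    from finite_subset[OF this tau_locally_finite[OF w]] show False by (simp add: infinite_Ici)
  qed
  then have l: "t \<le> \<tau> (Suc (LEAST n. t \<le> \<tau> (Suc n) \<omega>)) \<omega>" by (rule LeastI_ex)
  have "last_claim (LEAST n. t \<le> \<tau> (Suc n) \<omega>) \<omega> < t"
  proof (cases "LEAST n. t \<le> \<tau> (Suc n) \<omega>")
    case 0 then show ?thesis using assms by (simp add: last_claim_def)
  next
    case (Suc m)
    then have "\<not> t \<le> \<tau> (Suc m) \<omega>" using not_less_Least[of m "\<lambda>n. t \<le> \<tau> (Suc n) \<omega>"] by simp
    then show ?thesis unfolding Suc by (simp add: last_claim_def)
  qed
  then show ?thesis using l that by blast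
qed

lemma Y_between:
  assumes "last_claim n \<omega> \<le> r" "r < \<tau> (Suc n) \<omega>"
  shows "Y r \<omega> = x + r *\<^sub>R p - (\<Sum>k = 1..n. U k \<omega>) - L r \<omega>"
  unfolding controlled_surplus_def surplus_def N_eq[OF assms] ..

lemma Y_left:
  assumes "last_claim n \<omega> < t" "t \<le> \<tau> (Suc n) \<omega>"
  shows "((\<lambda>r. Y r \<omega>) \<longlongrightarrow> x + t *\<^sub>R p - (\<Sum>k = 1..n. U k \<omega>) - Lm t \<omega>) (at_left t)"
proof -
  have t: "0 < t" using assms last_claim_nonneg[of n] by simp
  have "((\<lambda>r. x + r *\<^sub>R p - (\<Sum>k = 1..n. U k \<omega>) - L r \<omega>) \<longlongrightarrow> x + t *\<^sub>R p - (\<Sum>k = 1..n. U k \<omega>) - Lm t \<omega>) (at_left t)"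
    by (intro tendsto_intros L_left t)
  moreover have "\<forall>\<^sub>F r in at_left t. x + r *\<^sub>R p - (\<Sum>k = 1..n. U k \<omega>) - L r \<omega> = Y r \<omega>"
    using eventually_at_left_real[OF assms(1)] by eventually_elim (intro Y_between[symmetric], use assms(2) in auto)
  ultimately show ?thesis by (rule Lim_transform_eventually)
qed

lemma Ym_between:
  assumes "last_claim n \<omega> < t" "t \<le> \<tau> (Suc n) \<omega>"
  shows "Ym t \<omega> = x + t *\<^sub>R p - (\<Sum>k = 1..n. U k \<omega>) - Lm t \<omega>"
  using tendsto_Lim[OF _ Y_left[OF assms]] assms last_claim_nonneg[of n] by (simp add: Ym_def left_limit_def)

lemma Y_tendsto_Ym: assumes "0 < t" shows "((\<lambda>r. Y r \<omega>) \<longlongrightarrow> Ym t \<omega>) (at_left t)"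
  using claim_interval[OF assms] Y_left Ym_between by metis

lemma Ym_nonneg: assumes "0 < t" "ennreal t \<le> \<rho> \<omega>" shows "0 \<le> Ym t \<omega>"
proof (rule tendsto_vec_lower[OF Y_tendsto_Ym[OF assms(1)]])
  show "\<forall>\<^sub>F r in at_left t. 0 \<le> Y r \<omega>" using eventually_at_left_real[OF assms(1)]
  proof eventually_elim
    case (elim r)
    then have "ennreal r < ennreal t" by (simp add: ennreal_less_iff)
    then show ?case using elim assms by (intro before_ruin) auto
  qed
qed simp

lemma Y_upper: "0 \<le> t \<Longrightarrow> Y t \<omega> \<le> x + t *\<^sub>R p"
proof -
  assume "0 \<le> t"
  moreover have "0 \<le> (\<Sum>k = 1..n. U k \<omega>)" for n using U_nonneg[OF w]
    by (induction n) (auto simp: less_eq_vec_def intro!: add_nonneg_nonneg)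
  ultimately show ?thesis using L_nonneg[of t] unfolding controlled_surplus_def surplus_def
    by (simp add: less_eq_vec_def) (smt (verit))
qed

lemma Ym_upper: assumes "0 < t" shows "Ym t \<omega> \<le> x + t *\<^sub>R p"
proof (rule tendsto_vec_upper[OF Y_tendsto_Ym[OF assms]])
  show "\<forall>\<^sub>F r in at_left t. Y r \<omega> \<le> x + t *\<^sub>R p" using eventually_at_left_real[OF assms]
  proof eventually_elim
    case (elim r)
    then have "x + r *\<^sub>R p \<le> x + t *\<^sub>R p" using p_scale_mono[of r t] by (simp add: less_eq_vec_def)
    from order_trans[OF Y_upper this] elim show ?case by simp
  qed
qed simp

lemma Ym_path_measurable: "(\<lambda>t. Ym t \<omega>) \<in> borel_measurable borel"
proof (rule borel_measurable_LIMSEQ_metric)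
  fix n show "(\<lambda>t. if 0 < t then Y (grid_before 0 (1 / real (Suc n)) t) \<omega> else 0) \<in> borel_measurable borel"
    using grid_before_compose_measurable[of "\<lambda>t. Y t \<omega>"] by measurable
next
  fix t
  show "(\<lambda>n. if 0 < t then Y (grid_before 0 (1 / real (Suc n)) t) \<omega> else 0) \<longlonglongrightarrow> Ym t \<omega>"
  proof (cases "0 < t")
    case True
    have "filterlim (\<lambda>n. grid_before 0 (1 / real (Suc n)) t) (at_left t) sequentially"
      by (rule grid_before_filterlim) (use LIMSEQ_inverse_real_of_nat in \<open>auto simp: inverse_eq_divide\<close>)
    from filterlim_compose[OF Y_tendsto_Ym[OF True] this] True show ?thesis by simp
  qed (simp add: Ym_def)
qed

lemma Ym_integrable: assumes "ennreal t \<le> \<rho> \<omega>" "0 \<le> s" shows "set_integrable lborel {s<..t} (\<lambda>r. g (Ym r \<omega>))"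
proof (rule interval_integrable[OF Ym_path_measurable])
  fix r assume r: "s < r" "r \<le> t"
  then have "ennreal r \<le> \<rho> \<omega>" using assms order_trans ennreal_leI by blast
  then show "0 \<le> Ym r \<omega> \<and> Ym r \<omega> \<le> x + t *\<^sub>R p"
    using r assms Ym_nonneg[of r] Ym_upper[of r] p_scale_mono[of r t] by (auto simp: less_eq_vec_def) (smt (verit))
qed

section \<open>The undiscounted inequality along a path\<close>

lemma left_bound_step:
  assumes b: "u (Y (last_claim n \<omega>) \<omega>) + a \<bullet> L (last_claim n \<omega>) \<omega> \<le> K + (LINT r:{0<..last_claim n \<omega>}|lborel. g (Ym r \<omega>))"
    and t: "last_claim n \<omega> < t" "t \<le> \<tau> (Suc n) \<omega>" "ennreal t \<le> \<rho> \<omega>"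
  shows "u (Ym t \<omega>) + a \<bullet> Lm t \<omega> \<le> K + (LINT r:{0<..t}|lborel. g (Ym r \<omega>))"
proof -
  define s where "s = last_claim n \<omega>"
  have s: "0 \<le> s" "s < t" using last_claim_nonneg t by (auto simp: s_def)
  \<comment> \<open>At the right end t left limits replace the values, so that neither a claim nor a
    dividend paid at t itself enters.\<close>
  define D where "D r = (if r < t then L r \<omega> else Lm t \<omega>)" for r
  define y where "y r = (if r < t then Y r \<omega> else Ym t \<omega>)" for r
  have "u (y t) + a \<bullet> D t \<le> u (y s) + a \<bullet> D s + (LINT r:{s<..t}|lborel. g (Ym r \<omega>))"
  proof (rule claim_free_increment[OF s(2), where ?y0.0 = "x + s *\<^sub>R p - (\<Sum>k = 1..n. U k \<omega>)"])
    show "D r \<le> D r'" if "s \<le> r" "r \<le> r'" "r' \<le> t" for r r'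
      using that s L_mono[of r r'] L_le_Lm[of r t] by (auto simp: D_def)
    show "y r = x + s *\<^sub>R p - (\<Sum>k = 1..n. U k \<omega>) + (r - s) *\<^sub>R p - D r" if "s \<le> r" "r \<le> t" for r
      using that t Y_between[of n r] Ym_between[of n t] by (auto simp: y_def D_def s_def algebra_simps)
    show "0 \<le> y r" if "s \<le> r" "r \<le> t" for r
    proof (cases "r < t")
      case True
      then have "ennreal r < ennreal t" using that s by (simp add: ennreal_less_iff)
      then show ?thesis using True t(3) that s before_ruin[of r] by (simp add: y_def)
    next
      case False
      then show ?thesis using Ym_nonneg[of t] s t(3) by (simp add: y_def)
    qed
    show "(y \<longlongrightarrow> Ym r \<omega>) (at_left r)" if "s < r" "r \<le> t" for r
    proof (rule Lim_transform_eventually[OF Y_tendsto_Ym])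
      show "\<forall>\<^sub>F q in at_left r. Y q \<omega> = y q"
        using eventually_at_left_real[OF that(1)] by eventually_elim (use that in \<open>simp add: y_def\<close>)
    qed (use that s in simp)
  qed
  moreover have "(LINT r:{0<..t}|lborel. g (Ym r \<omega>)) = (LINT r:{0<..s}|lborel. g (Ym r \<omega>)) + (LINT r:{s<..t}|lborel. g (Ym r \<omega>))"
    by (rule interval_integral_combine[OF Ym_integrable]) (use s t in auto)
  ultimately show ?thesis using b s by (simp add: y_def D_def s_def[symmetric])
qed

lemma bound_at_claims:
  "n = 0 \<or> ennreal (\<tau> n \<omega>) < \<rho> \<omega> \<Longrightarrow>
     u (Y (last_claim n \<omega>) \<omega>) + a \<bullet> L (last_claim n \<omega>) \<omega> \<le>
     (u x + (\<Sum>k = 1..n. jump_gain k \<omega>)) + (LINT r:{0<..last_claim n \<omega>}|lborel. g (Ym r \<omega>))"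
proof (induction n)
  case 0
  have l0: "last_claim 0 \<omega> = 0" by (simp add: last_claim_def)
  have e: "Y 0 \<omega> = x - L 0 \<omega>" using Y_between[of 0 0] tau_pos[OF w] l0 by simp
  show ?case
  \<comment> \<open>Ruin happens only at claim times, which are positive, so the second case is
    void. In the first one the initial lump sum is absorbed by \<open>u_increment\<close>.\<close>
  proof (cases "ennreal 0 < \<rho> \<omega>")
    case True
    have "u (Y 0 \<omega>) + a \<bullet> L 0 \<omega> \<le> u (Y 0 \<omega> + L 0 \<omega>)"
      by (rule u_increment) (use before_ruin[OF _ True] L_nonneg[of 0] in auto)
    then show ?thesis unfolding l0 e by (simp add: set_lebesgue_integral_def)
  next
    case False
    then have "\<rho> \<omega> < \<infinity>" by (simp add: not_less le_zero_eq)
    then obtain k where "1 \<le> k" "\<rho> \<omega> = ennreal (\<tau> k \<omega>)" by (rule ruin_attained)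
    then show ?thesis using False tau_positive[OF w, of k] by simp
  qed
next
  case (Suc n)
  define t where "t = \<tau> (Suc n) \<omega>"
  have t: "ennreal t < \<rho> \<omega>" using Suc.prems by (simp add: t_def)
  have lt: "last_claim n \<omega> < t" using tau_positive[OF w, of 1] tau_increasing[OF w, of n] by (auto simp: last_claim_def t_def)
  have t0: "0 < t" using lt last_claim_nonneg[of n] by simp
  have "ennreal (\<tau> n \<omega>) < \<rho> \<omega>" if "n \<noteq> 0"
  proof -
    have "ennreal (\<tau> n \<omega>) \<le> ennreal t" using lt that by (intro ennreal_leI) (simp add: last_claim_def)
    then show ?thesis using t by simp
  qed
  then have "n = 0 \<or> ennreal (\<tau> n \<omega>) < \<rho> \<omega>" by blast
  from left_bound_step[OF Suc.IH[OF this] lt] t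
  have lb: "u (Ym t \<omega>) + a \<bullet> Lm t \<omega> \<le> (u x + (\<Sum>k = 1..n. jump_gain k \<omega>)) + (LINT r:{0<..t}|lborel. g (Ym r \<omega>))"
    by (simp add: t_def)
  have Ym: "Ym t \<omega> = x + t *\<^sub>R p - (\<Sum>k = 1..n. U k \<omega>) - Lm t \<omega>" by (rule Ym_between[OF lt]) (simp add: t_def)
  have "last_claim (Suc n) \<omega> \<le> t" "t < \<tau> (Suc (Suc n)) \<omega>" using tau_increasing[OF w, of "Suc n"] by (auto simp: last_claim_def t_def)
  \<comment> \<open>At a claim time the claim comes first and a dividend may follow. Adding this
    dividend back gives the surplus just after the claim, which is nonnegative because ruin has not
    occurred; so the claim is survived.\<close>
  from Y_between[OF this] have Yt: "Y t \<omega> + (L t \<omega> - Lm t \<omega>) = Ym t \<omega> - U (Suc n) \<omega>"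
    unfolding Ym by (simp add: algebra_simps)
  have Y0: "0 \<le> Y t \<omega>" using before_ruin t t0 by simp
  have j0: "0 \<le> L t \<omega> - Lm t \<omega>" using Lm_le_L[OF t0] by simp
  have "u (Y t \<omega>) + a \<bullet> (L t \<omega> - Lm t \<omega>) \<le> u (Ym t \<omega> - U (Suc n) \<omega>)"
    unfolding Yt[symmetric] by (rule u_increment) (use Y0 j0 in auto)
  also have "u (Ym t \<omega> - U (Suc n) \<omega>) = payoff (Ym t \<omega>) (U (Suc n) \<omega>)"
  proof -
    have "0 \<le> Y t \<omega> + (L t \<omega> - Lm t \<omega>)" using Y0 j0 by (simp add: less_eq_vec_def)
    then have "U (Suc n) \<omega> \<le> Ym t \<omega>" unfolding Yt by simp
    then show ?thesis using Ym_nonneg[OF t0] t U_nonneg[OF w, of "Suc n"] by (simp add: payoff_def)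
  qed
  finally show ?case using lb by (simp add: last_claim_def jump_gain_def t_def[symmetric] inner_diff_right)
qed

lemma bound_before:
  assumes "last_claim n \<omega> < t" "t \<le> \<tau> (Suc n) \<omega>" "ennreal t \<le> \<rho> \<omega>"
  shows "u (Ym t \<omega>) + a \<bullet> Lm t \<omega> \<le> (u x + (\<Sum>k = 1..n. jump_gain k \<omega>)) + (LINT r:{0<..t}|lborel. g (Ym r \<omega>))"
proof (rule left_bound_step[OF bound_at_claims assms])
  show "n = 0 \<or> ennreal (\<tau> n \<omega>) < \<rho> \<omega>"
  proof (cases "n = 0")
    case False
    then have "ennreal (\<tau> n \<omega>) < ennreal t" using assms(1) tau_positive[OF w, of n] by (simp add: last_claim_def ennreal_less_iff)
    then show ?thesis using order_less_le_trans[OF _ assms(3)] by blast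
  qed simp
qed

lemma bound_at:
  assumes t: "0 \<le> t" "ennreal t < \<rho> \<omega>"
  shows "u (Y t \<omega>) + a \<bullet> L t \<omega> \<le> (u x + (\<Sum>k = 1..N t \<omega>. jump_gain k \<omega>)) + (LINT r:{0<..t}|lborel. g (Ym r \<omega>))"
proof -
  define n where "n = N t \<omega>"
  have l: "last_claim n \<omega> \<le> t" using le_N_iff[OF w, of n t] t by (auto simp: last_claim_def n_def)
  have r: "t < \<tau> (Suc n) \<omega>" using le_N_iff[OF w, of "Suc n" t] by (simp add: n_def)
  show ?thesis
  \<comment> \<open>If t is a claim time or 0, the bound after that claim applies directly;
    otherwise the surplus changes at t only by the dividend paid there.\<close>
  proof (cases "last_claim n \<omega> = t")
    case True
    have "n = 0 \<or> ennreal (\<tau> n \<omega>) < \<rho> \<omega>" using True t by (auto simp: last_claim_def split: if_splits)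
    from bound_at_claims[OF this] show ?thesis unfolding True unfolding n_def .
  next
    case False
    then have lt: "last_claim n \<omega> < t" using l by simp
    have t0: "0 < t" using lt last_claim_nonneg[of n] by simp
    have e: "Y t \<omega> + (L t \<omega> - Lm t \<omega>) = Ym t \<omega>"
      using Y_between[OF l r] Ym_between[OF lt] r by simp
    have "u (Y t \<omega>) + a \<bullet> (L t \<omega> - Lm t \<omega>) \<le> u (Ym t \<omega>)"
      unfolding e[symmetric] by (rule u_increment) (use before_ruin t Lm_le_L[OF t0] in auto)
    then show ?thesis using bound_before[OF lt less_imp_le[OF r] less_imp_le[OF t(2)]] by (simp add: inner_diff_right n_def)
  qed
qed

text \<open>Ruin occurs at a claim, and from then on the dividends are frozen at their left limit.
  So nothing is paid at ruin, the drop of the surplus is the claim itself, and its payoff is minus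
  the penalty.\<close>

lemma bound_at_ruin:
  assumes "\<rho> \<omega> = ennreal t" "0 \<le> t"
  shows "- \<upsilon> (Ym t \<omega>) (Ym t \<omega> - Y t \<omega>) + a \<bullet> L t \<omega> \<le>
      (u x + (\<Sum>k = 1..N t \<omega>. jump_gain k \<omega>)) + (LINT r:{0<..t}|lborel. g (Ym r \<omega>))"
    and "(Ym t \<omega>, Ym t \<omega> - Y t \<omega>) \<in> exit_set" and "0 < t"
    and "\<exists>k\<ge>1. t = \<tau> k \<omega> \<and> Ym t \<omega> - Y t \<omega> = U k \<omega>"
proof -
  have "\<rho> \<omega> < \<infinity>" using assms by simp
  then obtain k where k: "1 \<le> k" "\<rho> \<omega> = ennreal (\<tau> k \<omega>)" "\<not> 0 \<le> X (\<tau> k \<omega>) \<omega> - Lm (\<tau> k \<omega>) \<omega>" by (rule ruin_attained)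
  obtain n where n: "k = Suc n" using k(1) by (cases k) auto
  have tk: "t = \<tau> (Suc n) \<omega>" using assms k(2) tau_positive[OF w k(1)] n by simp
  then show t0: "0 < t" using tau_positive[OF w, of "Suc n"] by simp
  have lt: "last_claim n \<omega> < t" using tau_positive[OF w, of 1] tau_increasing[OF w, of n] by (auto simp: last_claim_def tk)
  have Ym: "Ym t \<omega> = x + t *\<^sub>R p - (\<Sum>k = 1..n. U k \<omega>) - Lm t \<omega>" by (rule Ym_between[OF lt]) (simp add: tk)
  have lS: "last_claim (Suc n) \<omega> \<le> t" "t < \<tau> (Suc (Suc n)) \<omega>" using tau_increasing[OF w, of "Suc n"] by (auto simp: last_claim_def tk)
  have Nt: "N t \<omega> = Suc n" by (rule N_eq[OF lS])
  have Lt: "L t \<omega> = Lm t \<omega>" using after_ruin[of t] assms by simp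
  have jump: "Ym t \<omega> - Y t \<omega> = U (Suc n) \<omega>" using Y_between[OF lS] unfolding Ym Lt by (simp add: algebra_simps)
  then show "\<exists>k\<ge>1. t = \<tau> k \<omega> \<and> Ym t \<omega> - Y t \<omega> = U k \<omega>" using tk by (intro exI[of _ "Suc n"]) auto
  have "\<not> 0 \<le> Y t \<omega>" using k(3) Lt unfolding controlled_surplus_def tk n by simp
  moreover have "Ym t \<omega> - U (Suc n) \<omega> = Y t \<omega>" using jump by (simp add: algebra_simps)
  ultimately have nle: "\<not> U (Suc n) \<omega> \<le> Ym t \<omega>" by (metis vec_diff_nonneg)
  have Y0: "0 \<le> Ym t \<omega>" using Ym_nonneg[OF t0] assms by simp
  show "(Ym t \<omega>, Ym t \<omega> - Y t \<omega>) \<in> exit_set" unfolding jump using nle Y0 U_nonneg[OF w, of "Suc n"] by (simp add: exit_set_iff)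
  have "payoff (Ym t \<omega>) (U (Suc n) \<omega>) = - \<upsilon> (Ym t \<omega>) (U (Suc n) \<omega>)"
    using nle Y0 U_nonneg[OF w, of "Suc n"] by (simp add: payoff_def)
  then show "- \<upsilon> (Ym t \<omega>) (Ym t \<omega> - Y t \<omega>) + a \<bullet> L t \<omega> \<le>
      (u x + (\<Sum>k = 1..N t \<omega>. jump_gain k \<omega>)) + (LINT r:{0<..t}|lborel. g (Ym r \<omega>))"
    using bound_before[OF lt] assms unfolding Nt jump Lt by (simp add: jump_gain_def tk[symmetric])
qed

end

section \<open>Discounting along a path\<close>

lemma a_inner_mono: "y \<le> z \<Longrightarrow> a \<bullet> y \<le> a \<bullet> z"
  using a_inner_nonneg[of "z - y"] by (simp add: inner_diff_right)

text \<open>The minimum of \<open>v\<close> and \<open>T\<close> as a real number; the case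
  distinction keeps T = \<infinity> from being converted to 0.\<close>

definition stop_at :: "ennreal \<Rightarrow> real \<Rightarrow> real" where
  "stop_at T v = (if ennreal v \<le> T then v else enn2real T)"

lemma stop_at_nonneg: "0 \<le> v \<Longrightarrow> 0 \<le> stop_at T v"
  by (simp add: stop_at_def)

lemma stop_at_le: "0 \<le> v \<Longrightarrow> stop_at T v \<le> v"
  by (cases T) (auto simp: stop_at_def not_le ennreal_less_iff split: if_splits)

lemma stop_at_real: "0 \<le> v \<Longrightarrow> 0 \<le> e \<Longrightarrow> stop_at (ennreal e) v = min v e"
  by (auto simp: stop_at_def min_def)

lemma stop_at_mono: "0 \<le> v \<Longrightarrow> v \<le> v' \<Longrightarrow> stop_at T v \<le> stop_at T v'"
  by (cases T) (auto simp: stop_at_def top_unique)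

context
  fixes \<omega> assumes w: "\<omega> \<in> space M"
begin

lemma X_upper: "0 \<le> t \<Longrightarrow> X t \<omega> \<le> x + t *\<^sub>R p"
proof -
  have "0 \<le> (\<Sum>k = 1..n. U k \<omega>)" for n using U_nonneg[OF w]
    by (induction n) (auto simp: less_eq_vec_def intro!: add_nonneg_nonneg)
  then show ?thesis unfolding surplus_def by simp
qed

text \<open>Before ruin the dividends cannot exceed the uncontrolled surplus, and afterwards they
  are frozen at a left limit of such values. The affine bound makes the dividends integrable against
  the clock.\<close>

lemma L_upper: assumes "0 \<le> t" shows "L t \<omega> \<le> x + t *\<^sub>R p"
proof -
  have bef: "L s \<omega> \<le> x + s *\<^sub>R p" if "0 \<le> s" "ennreal s < \<rho> \<omega>" for s
    using before_ruin[OF w that] X_upper[OF that(1)] order_trans unfolding controlled_surplus_def by auto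
  show ?thesis
  proof (cases "ennreal t < \<rho> \<omega>")
    case True then show ?thesis using bef assms by simp
  next
    case False
    then have "\<rho> \<omega> < \<infinity>" by (metis ennreal_less_top infinity_ennreal_def not_less order_le_less_trans)
    then obtain k where k: "1 \<le> k" "\<rho> \<omega> = ennreal (\<tau> k \<omega>)" by (rule ruin_attained[OF w])
    define r where "r = \<tau> k \<omega>"
    have r: "0 < r" "r \<le> t" using tau_positive[OF w k(1)] False k(2) assms by (auto simp: r_def not_less)
    have Lt: "L t \<omega> = Lm r \<omega>" using after_ruin[OF w assms] False k(2) r by (simp add: not_less r_def)
    have "Lm r \<omega> \<le> x + t *\<^sub>R p"
    proof (rule tendsto_vec_upper[OF L_left[OF w r(1)]])
      show "\<forall>\<^sub>F s in at_left r. L s \<omega> \<le> x + t *\<^sub>R p" using eventually_at_left_real[OF r(1)]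
      proof eventually_elim
        case (elim s)
        then have "L s \<omega> \<le> x + s *\<^sub>R p" using k(2) by (intro bef) (auto simp: r_def ennreal_less_iff)
        also have "\<dots> \<le> x + t *\<^sub>R p" using p_scale_mono[of s t] elim r by (simp add: less_eq_vec_def)
        finally show ?case .
      qed
    qed simp
    then show ?thesis using Lt by simp
  qed
qed

lemma L_component_measurable: "(\<lambda>v. L (stop_at T (max 0 v)) \<omega> $ i) \<in> borel_measurable borel"
proof (rule borel_measurable_mono, rule monoI)
  fix v v' :: real assume "v \<le> v'"
  then have "L (stop_at T (max 0 v)) \<omega> \<le> L (stop_at T (max 0 v')) \<omega>"
    by (intro L_mono[OF w] stop_at_nonneg stop_at_mono) auto
  then show "L (stop_at T (max 0 v)) \<omega> $ i \<le> L (stop_at T (max 0 v')) \<omega> $ i" by (simp add: less_eq_vec_def)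
qed

lemma L_stop_integrable: "integrable clock (\<lambda>v. L (stop_at T (max 0 v)) \<omega> $ i)"
proof -
  interpret E: prob_space clock by (rule prob_space_clock)
  show ?thesis
  proof (rule Bochner_Integration.integrable_bound[of _ "\<lambda>v. x $ i + v * p $ i"])
    show "integrable clock (\<lambda>v. x $ i + v * p $ i)"
      by (intro Bochner_Integration.integrable_add integrable_mult_left clock_mean_integrable) auto
    have "AE v in clock. 0 < v \<and> True" by (rule AE_clock) simp
    then show "AE v in clock. norm (L (stop_at T (max 0 v)) \<omega> $ i) \<le> norm (x $ i + v * p $ i)"
    proof eventually_elim
      case (elim v)
      have "L (stop_at T (max 0 v)) \<omega> \<le> L v \<omega>" using stop_at_le[of v T] stop_at_nonneg[of v T] elim by (intro L_mono[OF w]) auto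
      moreover have "L v \<omega> \<le> x + v *\<^sub>R p" using elim by (intro L_upper) simp
      moreover have "0 \<le> L (stop_at T (max 0 v)) \<omega>" by (intro L_nonneg[OF w] stop_at_nonneg) simp
      ultimately show ?case by (simp add: less_eq_vec_def) (smt (verit, best))
    qed
  qed (use L_component_measurable in simp)
qed

text \<open>The discount factor at s is the probability that the clock value is at least s, so
  Fubini turns the Stieltjes integral of a component into the mean of its increment from 0 to the
  clock value, capped at T. The separate summand for the initial lump sum cancels the value at 0 in
  these increments.\<close>

lemma discounted_dividends_clock:
  "discounted_dividends a c L T \<omega> = (\<integral>v. a \<bullet> L (stop_at T (max 0 v)) \<omega> \<partial>clock)"
proof -
  interpret E: prob_space clock by (rule prob_space_clock)
  have comp: "(LINT s:{s. 0 < s \<and> ennreal s \<le> T}|interval_measure (\<lambda>r. L (max 0 r) \<omega> $ i). exp (- c * s)) =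
      (\<integral>v. L (stop_at T (max 0 v)) \<omega> $ i \<partial>clock) - L 0 \<omega> $ i" for i
  proof -
    define F where "F r = L (max 0 r) \<omega> $ i" for r
    have mono: "F r \<le> F r'" if "r \<le> r'" for r r'
      using L_mono[OF w, of "max 0 r" "max 0 r'"] that by (auto simp: F_def less_eq_vec_def)
    have rc: "continuous (at_right r) F" for r
    proof (cases "0 \<le> r")
      case True
      have "((\<lambda>s. L s \<omega> $ i) \<longlongrightarrow> L r \<omega> $ i) (at_right r)" by (intro tendsto_vec_nth L_right[OF w True])
      moreover have "\<forall>\<^sub>F s in at_right r. L s \<omega> $ i = F s"
        using eventually_at_right_less[of r] by eventually_elim (use True in \<open>simp add: F_def\<close>)
      ultimately have "(F \<longlongrightarrow> L r \<omega> $ i) (at_right r)" by (rule Lim_transform_eventually)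
      then show ?thesis using True by (simp add: continuous_within F_def)
    next
      case False
      have "\<forall>\<^sub>F s in at_right r. F r = F s"
        using eventually_at_right_real[of r 0] False by (auto simp: F_def elim!: eventually_mono)
      then show ?thesis unfolding continuous_within by (rule Lim_transform_eventually[OF tendsto_const])
    qed
    define I where "I = interval_measure F"
    interpret I: sigma_finite_measure I unfolding I_def by (rule sigma_finite_interval_measure[OF mono rc])
    interpret Pr: pair_sigma_finite I clock ..
    have sI [simp, measurable_cong]: "sets I = sets borel" by (simp add: I_def)
    define A where "A = {s. 0 < s \<and> ennreal s \<le> T}"
    have A [measurable]: "A \<in> sets borel" unfolding A_def by measurable
    \<comment> \<open>Being within the limit T and not beyond v means lying in the interval up to
      \<open>stop_at T v\<close>, whose mass under the interval measure is an increment of the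
      path.\<close>
    have cut: "indicator A s * (if s \<le> v then 1 else 0 :: ennreal) = indicator {0<..stop_at T v} s" if "0 < v" for s v :: real
    proof -
      have "s \<in> A \<and> s \<le> v \<longleftrightarrow> 0 < s \<and> s \<le> stop_at T v"
      proof (cases T)
        case (real r)
        then show ?thesis using that by (auto simp: A_def stop_at_def not_le)
      next
        case top
        then show ?thesis using that by (auto simp: A_def stop_at_def)
      qed
      then show ?thesis by (auto simp: indicator_def)
    qed
    have "(\<integral>\<^sup>+ s. ennreal (indicator A s * exp (- c * s)) \<partial>I) = (\<integral>\<^sup>+ s. \<integral>\<^sup>+ v. indicator A s * (if s \<le> v then 1 else 0) \<partial>clock \<partial>I)"
    proof (rule nn_integral_cong)
      fix s
      have "(\<integral>\<^sup>+ v. indicator A s * (if s \<le> v then 1 else 0) \<partial>clock) = indicator A s * emeasure clock {s..}"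
      proof -
        have "indicator A s * (if s \<le> v then 1 else 0 :: ennreal) = indicator A s * indicator {s..} v" for v
          by (simp add: indicator_def)
        then show ?thesis by (simp add: nn_integral_cmult_indicator)
      qed
      also have "\<dots> = ennreal (indicator A s * exp (- c * s))"
        using clock_tail[of s] by (auto simp: indicator_def A_def E.emeasure_eq_measure)
      finally show "ennreal (indicator A s * exp (- c * s)) = (\<integral>\<^sup>+ v. indicator A s * (if s \<le> v then 1 else 0) \<partial>clock)" ..
    qed
    also have "\<dots> = (\<integral>\<^sup>+ v. \<integral>\<^sup>+ s. indicator A s * (if s \<le> v then 1 else 0) \<partial>I \<partial>clock)"
      by (rule Pr.Fubini'[symmetric]) measurable
    also have "\<dots> = (\<integral>\<^sup>+ v. ennreal (L (stop_at T (max 0 v)) \<omega> $ i - L 0 \<omega> $ i) \<partial>clock)"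
    proof (rule nn_integral_cong_AE)
      have "AE v in clock. 0 < v \<and> True" by (rule AE_clock) simp
      then show "AE v in clock. (\<integral>\<^sup>+ s. indicator A s * (if s \<le> v then 1 else 0) \<partial>I) = ennreal (L (stop_at T (max 0 v)) \<omega> $ i - L 0 \<omega> $ i)"
      proof eventually_elim
        case (elim v)
        have "(\<integral>\<^sup>+ s. indicator A s * (if s \<le> v then 1 else 0) \<partial>I) = emeasure I {0<..stop_at T v}"
          using elim by (simp add: cut)
        also have "\<dots> = ennreal (F (stop_at T v) - F 0)"
          unfolding I_def using stop_at_nonneg[of v T] elim by (intro emeasure_interval_measure_Ioc mono rc) auto
        finally show ?case using elim stop_at_nonneg[of v T] by (simp add: F_def)
      qed
    qed
    finally have nn: "(\<integral>\<^sup>+ s. ennreal (indicator A s * exp (- c * s)) \<partial>I) =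
      (\<integral>\<^sup>+ v. ennreal (L (stop_at T (max 0 v)) \<omega> $ i - L 0 \<omega> $ i) \<partial>clock)" .
    have "(LINT s:A|I. exp (- c * s)) = enn2real (\<integral>\<^sup>+ s. ennreal (indicator A s * exp (- c * s)) \<partial>I)"
      unfolding set_lebesgue_integral_def by (subst integral_eq_nn_integral) auto
    also have "\<dots> = (\<integral>v. L (stop_at T (max 0 v)) \<omega> $ i - L 0 \<omega> $ i \<partial>clock)"
      unfolding nn
    proof (subst integral_eq_nn_integral)
      show "AE v in clock. 0 \<le> L (stop_at T (max 0 v)) \<omega> $ i - L 0 \<omega> $ i"
        using L_mono[OF w, of 0] stop_at_nonneg by (intro AE_I2) (auto simp: less_eq_vec_def)
      show "(\<lambda>v. L (stop_at T (max 0 v)) \<omega> $ i - L 0 \<omega> $ i) \<in> borel_measurable clock"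
        using L_component_measurable by simp
    qed simp
    also have "\<dots> = (\<integral>v. L (stop_at T (max 0 v)) \<omega> $ i \<partial>clock) - L 0 \<omega> $ i"
      by (subst Bochner_Integration.integral_diff[OF L_stop_integrable]) (auto simp: E.prob_space[simplified])
    finally show ?thesis by (simp add: I_def F_def[abs_def] A_def)
  qed
  show ?thesis
    unfolding discounted_dividends_def comp inner_vec_def
    by (subst Bochner_Integration.integral_sum)
       (auto intro!: integrable_mult_right L_stop_integrable simp: right_diff_distrib sum_subtractf)
qed

text \<open>Claim times and jumps of monotone paths are countable, so the clock, having a density,
  misses them almost surely.\<close>

lemma AE_no_jump: "AE v in lborel. 0 < v \<longrightarrow> (\<forall>k\<ge>1. v \<noteq> \<tau> k \<omega>) \<and> Lm v \<omega> = L v \<omega>"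
proof -
  define F where "F i r = L (max 0 r) \<omega> $ i" for i r
  define B where "B = range (\<lambda>k. \<tau> k \<omega>) \<union> (\<Union>i. {v. \<not> isCont (F i) v})"
  have mono: "mono (F i)" for i
    by (rule monoI) (use L_mono[OF w] in \<open>auto simp: F_def less_eq_vec_def\<close>)
  have "countable B" unfolding B_def using mono_ctble_discont[OF mono] by (intro countable_Un countable_UN) auto
  then have "AE v in lborel. v \<notin> B" by (intro AE_not_in countable_imp_null_set_lborel)
  then show ?thesis
  proof eventually_elim
    case (elim v)
    show ?case
    proof (intro impI conjI)
      assume v: "0 < v"
      show "\<forall>k\<ge>1. v \<noteq> \<tau> k \<omega>" using elim by (auto simp: B_def)
      show "Lm v \<omega> = L v \<omega>"
      proof (rule vec_eq_iff[THEN iffD2], rule allI)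
        fix i
        have "isCont (F i) v" using elim by (auto simp: B_def)
        then have "(F i \<longlongrightarrow> F i v) (at v)" by (simp add: isCont_def)
        then have l: "(F i \<longlongrightarrow> F i v) (at_left v)" by (rule tendsto_mono[rotated]) (simp add: at_le)
        have "((\<lambda>s. L s \<omega> $ i) \<longlongrightarrow> Lm v \<omega> $ i) (at_left v)" by (intro tendsto_vec_nth L_left[OF w v])
        moreover have "\<forall>\<^sub>F s in at_left v. L s \<omega> $ i = F i s"
          using eventually_at_left_real[OF v] by eventually_elim (simp add: F_def)
        ultimately have "(F i \<longlongrightarrow> Lm v \<omega> $ i) (at_left v)" by (rule Lim_transform_eventually)
        from tendsto_unique[OF _ this l] show "Lm v \<omega> $ i = L v \<omega> $ i" using v by (simp add: F_def)
      qed
    qed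
  qed
qed

text \<open>Averages undiscounted bounds over the clock value v: for v < e the bound just before v,
  for v > e the assumed bound at the end time. The terminal value \<open>E\<close> is left open so
  as to cover switching, ruin and the horizon alike. The mean of \<open>u\<close> at clock values
  before e is the integral of c exp (-c s) u and is moved to the right-hand side.\<close>

lemma discounted_bound:
  assumes e: "0 \<le> e" "ennreal e \<le> \<rho> \<omega>"
    and End: "E + a \<bullet> L e \<omega> \<le> (u x + (\<Sum>k = 1..N e \<omega>. jump_gain k \<omega>)) + (LINT r:{0<..e}|lborel. g (Ym r \<omega>))"
  shows "discounted_dividends a c L (ennreal e) \<omega> + exp (- c * e) * E \<le>
    u x + (\<Sum>k = 1..N e \<omega>. exp (- c * \<tau> k \<omega>) * jump_gain k \<omega>) +
    (LINT s:{0<..e}|lborel. exp (- c * s) * (g (Ym s \<omega>) - c * u (Ym s \<omega>)))"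
proof -
  interpret Cl: prob_space clock by (rule prob_space_clock)
  define uu where "uu z = (if 0 \<le> z then u z else 0)" for z
  have uu: "uu \<in> borel_measurable borel" unfolding uu_def[abs_def] by (rule u_indicator_measurable)
  have Ym0: "0 \<le> Ym v \<omega>" "Ym v \<omega> \<le> x + e *\<^sub>R p" if "0 < v" "v \<le> e" for v
  proof -
    have "ennreal v \<le> \<rho> \<omega>" using that e(2) order_trans ennreal_leI by blast
    then show "0 \<le> Ym v \<omega>" by (rule Ym_nonneg[OF w that(1)])
    have "x + v *\<^sub>R p \<le> x + e *\<^sub>R p" using p_scale_mono[OF that(2)] by (simp add: less_eq_vec_def)
    then show "Ym v \<omega> \<le> x + e *\<^sub>R p" using Ym_upper[OF w that(1)] order_trans by blast
  qed
  define h where "h v = uu (Ym v \<omega>)" for v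
  have hm: "h \<in> borel_measurable borel" unfolding h_def using measurable_compose[OF Ym_path_measurable[OF w] uu] .
  have hu: "h v = u (Ym v \<omega>)" if "0 < v" "v \<le> e" for v using Ym0[OF that] by (simp add: h_def uu_def)
  have hb: "\<bar>indicator {0<..e} v * h v\<bar> \<le> \<bar>u 0\<bar> + \<bar>u (x + e *\<^sub>R p)\<bar>" for v
    using u_box_bound[OF Ym0, of v] hu[of v] by (auto simp: indicator_def)
  \<comment> \<open>The two sides of the pathwise bound as functions of the clock value;
    \<open>h\<close> is \<open>u\<close> along the path, set to 0 off the orthant so as to be
    measurable.\<close>
  define \<phi> where "\<phi> v = indicator {0<..e} v * h v + E * indicator {e..} v + a \<bullet> L (stop_at (ennreal e) (max 0 v)) \<omega>" for v
  define \<psi> where "\<psi> v = u x + (\<Sum>k = 1..N e \<omega>. jump_gain k \<omega> * indicator {\<tau> k \<omega>..} v) + (LINT s:{0<..min v e}|lborel. g (Ym s \<omega>))" for v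
  have gi: "set_integrable lborel {0<..e} (\<lambda>r. g (Ym r \<omega>))" by (rule Ym_integrable[OF w e(2)]) simp
  have hi: "integrable clock (\<lambda>v. indicator {0<..e} v * h v)"
    by (rule Cl.integrable_const_bound[of _ "\<bar>u 0\<bar> + \<bar>u (x + e *\<^sub>R p)\<bar>"]) (use hb hm in auto)
  have ii: "integrable clock (indicator {s..} :: real \<Rightarrow> real)" for s
    by (rule Cl.integrable_const_bound[of _ 1]) (auto simp: indicator_def)
  have Li: "integrable clock (\<lambda>v. a \<bullet> L (stop_at (ennreal e) (max 0 v)) \<omega>)"
    unfolding inner_vec_def by (intro Bochner_Integration.integrable_sum) (auto intro!: integrable_mult_right L_stop_integrable)
  have \<phi>i: "integrable clock \<phi>" unfolding \<phi>_def
    by (intro Bochner_Integration.integrable_add hi Li integrable_mult_right ii)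
  have \<psi>i: "integrable clock \<psi>" unfolding \<psi>_def
    by (intro Bochner_Integration.integrable_add Bochner_Integration.integrable_sum integrable_mult_right ii clock_fubini(1)[OF gi]) auto
  have tauN: "\<tau> k \<omega> \<le> e" if "k \<in> {1..N e \<omega>}" for k using le_N_iff[OF w, of k e] that by simp
  have "AE v in clock. 0 < v \<and> (v \<noteq> e \<and> (\<forall>k\<ge>1. v \<noteq> \<tau> k \<omega>) \<and> Lm v \<omega> = L v \<omega>)"
    by (rule AE_clock) (use AE_no_jump AE_lborel_singleton[of e] in \<open>eventually_elim, auto\<close>)
  then have "AE v in clock. \<phi> v \<le> \<psi> v"
  proof eventually_elim
    case (elim v)
    show ?case
    proof (cases "v < e")
      case True
      have vr: "ennreal v \<le> \<rho> \<omega>" using True e(2) order_trans ennreal_leI less_imp_le by metis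
      obtain n where n: "last_claim n \<omega> < v" "v \<le> \<tau> (Suc n) \<omega>" using claim_interval[OF w] elim by blast
      have "v \<noteq> \<tau> (Suc n) \<omega>" using elim by simp
      then have nv: "v < \<tau> (Suc n) \<omega>" using n(2) by simp
      have Nv: "N v \<omega> = n" by (rule N_eq[OF w less_imp_le[OF n(1)] nv])
      have "N v \<omega> \<le> N e \<omega>" using elim True by (intro N_mono[OF w]) auto
      then have sub: "{1..n} \<subseteq> {1..N e \<omega>}" unfolding Nv by auto
      have "(\<Sum>k = 1..N e \<omega>. jump_gain k \<omega> * indicator {\<tau> k \<omega>..} v) = (\<Sum>k = 1..n. jump_gain k \<omega> * indicator {\<tau> k \<omega>..} v)"
      proof (rule sum.mono_neutral_right[OF _ sub])
        show "\<forall>k\<in>{1..N e \<omega>} - {1..n}. jump_gain k \<omega> * indicator {\<tau> k \<omega>..} v = 0"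
          using le_N_iff[OF w, of _ v] Nv by (auto simp: indicator_def)
      qed simp
      also have "\<dots> = (\<Sum>k = 1..n. jump_gain k \<omega>)"
        by (rule sum.cong[OF refl]) (use le_N_iff[OF w, of _ v] Nv in \<open>auto simp: indicator_def\<close>)
      finally have s: "(\<Sum>k = 1..N e \<omega>. jump_gain k \<omega> * indicator {\<tau> k \<omega>..} v) = (\<Sum>k = 1..n. jump_gain k \<omega>)" .
      have "\<phi> v = u (Ym v \<omega>) + a \<bullet> Lm v \<omega>"
        unfolding \<phi>_def using True elim hu[of v] stop_at_real[of v e] e(1) by (simp add: max_def)
      also have "\<dots> \<le> \<psi> v" unfolding \<psi>_def s using bound_before[OF w n vr] True by (simp add: min_def)
      finally show ?thesis .
    next
      case False
      then have ve: "e < v" using elim by simp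
      have "(\<Sum>k = 1..N e \<omega>. jump_gain k \<omega> * indicator {\<tau> k \<omega>..} v) = (\<Sum>k = 1..N e \<omega>. jump_gain k \<omega>)"
      proof (rule sum.cong[OF refl])
        fix k assume "k \<in> {1..N e \<omega>}"
        from tauN[OF this] ve show "jump_gain k \<omega> * indicator {\<tau> k \<omega>..} v = jump_gain k \<omega>" by (simp add: indicator_def)
      qed
      then have "\<psi> v = (u x + (\<Sum>k = 1..N e \<omega>. jump_gain k \<omega>)) + (LINT r:{0<..e}|lborel. g (Ym r \<omega>))"
        unfolding \<psi>_def using ve by (simp add: min_def)
      moreover have "\<phi> v = E + a \<bullet> L e \<omega>"
        unfolding \<phi>_def using ve elim stop_at_real[of v e] e(1) by (simp add: max_def min_def)
      ultimately show ?thesis using End by simp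
    qed
  qed
  then have main: "integral\<^sup>L clock \<phi> \<le> integral\<^sup>L clock \<psi>" by (rule integral_mono_AE[OF \<phi>i \<psi>i])
  have im: "(\<integral>v. indicator {s..} v \<partial>clock) = exp (- c * s)" if "0 \<le> s" for s
    using clock_tail[OF that] by simp
  have "integral\<^sup>L clock \<phi> = (\<integral>v. indicator {0<..e} v * h v \<partial>clock) + E * (\<integral>v. indicator {e..} v \<partial>clock) + discounted_dividends a c L (ennreal e) \<omega>"
    unfolding \<phi>_def discounted_dividends_clock
    by (subst Bochner_Integration.integral_add, (intro Bochner_Integration.integrable_add hi Li integrable_mult_right ii)+)
       (subst Bochner_Integration.integral_add, (intro Bochner_Integration.integrable_add hi Li integrable_mult_right ii)+, simp)
  also have "(\<integral>v. indicator {0<..e} v * h v \<partial>clock) = (LINT s:{0<..e}|lborel. c * exp (- c * s) * h s)" by (rule clock_integral[OF hm])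
  finally have i\<phi>: "integral\<^sup>L clock \<phi> = (LINT s:{0<..e}|lborel. c * exp (- c * s) * h s) + E * exp (- c * e) + discounted_dividends a c L (ennreal e) \<omega>"
    unfolding im[OF e(1)] .
  have "integral\<^sup>L clock \<psi> = u x + (\<integral>v. (\<Sum>k = 1..N e \<omega>. jump_gain k \<omega> * indicator {\<tau> k \<omega>..} v) \<partial>clock) + (\<integral>v. (LINT s:{0<..min v e}|lborel. g (Ym s \<omega>)) \<partial>clock)"
    unfolding \<psi>_def
    by (subst Bochner_Integration.integral_add, (intro Bochner_Integration.integrable_add Bochner_Integration.integrable_sum integrable_mult_right ii clock_fubini(1)[OF gi] Cl.integrable_const)+)
       (subst Bochner_Integration.integral_add, (intro Bochner_Integration.integrable_add Bochner_Integration.integrable_sum integrable_mult_right ii Cl.integrable_const)+, simp add: Cl.prob_space[simplified])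
  also have "(\<integral>v. (\<Sum>k = 1..N e \<omega>. jump_gain k \<omega> * indicator {\<tau> k \<omega>..} v) \<partial>clock) = (\<Sum>k = 1..N e \<omega>. exp (- c * \<tau> k \<omega>) * jump_gain k \<omega>)"
  proof (subst Bochner_Integration.integral_sum)
    show "(\<Sum>k = 1..N e \<omega>. \<integral>v. jump_gain k \<omega> * indicator {\<tau> k \<omega>..} v \<partial>clock) = (\<Sum>k = 1..N e \<omega>. exp (- c * \<tau> k \<omega>) * jump_gain k \<omega>)"
    proof (rule sum.cong[OF refl])
      fix k assume "k \<in> {1..N e \<omega>}"
      then have "0 \<le> \<tau> k \<omega>" using tau_positive[OF w, of k] by simp
      then show "(\<integral>v. jump_gain k \<omega> * indicator {\<tau> k \<omega>..} v \<partial>clock) = exp (- c * \<tau> k \<omega>) * jump_gain k \<omega>"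
        using clock_tail[of "\<tau> k \<omega>"] by simp
    qed
  qed (intro integrable_mult_right ii)
  also have "(\<integral>v. (LINT s:{0<..min v e}|lborel. g (Ym s \<omega>)) \<partial>clock) = (LINT s:{0<..e}|lborel. exp (- c * s) * g (Ym s \<omega>))"
    by (rule clock_fubini(2)[OF gi])
  finally have i\<psi>: "integral\<^sup>L clock \<psi> = u x + (\<Sum>k = 1..N e \<omega>. exp (- c * \<tau> k \<omega>) * jump_gain k \<omega>) + (LINT s:{0<..e}|lborel. exp (- c * s) * g (Ym s \<omega>))" .
  have expb: "\<bar>exp (- c * s)\<bar> \<le> 1" if "0 < s" for s using that c_pos by simp
  have I1: "set_integrable lborel {0<..e} (\<lambda>s. exp (- c * s) * g (Ym s \<omega>))"
    unfolding set_integrable_def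
  proof (rule Bochner_Integration.integrable_bound[OF gi[unfolded set_integrable_def]])
    have "(\<lambda>s. exp (- c * s) * (indicator {0<..e} s *\<^sub>R g (Ym s \<omega>))) \<in> borel_measurable lborel"
      using borel_measurable_integrable[OF gi[unfolded set_integrable_def]] by measurable
    then show "(\<lambda>s. indicator {0<..e} s *\<^sub>R (exp (- c * s) * g (Ym s \<omega>))) \<in> borel_measurable lborel" by (simp add: ac_simps)
    show "AE s in lborel. norm (indicator {0<..e} s *\<^sub>R (exp (- c * s) * g (Ym s \<omega>))) \<le> norm (indicator {0<..e} s *\<^sub>R g (Ym s \<omega>))"
      using expb by (intro AE_I2) (auto simp: indicator_def abs_mult intro!: mult_left_le_one_le)
  qed
  have I2: "set_integrable lborel {0<..e} (\<lambda>s. c * exp (- c * s) * h s)"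
    unfolding set_integrable_def
  proof (rule Bochner_Integration.integrable_bound[of _ "\<lambda>s. indicator {0<..e} s * (c * (\<bar>u 0\<bar> + \<bar>u (x + e *\<^sub>R p)\<bar>))"])
    show "integrable lborel (\<lambda>s. indicator {0<..e} s * (c * (\<bar>u 0\<bar> + \<bar>u (x + e *\<^sub>R p)\<bar>)))" using e(1) by auto
    show "(\<lambda>s. indicator {0<..e} s *\<^sub>R (c * exp (- c * s) * h s)) \<in> borel_measurable lborel" using hm by measurable
    show "AE s in lborel. norm (indicator {0<..e} s *\<^sub>R (c * exp (- c * s) * h s)) \<le> norm (indicator {0<..e} s * (c * (\<bar>u 0\<bar> + \<bar>u (x + e *\<^sub>R p)\<bar>)))"
    proof (rule AE_I2)
      fix s
      show "norm (indicator {0<..e} s *\<^sub>R (c * exp (- c * s) * h s)) \<le> norm (indicator {0<..e} s * (c * (\<bar>u 0\<bar> + \<bar>u (x + e *\<^sub>R p)\<bar>)))"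
      proof (cases "s \<in> {0<..e}")
        case True
        then have "exp (- c * s) * \<bar>h s\<bar> \<le> 1 * (\<bar>u 0\<bar> + \<bar>u (x + e *\<^sub>R p)\<bar>)"
          using hb[of s] expb[of s] by (intro mult_mono) auto
        then show ?thesis using True c_pos by (simp add: abs_mult mult.assoc)
      qed simp
    qed
  qed
  have "(LINT s:{0<..e}|lborel. exp (- c * s) * (g (Ym s \<omega>) - c * u (Ym s \<omega>))) =
      (LINT s:{0<..e}|lborel. exp (- c * s) * g (Ym s \<omega>) - c * exp (- c * s) * h s)"
    unfolding set_lebesgue_integral_def
    by (rule Bochner_Integration.integral_cong[OF refl]) (auto simp: indicator_def hu algebra_simps)
  also have "\<dots> = (LINT s:{0<..e}|lborel. exp (- c * s) * g (Ym s \<omega>)) - (LINT s:{0<..e}|lborel. c * exp (- c * s) * h s)"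
    by (rule set_integral_diff(2)[OF I1 I2])
  finally show ?thesis using main unfolding i\<phi> i\<psi> by (simp add: mult.commute)
qed
end

section \<open>Measurability of the surplus, the ruin time and the dividends\<close>

lemma Y_adapted: "0 \<le> t \<Longrightarrow> Y t \<in> borel_measurable (claims_upto (ennreal t))"
  using admissible surplus_adapted[of t x] unfolding admissible_def controlled_surplus_def[abs_def] by auto

lemma Ym_predictable [measurable]: "(\<lambda>z. Ym (fst (snd z)) (fst z)) \<in> borel_measurable predictable"
proof (rule borel_measurable_LIMSEQ_metric)
  fix n show "(\<lambda>z. Y (grid_before 0 (1 / real (Suc n)) (fst (snd z))) (fst z)) \<in> borel_measurable predictable"
    by (rule predictable_step[OF Y_adapted]) auto
next
  fix z assume z: "z \<in> space predictable"
  have "filterlim (\<lambda>n. grid_before 0 (1 / real (Suc n)) (fst (snd z))) (at_left (fst (snd z))) sequentially"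
    by (rule grid_before_filterlim) (use LIMSEQ_inverse_real_of_nat in \<open>auto simp: inverse_eq_divide\<close>)
  from filterlim_compose[OF Y_tendsto_Ym this] z
  show "(\<lambda>n. Y (grid_before 0 (1 / real (Suc n)) (fst (snd z))) (fst z)) \<longlonglongrightarrow> Ym (fst (snd z)) (fst z)" by auto
qed

text \<open>Rational times suffice, since a negative surplus stays negative for a short time after ruin.\<close>

lemma ruin_before_iff:
  assumes w: "\<omega> \<in> space M"
  shows "\<rho> \<omega> < ennreal s \<longleftrightarrow> (\<exists>q\<in>\<rat>. 0 \<le> q \<and> q < s \<and> \<not> 0 \<le> Y q \<omega>)"
proof
  assume "\<exists>q\<in>\<rat>. 0 \<le> q \<and> q < s \<and> \<not> 0 \<le> Y q \<omega>"
  then obtain q where q: "0 \<le> q" "q < s" "\<not> 0 \<le> Y q \<omega>" by blast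
  then have "\<rho> \<omega> \<le> ennreal q" using before_ruin[OF w q(1)] by (meson not_le)
  also have "\<dots> < ennreal s" using q by (simp add: ennreal_less_iff)
  finally show "\<rho> \<omega> < ennreal s" .
next
  assume lt: "\<rho> \<omega> < ennreal s"
  then have "\<rho> \<omega> < \<infinity>" using order_less_le_trans by fastforce
  then obtain k where k: "1 \<le> k" "\<rho> \<omega> = ennreal (\<tau> k \<omega>)" by (rule ruin_attained[OF w])
  define r where "r = \<tau> k \<omega>"
  have r: "0 < r" "r < s" "\<rho> \<omega> = ennreal r" using tau_positive[OF w k(1)] lt k(2) by (auto simp: r_def ennreal_less_iff)
  have ex: "(Ym r \<omega>, Ym r \<omega> - Y r \<omega>) \<in> exit_set" using bound_at_ruin(2)[OF w r(3)] r(1) by simp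
  then have "\<not> 0 \<le> Y r \<omega>" by (auto simp: exit_set_iff less_eq_vec_def)
  then obtain i where i: "Y r \<omega> $ i < 0" by (auto simp: less_eq_vec_def not_le)
  \<comment> \<open>Between ruin and b no further claim occurs, the drift does not make up the
    deficit in coordinate i, and dividends are frozen; every time in between still shows a negative
    surplus.\<close>
  define b where "b = min (min s (\<tau> (Suc k) \<omega>)) (r - Y r \<omega> $ i / p $ i)"
  have "Y r \<omega> $ i / p $ i < 0" using i p_pos[of i] by (simp add: divide_neg_pos)
  then have "r < b" using r tau_increasing[OF w k(1)] by (auto simp: b_def r_def)
  then obtain q where q: "q \<in> \<rat>" "r < q" "q < b" using Rats_dense_in_real by blast
  have lk: "last_claim k \<omega> = r" using k(1) by (simp add: last_claim_def r_def)
  have L: "L q \<omega> = L r \<omega>" using after_ruin[OF w, of q] after_ruin[OF w, of r] r q(2) by (simp add: ennreal_leI)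
  have Yq: "Y q \<omega> = x + q *\<^sub>R p - (\<Sum>k = 1..k. U k \<omega>) - L q \<omega>"
    by (rule Y_between[OF w]) (use q in \<open>auto simp: lk b_def\<close>)
  have Yr: "Y r \<omega> = x + r *\<^sub>R p - (\<Sum>k = 1..k. U k \<omega>) - L r \<omega>"
    by (rule Y_between[OF w]) (use tau_increasing[OF w k(1)] in \<open>auto simp: lk r_def\<close>)
  have "Y q \<omega> = Y r \<omega> + (q - r) *\<^sub>R p" unfolding Yq Yr L by (simp add: algebra_simps)
  moreover have "(q - r) * p $ i < - Y r \<omega> $ i" using q(3) p_pos[of i] by (simp add: b_def field_simps)
  ultimately have "Y q \<omega> $ i < 0" by simp
  then have "\<not> 0 \<le> Y q \<omega>" by (auto simp: less_eq_vec_def not_le)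
  then show "\<exists>q\<in>\<rat>. 0 \<le> q \<and> q < s \<and> \<not> 0 \<le> Y q \<omega>" using q r by (intro bexI[of _ q]) (auto simp: b_def)
qed

lemma Y_exit_event: "0 \<le> q \<Longrightarrow> {\<omega> \<in> space M. \<not> 0 \<le> Y q \<omega>} \<in> sets (claims_upto (ennreal q))"
proof -
  assume "0 \<le> q"
  note [measurable] = Y_adapted[OF this]
  have "{\<omega> \<in> space (claims_upto (ennreal q)). Y q \<omega> \<notin> {0..}} \<in> sets (claims_upto (ennreal q))" by measurable
  then show ?thesis by simp
qed

lemma ruin_predictable: "{z \<in> space predictable. ennreal (fst (snd z)) \<le> \<rho> (fst z)} \<in> sets predictable"
proof -
  have "{z \<in> space predictable. ennreal (fst (snd z)) \<le> \<rho> (fst z)} = space predictable -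
    {z \<in> space predictable. \<exists>q\<in>\<rat>. 0 \<le> q \<and> q < fst (snd z) \<and> fst z \<in> {\<omega> \<in> space M. \<not> 0 \<le> Y q \<omega>}}"
    using ruin_before_iff by (auto simp: not_less[symmetric])
  also have "\<dots> \<in> sets predictable" by (intro sets.Diff sets.top predictable_set Y_exit_event)
  finally show ?thesis .
qed

lemma ruin_measurable [measurable]: "\<rho> \<in> borel_measurable M"
proof (rule borel_measurableI_less)
  fix y :: ennreal
  have r: "{\<omega> \<in> space M. \<rho> \<omega> < ennreal s} \<in> sets M" for s
  proof -
    have "{\<omega> \<in> space M. \<rho> \<omega> < ennreal s} = (\<Union>q\<in>{q\<in>\<rat>. 0 \<le> q \<and> q < s}. {\<omega> \<in> space M. \<not> 0 \<le> Y q \<omega>})"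
      using ruin_before_iff by auto
    also have "\<dots> \<in> sets M"
      by (intro sets.countable_UN'' countable_subset[OF _ countable_rat] subsetD[OF claims_upto_sets Y_exit_event]) auto
    finally show ?thesis .
  qed
  show "{\<omega> \<in> space M. \<rho> \<omega> < y} \<in> sets M"
  proof (cases y)
    case (real s) then show ?thesis using r by simp
  next
    case top
    have "{\<omega> \<in> space M. \<rho> \<omega> < y} = (\<Union>n::nat. {\<omega> \<in> space M. \<rho> \<omega> < ennreal (real n)})"
    proof safe
      fix \<omega> assume "\<rho> \<omega> < y"
      then obtain n :: nat where "\<rho> \<omega> < of_nat n" using ennreal_Ex_less_of_nat top by blast
      moreover assume "\<omega> \<in> space M"
      ultimately show "\<omega> \<in> (\<Union>n::nat. {\<omega> \<in> space M. \<rho> \<omega> < ennreal (real n)})"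
        by (auto simp: ennreal_of_nat_eq_real_of_nat)
    qed (auto simp: top intro: order_less_le_trans)
    also have "\<dots> \<in> sets M" using r by blast
    finally show ?thesis .
  qed
qed

text \<open>Time is rounded up to a strictly later point of a countable grid, and right continuity
  of the paths passes joint measurability to the limit.\<close>

lemma L_joint: "(\<lambda>z. L (max 0 (snd z)) (fst z)) \<in> borel_measurable (M \<Otimes>\<^sub>M borel)"
proof (rule borel_measurable_LIMSEQ_metric)
  fix n
  have "(\<lambda>z. \<lfloor>max 0 (snd z) * real (Suc n)\<rfloor>) \<in> measurable (M \<Otimes>\<^sub>M (borel :: real measure)) (count_space UNIV)" by measurable
  moreover have "(\<lambda>z. L (max 0 ((of_int j + 1) / real (Suc n))) (fst z)) \<in> borel_measurable (M \<Otimes>\<^sub>M (borel :: real measure))" for j :: int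
  proof -
    have "L s \<in> borel_measurable M" if "0 \<le> s" for s
      by (rule claims_upto_measurable[of _ "ennreal s"]) (use admissible that in \<open>simp add: admissible_def\<close>)
    note [measurable] = this[OF max.cobounded1]
    then show ?thesis by measurable
  qed
  ultimately show "(\<lambda>z. L (max 0 ((of_int \<lfloor>max 0 (snd z) * real (Suc n)\<rfloor> + 1) / real (Suc n))) (fst z)) \<in> borel_measurable (M \<Otimes>\<^sub>M borel)"
    by (rule measurable_compose_countable[rotated])
next
  fix z :: "'w \<times> real" assume "z \<in> space (M \<Otimes>\<^sub>M borel)"
  then have w: "fst z \<in> space M" by (auto simp: space_pair_measure)
  define t where "t = max 0 (snd z)"
  define q where "q n = (of_int \<lfloor>t * real (Suc n)\<rfloor> + 1) / real (Suc n)" for n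
  have q: "t < q n" "q n \<le> t + 1 / real (Suc n)" for n
  proof -
    have "t * real (Suc n) < of_int \<lfloor>t * real (Suc n)\<rfloor> + 1" by linarith
    then show "t < q n" by (simp add: q_def pos_less_divide_eq del: of_nat_Suc)
    have "of_int \<lfloor>t * real (Suc n)\<rfloor> + 1 \<le> (t + 1 / real (Suc n)) * real (Suc n)"
      by (simp add: distrib_right del: of_nat_Suc)
    then show "q n \<le> t + 1 / real (Suc n)" by (simp add: q_def pos_divide_le_eq del: of_nat_Suc)
  qed
  have l: "(\<lambda>n. t + 1 / real (Suc n)) \<longlonglongrightarrow> t"
    using tendsto_add[OF tendsto_const LIMSEQ_inverse_real_of_nat, of t] by (simp add: inverse_eq_divide)
  have "q \<longlonglongrightarrow> t" by (rule tendsto_sandwich[OF _ _ tendsto_const l]) (use q in \<open>auto intro!: always_eventually less_imp_le\<close>)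
  then have "filterlim q (at_right t) sequentially" using q by (auto simp: filterlim_at intro!: always_eventually)
  from filterlim_compose[OF L_right[OF w] this] have "(\<lambda>n. L (q n) (fst z)) \<longlonglongrightarrow> L t (fst z)" by (simp add: t_def)
  moreover have "max 0 (q n) = q n" for n using q(1)[of n] by (simp add: t_def)
  ultimately show "(\<lambda>n. L (max 0 ((of_int \<lfloor>max 0 (snd z) * real (Suc n)\<rfloor> + 1) / real (Suc n))) (fst z)) \<longlonglongrightarrow> L (max 0 (snd z)) (fst z)"
    by (simp add: q_def t_def)
qed

lemma Y_random_time:
  assumes [measurable]: "S \<in> borel_measurable M" and "\<And>\<omega>. \<omega> \<in> space M \<Longrightarrow> 0 \<le> S \<omega>"
  shows "(\<lambda>\<omega>. Y (S \<omega>) \<omega>) \<in> borel_measurable M"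
proof -
  have "(\<lambda>\<omega>. (\<omega>, S \<omega>)) \<in> measurable M (M \<Otimes>\<^sub>M borel)" by measurable
  from measurable_compose[OF this L_joint] have "(\<lambda>\<omega>. L (max 0 (S \<omega>)) \<omega>) \<in> borel_measurable M" by simp
  then have "(\<lambda>\<omega>. X (S \<omega>) \<omega> - L (max 0 (S \<omega>)) \<omega>) \<in> borel_measurable M"
    using surplus_random_time[of S x] by simp
  then show ?thesis unfolding controlled_surplus_def
    by (rule measurable_cong[THEN iffD1, rotated]) (use assms(2) in simp)
qed

lemma Ym_random_time:
  assumes [measurable]: "S \<in> borel_measurable M" and S: "\<And>\<omega>. \<omega> \<in> space M \<Longrightarrow> 0 < S \<omega>"
  shows "(\<lambda>\<omega>. Ym (S \<omega>) \<omega>) \<in> borel_measurable M"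
proof -
  have "S \<in> measurable M (restrict_space lborel {0<..})" using S by (intro measurable_restrict_space2) auto
  \<comment> \<open>The predictable process is evaluated along the graph of \<open>S\<close>; the
    mark 0 is a dummy.\<close>
  then have "(\<lambda>\<omega>. (\<omega>, S \<omega>, 0::real^'n)) \<in> measurable M compensator_space"
    unfolding compensator_space_def by measurable
  from measurable_compose[OF measurable_compose[OF this compensator_measurable] Ym_predictable]
  show ?thesis by simp
qed

lemma dividends_measurable:
  assumes [measurable]: "S \<in> borel_measurable M"
  shows "(\<lambda>\<omega>. discounted_dividends a c L (S \<omega>) \<omega>) \<in> borel_measurable M"
proof -
  interpret Cl: prob_space clock by (rule prob_space_clock)
  have s: "(\<lambda>z. (fst z, stop_at (S (fst z)) (max 0 (snd z)))) \<in> measurable (M \<Otimes>\<^sub>M clock) (M \<Otimes>\<^sub>M borel)"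
    unfolding stop_at_def by measurable
  have "(\<lambda>z. a \<bullet> L (max 0 (stop_at (S (fst z)) (max 0 (snd z)))) (fst z)) \<in> borel_measurable (M \<Otimes>\<^sub>M clock)"
    using measurable_compose[OF s L_joint] by simp
  then have "(\<lambda>(\<omega>, v). a \<bullet> L (stop_at (S \<omega>) (max 0 v)) \<omega>) \<in> borel_measurable (M \<Otimes>\<^sub>M clock)"
    by (simp add: split_beta' max_absorb2[OF stop_at_nonneg])
  then have "(\<lambda>\<omega>. \<integral>v. a \<bullet> L (stop_at (S \<omega>) (max 0 v)) \<omega> \<partial>clock) \<in> borel_measurable M"
    by (rule Cl.borel_measurable_lebesgue_integral)
  then show ?thesis by (rule measurable_cong[THEN iffD1, rotated]) (simp add: discounted_dividends_clock)
qed

text \<open>One constant serves all \<omega> and T: the mean of a \<bullet> (x + v p) over the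
  clock.\<close>

lemma dividends_bounds:
  obtains C where "\<And>T \<omega>. \<omega> \<in> space M \<Longrightarrow> 0 \<le> discounted_dividends a c L T \<omega> \<and> discounted_dividends a c L T \<omega> \<le> C"
proof (rule that, intro conjI)
  interpret Cl: prob_space clock by (rule prob_space_clock)
  fix T \<omega> assume w: "\<omega> \<in> space M"
  have Li: "integrable clock (\<lambda>v. a \<bullet> L (stop_at T (max 0 v)) \<omega>)"
    unfolding inner_vec_def by (intro Bochner_Integration.integrable_sum) (auto intro!: integrable_mult_right L_stop_integrable w)
  show "0 \<le> discounted_dividends a c L T \<omega>" unfolding discounted_dividends_clock[OF w]
    by (rule integral_nonneg_AE, rule AE_I2) (intro a_inner_nonneg L_nonneg[OF w] stop_at_nonneg, simp)
  have Ui: "integrable clock (\<lambda>v. a \<bullet> x + v * (a \<bullet> p))"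
    by (intro Bochner_Integration.integrable_add integrable_mult_left clock_mean_integrable) auto
  have "AE v in clock. 0 < v \<and> True" by (rule AE_clock) simp
  then have "AE v in clock. a \<bullet> L (stop_at T (max 0 v)) \<omega> \<le> a \<bullet> x + v * (a \<bullet> p)"
  proof eventually_elim
    case (elim v)
    have "L (stop_at T (max 0 v)) \<omega> \<le> L v \<omega>" using stop_at_le[of v T] stop_at_nonneg[of v T] elim by (intro L_mono[OF w]) auto
    also have "L v \<omega> \<le> x + v *\<^sub>R p" using elim by (intro L_upper[OF w]) simp
    finally have "a \<bullet> L (stop_at T (max 0 v)) \<omega> \<le> a \<bullet> (x + v *\<^sub>R p)" by (rule a_inner_mono)
    then show ?case by (simp add: inner_add_right)
  qed
  then show "discounted_dividends a c L T \<omega> \<le> (\<integral>v. a \<bullet> x + v * (a \<bullet> p) \<partial>clock)"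
    unfolding discounted_dividends_clock[OF w] by (rule integral_mono_AE[OF Li Ui])
qed

lemma dividends_limit:
  assumes w: "\<omega> \<in> space M"
  shows "(\<lambda>m. discounted_dividends a c L (min S (ennreal (real m))) \<omega>) \<longlonglongrightarrow> discounted_dividends a c L S \<omega>"
  unfolding discounted_dividends_clock[OF w]
proof (rule integral_dominated_convergence[where w="\<lambda>v. a \<bullet> x + v * (a \<bullet> p)"])
  have m: "(\<lambda>v. a \<bullet> L (stop_at T (max 0 v)) \<omega>) \<in> borel_measurable clock" for T
    unfolding inner_vec_def using L_component_measurable[OF w] by (intro borel_measurable_sum) auto
  show "(\<lambda>v. a \<bullet> L (stop_at S (max 0 v)) \<omega>) \<in> borel_measurable clock" by (rule m)
  show "(\<lambda>v. a \<bullet> L (stop_at (min S (ennreal (real n))) (max 0 v)) \<omega>) \<in> borel_measurable clock" for n by (rule m)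
  interpret Cl: prob_space clock by (rule prob_space_clock)
  show "integrable clock (\<lambda>v. a \<bullet> x + v * (a \<bullet> p))"
    by (intro Bochner_Integration.integrable_add integrable_mult_left clock_mean_integrable) auto
  have ae: "AE v in clock. 0 < v \<and> True" by (rule AE_clock) simp
  show "AE v in clock. norm (a \<bullet> L (stop_at (min S (ennreal (real n))) (max 0 v)) \<omega>) \<le> a \<bullet> x + v * (a \<bullet> p)" for n
    using ae
  proof eventually_elim
    case (elim v)
    let ?T = "min S (ennreal (real n))"
    have "L (stop_at ?T (max 0 v)) \<omega> \<le> L v \<omega>" using stop_at_le[of v ?T] stop_at_nonneg[of v ?T] elim by (intro L_mono[OF w]) auto
    also have "L v \<omega> \<le> x + v *\<^sub>R p" using elim by (intro L_upper[OF w]) simp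
    finally have "a \<bullet> L (stop_at ?T (max 0 v)) \<omega> \<le> a \<bullet> (x + v *\<^sub>R p)" by (rule a_inner_mono)
    moreover have "0 \<le> a \<bullet> L (stop_at ?T (max 0 v)) \<omega>" by (intro a_inner_nonneg L_nonneg[OF w] stop_at_nonneg) simp
    ultimately show ?case by (simp add: inner_add_right)
  qed
  show "AE v in clock. (\<lambda>n. a \<bullet> L (stop_at (min S (ennreal (real n))) (max 0 v)) \<omega>) \<longlonglongrightarrow> a \<bullet> L (stop_at S (max 0 v)) \<omega>"
  proof (rule AE_I2, rule tendsto_eventually)
    fix v :: real
    obtain k :: nat where k: "max 0 v \<le> real k" using real_arch_simple by blast
    show "\<forall>\<^sub>F n in sequentially. a \<bullet> L (stop_at (min S (ennreal (real n))) (max 0 v)) \<omega> = a \<bullet> L (stop_at S (max 0 v)) \<omega>"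
      using eventually_ge_at_top[of k]
    proof eventually_elim
      case (elim n)
      then have vn: "ennreal (max 0 v) \<le> ennreal (real n)" using k by (intro ennreal_leI) simp
      have "stop_at (min S (ennreal (real n))) (max 0 v) = stop_at S (max 0 v)"
      proof (cases "ennreal (max 0 v) \<le> S")
        case True then show ?thesis using vn by (simp add: stop_at_def)
      next
        case False
        then have "min S (ennreal (real n)) = S" using order_trans[OF less_imp_le vn] by (intro min_absorb1) (simp only: not_le)
        then show ?thesis by simp
      qed
      then show ?case by simp
    qed
  qed
qed

end

section \<open>Comparison with the value of a strategy\<close>

locale strategy_bound = controlled M p a c rate \<tau> U \<upsilon> f u x L
  for M :: "'w measure" and p a :: "real^'n" and c rate :: real
    and \<tau> :: "nat \<Rightarrow> 'w \<Rightarrow> real" and U :: "nat \<Rightarrow> 'w \<Rightarrow> real^'n"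
    and \<upsilon> :: "real^'n \<Rightarrow> real^'n \<Rightarrow> real" and f u :: "real^'n \<Rightarrow> real"
    and x :: "real^'n" and L :: "real \<Rightarrow> 'w \<Rightarrow> real^'n" +
  fixes T :: "'w \<Rightarrow> ennreal"
  assumes stopping: "stopping_time (claim_filtration M \<tau> U) T"
begin

section \<open>Compensating the claim gains of a strategy\<close>

lemma T_event: "{\<omega> \<in> space M. T \<omega> \<le> t} \<in> sets (claims_upto t)"
  using stopping_timeD[OF stopping, of t] by (simp add: pred_def)

lemma T_measurable [measurable]: "T \<in> borel_measurable M"
  by (rule borel_measurableI_le) (rule subsetD[OF claims_upto_sets T_event])

lemma T_predictable: "{z \<in> space predictable. ennreal (fst (snd z)) \<le> T (fst z)} \<in> sets predictable"
proof -
  have iff: "T \<omega> < ennreal s \<longleftrightarrow> (\<exists>q\<in>\<rat>. 0 \<le> q \<and> q < s \<and> T \<omega> \<le> ennreal q)" for \<omega> s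
  proof
    assume lt: "T \<omega> < ennreal s"
    then obtain r where r: "0 \<le> r" "T \<omega> = ennreal r" by (cases "T \<omega>") auto
    then have "r < s" using lt by (simp add: ennreal_less_iff)
    then obtain q where "q \<in> \<rat>" "r < q" "q < s" using Rats_dense_in_real by blast
    then show "\<exists>q\<in>\<rat>. 0 \<le> q \<and> q < s \<and> T \<omega> \<le> ennreal q" using r by (intro bexI[of _ q]) (auto intro: ennreal_leI)
  next
    assume "\<exists>q\<in>\<rat>. 0 \<le> q \<and> q < s \<and> T \<omega> \<le> ennreal q"
    then obtain q where q: "0 \<le> q" "q < s" "T \<omega> \<le> ennreal q" by blast
    have "ennreal q < ennreal s" using q by (simp add: ennreal_less_iff)
    then show "T \<omega> < ennreal s" using q(3) by (rule order_le_less_trans[rotated])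
  qed
  have "{z \<in> space predictable. ennreal (fst (snd z)) \<le> T (fst z)} = space predictable -
    {z \<in> space predictable. \<exists>q\<in>\<rat>. 0 \<le> q \<and> q < fst (snd z) \<and> fst z \<in> {\<omega> \<in> space M. T \<omega> \<le> ennreal q}}"
    using iff by (auto simp: not_less[symmetric])
  also have "\<dots> \<in> sets predictable" by (intro sets.Diff sets.top predictable_set T_event)
  finally show ?thesis .
qed

definition end_time :: "real \<Rightarrow> 'w \<Rightarrow> ennreal" where
  "end_time m \<omega> = min (min (T \<omega>) (\<rho> \<omega>)) (ennreal m)"

text \<open>Discounted gain from a claim of size \<open>snd (snd z)\<close> at time
  \<open>fst (snd z)\<close>, provided that neither switch, ruin nor horizon comes earlier. At a
  \<open>claim_mark\<close> it is the realised gain; integrated over time and \<open>\<mu>\<close>,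
  and multiplied by the rate, it is the compensator. The inner case distinction secures
  measurability and is invisible up to ruin, where the left limit is nonnegative.\<close>

definition integrand :: "real \<Rightarrow> 'w \<times> real \<times> (real^'n) \<Rightarrow> real" where
  "integrand m z = (if ennreal (fst (snd z)) \<le> T (fst z) \<and> ennreal (fst (snd z)) \<le> \<rho> (fst z) \<and> fst (snd z) \<le> m
     then exp (- c * fst (snd z)) * (payoff (Ym (fst (snd z)) (fst z)) (snd (snd z)) -
       (if 0 \<le> Ym (fst (snd z)) (fst z) then u (Ym (fst (snd z)) (fst z)) else 0)) else 0)"

lemma integrand_measurable: "integrand m \<in> borel_measurable predictable"
proof -
  have [measurable]: "Measurable.pred predictable (\<lambda>z. ennreal (fst (snd z)) \<le> T (fst z))"
    "Measurable.pred predictable (\<lambda>z. ennreal (fst (snd z)) \<le> \<rho> (fst z))"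
    unfolding pred_def using T_predictable ruin_predictable by auto
  have [measurable]: "(\<lambda>z. if 0 \<le> Ym (fst (snd z)) (fst z) then u (Ym (fst (snd z)) (fst z)) else 0) \<in> borel_measurable predictable"
    using measurable_compose[OF Ym_predictable u_indicator_measurable] .
  show ?thesis unfolding integrand_def by measurable
qed

lemma integrand_bound:
  obtains C where "0 \<le> C" "\<And>z. z \<in> space predictable \<Longrightarrow> \<bar>integrand m z\<bar> \<le> indicator {0<..m} (fst (snd z)) * (C + penalty_bound (snd (snd z)))"
proof -
  define b where "b = x + max 0 m *\<^sub>R p"
  obtain C where C: "C \<ge> 0" "\<And>y \<alpha>. 0 \<le> y \<Longrightarrow> y \<le> b \<Longrightarrow> 0 \<le> \<alpha> \<Longrightarrow> \<bar>payoff y \<alpha>\<bar> \<le> C + penalty_bound \<alpha>"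
    using payoff_bound by blast
  define D where "D = C + \<bar>u 0\<bar> + \<bar>u b\<bar>"
  have pb: "0 \<le> penalty_bound \<alpha>" for \<alpha> by (simp add: penalty_bound_def)
  show ?thesis
  proof (rule that[of D])
    show "0 \<le> D" using C by (simp add: D_def)
    fix z assume "z \<in> space predictable"
    then obtain \<omega> s \<alpha> where z: "z = (\<omega>, s, \<alpha>)" "\<omega> \<in> space M" "0 < s" by (cases z) auto
    show "\<bar>integrand m z\<bar> \<le> indicator {0<..m} (fst (snd z)) * (D + penalty_bound (snd (snd z)))"
    proof (cases "ennreal s \<le> T \<omega> \<and> ennreal s \<le> \<rho> \<omega> \<and> s \<le> m")
      case True
      then have y: "0 \<le> Ym s \<omega>" using Ym_nonneg z by blast
      have "Ym s \<omega> \<le> x + s *\<^sub>R p" using Ym_upper z by blast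
      also have "s *\<^sub>R p \<le> max 0 m *\<^sub>R p" by (rule p_scale_mono) (use True in auto)
      then have "x + s *\<^sub>R p \<le> b" unfolding b_def by (simp add: less_eq_vec_def)
      finally have yb: "Ym s \<omega> \<le> b" .
      have "\<bar>payoff (Ym s \<omega>) \<alpha>\<bar> \<le> C + penalty_bound \<alpha>"
        using C(2)[OF y yb, of \<alpha>] C(1) pb[of \<alpha>] by (cases "0 \<le> \<alpha>") (auto simp: payoff_def)
      moreover have "\<bar>u (Ym s \<omega>)\<bar> \<le> \<bar>u 0\<bar> + \<bar>u b\<bar>" by (rule u_box_bound[OF y yb])
      ultimately have "\<bar>payoff (Ym s \<omega>) \<alpha> - u (Ym s \<omega>)\<bar> \<le> D + penalty_bound \<alpha>" by (simp add: D_def)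
      moreover have "exp (- c * s) \<le> 1" using c_pos z by simp
      ultimately have "exp (- c * s) * \<bar>payoff (Ym s \<omega>) \<alpha> - u (Ym s \<omega>)\<bar> \<le> 1 * (D + penalty_bound \<alpha>)"
        by (intro mult_mono) auto
      then show ?thesis using True y z by (simp add: integrand_def abs_mult)
    next
      case False
      then have "integrand m z = 0" unfolding integrand_def z fst_conv snd_conv by (rule if_not_P)
      then show ?thesis using \<open>0 \<le> D\<close> pb[of "snd (snd z)"] by simp
    qed
  qed
qed

lemma time_mark_integrable:
  assumes h: "integrable (restrict_space lborel {0<..}) h"
  shows "integrable (restrict_space lborel {0<..} \<Otimes>\<^sub>M \<mu>) (\<lambda>z. h (fst z) * (C + penalty_bound (snd z)))"
    and "integrable compensator_space (\<lambda>z. h (fst (snd z)) * (C + penalty_bound (snd (snd z))))"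
proof -
  interpret S: sigma_finite_measure "restrict_space lborel {0::real<..}" by (rule sigma_finite_time)
  interpret \<mu>: prob_space \<mu> by (rule prob_space_\<mu>)
  interpret P: pair_sigma_finite "restrict_space lborel {0::real<..}" \<mu> ..
  interpret TM: sigma_finite_measure "restrict_space lborel {0::real<..} \<Otimes>\<^sub>M \<mu>" by (rule sigma_finite_time_mark)
  interpret Q: pair_sigma_finite M "restrict_space lborel {0::real<..} \<Otimes>\<^sub>M \<mu>" ..
  show i: "integrable (restrict_space lborel {0<..} \<Otimes>\<^sub>M \<mu>) (\<lambda>z. h (fst z) * (C + penalty_bound (snd z)))"
    by (rule P.integrable_product_fun[OF h]) (intro Bochner_Integration.integrable_add penalty_bound_integrable \<mu>.integrable_const)
  have "integrable M (\<lambda>_. 1::real)" by simp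
  from Q.integrable_product_fun[OF this i]
  show "integrable compensator_space (\<lambda>z. h (fst (snd z)) * (C + penalty_bound (snd (snd z))))"
    by (simp add: compensator_space_def)
qed

lemma indicator_time_integrable: "integrable (restrict_space lborel {0<..}) (indicator {0<..m} :: real \<Rightarrow> real)"
proof (subst integrable_restrict_space)
  have "integrable lborel (indicator {0<..m} :: real \<Rightarrow> real)"
    using set_integrable_const[of 0 m 1] by (simp add: set_integrable_def)
  moreover have "(\<lambda>s. indicator {0<..} s *\<^sub>R indicator {0<..m} s) = (indicator {0<..m} :: real \<Rightarrow> real)"
    by (auto simp: indicator_def)
  ultimately show "integrable lborel (\<lambda>s. indicator {0<..} s *\<^sub>R indicator {0<..m} s :: real)" by simp
qed simp

lemma integrand_integrable:
  shows "integrable compensator_space (integrand m)"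
    and "\<omega> \<in> space M \<Longrightarrow> integrable (restrict_space lborel {0<..} \<Otimes>\<^sub>M \<mu>) (\<lambda>z. integrand m (\<omega>, z))"
proof -
  obtain C where C: "0 \<le> C" "\<And>z. z \<in> space predictable \<Longrightarrow> \<bar>integrand m z\<bar> \<le> indicator {0<..m} (fst (snd z)) * (C + penalty_bound (snd (snd z)))"
    using integrand_bound by blast
  have sp: "space compensator_space = space predictable"
    by (simp add: compensator_space_def space_pair_measure space_restrict_space)
  have mm: "integrand m \<in> borel_measurable compensator_space"
    using measurable_compose[OF compensator_measurable integrand_measurable] .
  show "integrable compensator_space (integrand m)"
    by (rule Bochner_Integration.integrable_bound[OF time_mark_integrable(2)[OF indicator_time_integrable[of m], where C=C] mm])
       (use C in \<open>auto intro!: AE_I2 order_trans[OF _ abs_ge_self] simp: sp\<close>)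
  assume w: "\<omega> \<in> space M"
  have "(\<lambda>z. (\<omega>, z)) \<in> measurable (restrict_space lborel {0<..} \<Otimes>\<^sub>M \<mu>) compensator_space"
    unfolding compensator_space_def using w by measurable
  from measurable_compose[OF this mm]
  show "integrable (restrict_space lborel {0<..} \<Otimes>\<^sub>M \<mu>) (\<lambda>z. integrand m (\<omega>, z))"
    by (rule Bochner_Integration.integrable_bound[OF time_mark_integrable(1)[OF indicator_time_integrable[of m], where C=C]])
       (use C w in \<open>auto intro!: AE_I2 order_trans[OF _ abs_ge_self] simp: space_pair_measure space_restrict_space\<close>)
qed

text \<open>Realised discounted claim gains up to \<open>end_time m\<close> minus their compensator;
  it enters the comparison through its zero mean.\<close>

definition gain_martingale :: "real \<Rightarrow> 'w \<Rightarrow> real" where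
  "gain_martingale m \<omega> = (\<integral>k. integrand m (claim_mark k \<omega>) \<partial>count_space UNIV) -
     rate * (\<integral>z. integrand m (\<omega>, z) \<partial>(restrict_space lborel {0<..} \<Otimes>\<^sub>M \<mu>))"

lemma gain_martingale_mean:
  shows "integrable M (gain_martingale m)" and "(\<integral>\<omega>. gain_martingale m \<omega> \<partial>M) = 0"
proof -
  note cmp = compensation[OF integrand_measurable integrand_integrable(1)]
  show "integrable M (gain_martingale m)" unfolding gain_martingale_def
    by (intro Bochner_Integration.integrable_diff cmp(1) integrable_mult_right cmp(2))
  have "(\<integral>\<omega>. gain_martingale m \<omega> \<partial>M) =
     (\<integral>\<omega>. (\<integral>k. integrand m (claim_mark k \<omega>) \<partial>count_space UNIV) \<partial>M) -
     (\<integral>\<omega>. rate * (\<integral>z. integrand m (\<omega>, z) \<partial>(restrict_space lborel {0<..} \<Otimes>\<^sub>M \<mu>)) \<partial>M)"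
    unfolding gain_martingale_def
    by (rule Bochner_Integration.integral_diff) (intro cmp(1) integrable_mult_right cmp(2))+
  then show "(\<integral>\<omega>. gain_martingale m \<omega> \<partial>M) = 0" using cmp(3) by simp
qed

text \<open>By \<open>g_payoff\<close> the mean gain per claim times the rate is c u - g before the
  end time. Subtracting this compensator produces exactly the running integral of
  \<open>discounted_bound\<close>, so the random part of that bound has mean zero.\<close>

lemma gain_martingale_eq:
  assumes w: "\<omega> \<in> space M" and m: "0 \<le> m"
  defines "e \<equiv> enn2real (end_time m \<omega>)"
  shows "gain_martingale m \<omega> = (\<Sum>k = 1..N e \<omega>. exp (- c * \<tau> k \<omega>) * jump_gain k \<omega>) +
    (LINT s:{0<..e}|lborel. exp (- c * s) * (g (Ym s \<omega>) - c * u (Ym s \<omega>)))"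
proof -
  interpret S: sigma_finite_measure "restrict_space lborel {0::real<..}" by (rule sigma_finite_time)
  interpret \<mu>: prob_space \<mu> by (rule prob_space_\<mu>)
  interpret P: pair_sigma_finite "restrict_space lborel {0::real<..}" \<mu> ..
  have "end_time m \<omega> \<le> ennreal m" by (simp add: end_time_def)
  then have ee: "end_time m \<omega> = ennreal e" unfolding e_def by (intro ennreal_enn2real[symmetric]) (simp add: order_le_less_trans)
  have e0: "0 \<le> e" by (simp add: e_def)
  have cond: "ennreal s \<le> T \<omega> \<and> ennreal s \<le> \<rho> \<omega> \<and> s \<le> m \<longleftrightarrow> s \<le> e" if "0 < s" for s
  proof -
    have "ennreal s \<le> T \<omega> \<and> ennreal s \<le> \<rho> \<omega> \<and> s \<le> m \<longleftrightarrow> ennreal s \<le> end_time m \<omega>"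
      using m by (auto simp: end_time_def)
    then show ?thesis unfolding ee using e0 by simp
  qed
  have er: "ennreal e \<le> \<rho> \<omega>" unfolding ee[symmetric] by (simp add: end_time_def min.coboundedI1)
  have y0: "0 \<le> Ym s \<omega>" if "0 < s" "s \<le> e" for s
    by (rule Ym_nonneg[OF w that(1)]) (use er that ennreal_leI order_trans in blast)
  have int: "integrand m (\<omega>, s, \<alpha>) = (if s \<le> e then exp (- c * s) * (payoff (Ym s \<omega>) \<alpha> - u (Ym s \<omega>)) else 0)" if "0 < s" for s \<alpha>
    using cond[OF that] y0[OF that] by (auto simp: integrand_def)
  have "(\<integral>k. integrand m (claim_mark k \<omega>) \<partial>count_space UNIV) = (\<Sum>k | integrand m (claim_mark k \<omega>) \<noteq> 0. integrand m (claim_mark k \<omega>))"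
  proof (subst lebesgue_integral_count_space_finite_support)
    have "{k. integrand m (claim_mark k \<omega>) \<noteq> 0} \<subseteq> {..<N e \<omega>}"
      using int tau_positive[OF w] le_N_iff[OF w, of "Suc _" e] by (auto simp: claim_mark_def Suc_le_eq split: if_splits)
    then show "finite {a \<in> UNIV. integrand m (claim_mark a \<omega>) \<noteq> 0}" using finite_subset by auto
  qed simp
  also have "\<dots> = (\<Sum>k<N e \<omega>. integrand m (claim_mark k \<omega>))"
    using int tau_positive[OF w] le_N_iff[OF w, of "Suc _" e]
    by (intro sum.mono_neutral_left) (auto simp: claim_mark_def Suc_le_eq split: if_splits)
  also have "\<dots> = (\<Sum>k<N e \<omega>. exp (- c * \<tau> (Suc k) \<omega>) * jump_gain (Suc k) \<omega>)"
  proof (rule sum.cong[OF refl])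
    fix k assume "k \<in> {..<N e \<omega>}"
    then have "\<tau> (Suc k) \<omega> \<le> e" using le_N_iff[OF w, of "Suc k" e] by simp
    then show "integrand m (claim_mark k \<omega>) = exp (- c * \<tau> (Suc k) \<omega>) * jump_gain (Suc k) \<omega>"
      using int[OF tau_positive[OF w, of "Suc k"]] by (simp add: claim_mark_def jump_gain_def)
  qed
  also have "\<dots> = (\<Sum>k = 1..N e \<omega>. exp (- c * \<tau> k \<omega>) * jump_gain k \<omega>)"
    by (rule sum.reindex_bij_witness[of _ "\<lambda>k. k - 1" Suc]) auto
  finally have s1: "(\<integral>k. integrand m (claim_mark k \<omega>) \<partial>count_space UNIV) = (\<Sum>k = 1..N e \<omega>. exp (- c * \<tau> k \<omega>) * jump_gain k \<omega>)" .
  have "rate * (\<integral>z. integrand m (\<omega>, z) \<partial>(restrict_space lborel {0<..} \<Otimes>\<^sub>M \<mu>)) =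
     rate * (\<integral>s. (\<integral>\<alpha>. integrand m (\<omega>, s, \<alpha>) \<partial>\<mu>) \<partial>restrict_space lborel {0<..})"
    using P.integral_fst'[OF integrand_integrable(2)[OF w]] by simp
  also have "\<dots> = (\<integral>s. rate * (\<integral>\<alpha>. integrand m (\<omega>, s, \<alpha>) \<partial>\<mu>) \<partial>restrict_space lborel {0<..})" by simp
  also have "\<dots> = (\<integral>s. - (indicator {0<..e} s *\<^sub>R (exp (- c * s) * (g (Ym s \<omega>) - c * u (Ym s \<omega>)))) \<partial>restrict_space lborel {0<..})"
  proof (rule Bochner_Integration.integral_cong[OF refl])
    fix s :: real assume "s \<in> space (restrict_space lborel {0<..})"
    then have s: "0 < s" by (simp add: space_restrict_space)
    show "rate * (\<integral>\<alpha>. integrand m (\<omega>, s, \<alpha>) \<partial>\<mu>) = - (indicator {0<..e} s *\<^sub>R (exp (- c * s) * (g (Ym s \<omega>) - c * u (Ym s \<omega>))))"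
    proof (cases "s \<le> e")
      case True
      have "(\<integral>\<alpha>. integrand m (\<omega>, s, \<alpha>) \<partial>\<mu>) = exp (- c * s) * (\<integral>\<alpha>. payoff (Ym s \<omega>) \<alpha> - u (Ym s \<omega>) \<partial>\<mu>)"
        using True by (simp add: int[OF s])
      also have "(\<integral>\<alpha>. payoff (Ym s \<omega>) \<alpha> - u (Ym s \<omega>) \<partial>\<mu>) = (\<integral>\<alpha>. payoff (Ym s \<omega>) \<alpha> \<partial>\<mu>) - u (Ym s \<omega>)"
        by (subst Bochner_Integration.integral_diff[OF payoff_integrable[OF y0[OF s True]]])
           (auto simp: \<mu>.prob_space[simplified])
      finally have eq: "(\<integral>\<alpha>. integrand m (\<omega>, s, \<alpha>) \<partial>\<mu>) = exp (- c * s) * ((\<integral>\<alpha>. payoff (Ym s \<omega>) \<alpha> \<partial>\<mu>) - u (Ym s \<omega>))" .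
      show ?thesis using True s unfolding eq g_payoff[OF y0[OF s True]] by (simp add: algebra_simps)
    qed (simp add: int[OF s])
  qed
  also have "\<dots> = - (LINT s:{0<..e}|lborel. exp (- c * s) * (g (Ym s \<omega>) - c * u (Ym s \<omega>)))"
  proof -
    have "(\<integral>s. indicator {0<..e} s *\<^sub>R (exp (- c * s) * (g (Ym s \<omega>) - c * u (Ym s \<omega>))) \<partial>restrict_space lborel {0<..}) =
       (LINT s:{0<..}|lborel. indicator {0<..e} s *\<^sub>R (exp (- c * s) * (g (Ym s \<omega>) - c * u (Ym s \<omega>))))"
      by (subst integral_restrict_space) (auto simp: set_lebesgue_integral_def)
    also have "\<dots> = (LINT s:{0<..e}|lborel. exp (- c * s) * (g (Ym s \<omega>) - c * u (Ym s \<omega>)))"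
      unfolding set_lebesgue_integral_def by (rule Bochner_Integration.integral_cong) (auto simp: indicator_def)
    finally show ?thesis by simp
  qed
  finally show ?thesis unfolding gain_martingale_def s1 by simp
qed

section \<open>The value up to a finite horizon and its limit\<close>

definition switch_reward :: "'w \<Rightarrow> real" where
  "switch_reward \<omega> = (if T \<omega> < \<rho> \<omega> then discount c (T \<omega>) * f (Y (enn2real (T \<omega>)) \<omega>) else 0)"

abbreviation penalty :: "'w \<Rightarrow> real" where "penalty \<equiv> ruin_penalty p c \<tau> U \<upsilon> x (L, T)"

text \<open>The path bounds hold up to a finite end time, hence the truncation at \<open>m\<close>;
  it disappears by dominated convergence.\<close>

definition value_upto :: "real \<Rightarrow> 'w \<Rightarrow> real" where
  "value_upto m \<omega> = discounted_dividends a c L (end_time m \<omega>) \<omega> +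
     (if T \<omega> \<le> ennreal m then switch_reward \<omega> else 0) - (if \<rho> \<omega> \<le> ennreal m then penalty \<omega> else 0)"

lemma discount_real: "0 \<le> t \<Longrightarrow> discount c (ennreal t) = exp (- c * t)"
  by (simp add: discount_def)

lemma penalty_eq:
  assumes w: "\<omega> \<in> space M"
  shows "penalty \<omega> = (if \<rho> \<omega> \<le> T \<omega> \<and> \<rho> \<omega> < \<infinity> then discount c (\<rho> \<omega>) *
     \<upsilon> (Ym (enn2real (\<rho> \<omega>)) \<omega>) (Ym (enn2real (\<rho> \<omega>)) \<omega> - Y (enn2real (\<rho> \<omega>)) \<omega>) else 0)"
proof (cases "\<rho> \<omega> < \<infinity>")
  case True
  then obtain r where r: "0 \<le> r" "\<rho> \<omega> = ennreal r" by (cases "\<rho> \<omega>") auto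
  have "0 < r" by (rule bound_at_ruin(3)[OF w r(2,1)])
  then show ?thesis using r True by (simp add: ruin_penalty_def Let_def Ym_def)
next
  case False
  then have "\<rho> \<omega> = \<infinity>" by (simp add: less_top[symmetric] not_less top_unique)
  then show ?thesis by (simp add: ruin_penalty_def Let_def discount_def)
qed

text \<open>The open terminal value is chosen as \<open>f\<close>, minus the penalty, or
  \<open>u 0\<close>, according to whether switch, ruin or horizon ends the path; a tie between
  switch and ruin counts as ruin. Only the horizon causes an error: its terminal value does not
  belong to the reward and is bounded below by monotonicity of \<open>u\<close>.\<close>

lemma value_upto_bound:
  assumes w: "\<omega> \<in> space M" and m: "0 \<le> m"
  shows "value_upto m \<omega> \<le> u x + exp (- c * m) * \<bar>u 0\<bar> + gain_martingale m \<omega>"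
proof -
  define e where "e = enn2real (end_time m \<omega>)"
  have "end_time m \<omega> \<le> ennreal m" by (simp add: end_time_def)
  then have ee: "end_time m \<omega> = ennreal e" unfolding e_def by (intro ennreal_enn2real[symmetric]) (simp add: order_le_less_trans)
  have e0: "0 \<le> e" by (simp add: e_def)
  have er: "ennreal e \<le> \<rho> \<omega>" unfolding ee[symmetric] by (simp add: end_time_def min.coboundedI1)
  have main: "discounted_dividends a c L (ennreal e) \<omega> + exp (- c * e) * E \<le> u x + gain_martingale m \<omega>"
    if "E + a \<bullet> L e \<omega> \<le> (u x + (\<Sum>k = 1..N e \<omega>. jump_gain k \<omega>)) + (LINT r:{0<..e}|lborel. g (Ym r \<omega>))" for E
    using discounted_bound[OF w e0 er that] unfolding gain_martingale_eq[OF w m, folded e_def] by simp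
  have "(T \<omega> < \<rho> \<omega> \<and> T \<omega> \<le> ennreal m) \<or> (\<rho> \<omega> \<le> T \<omega> \<and> \<rho> \<omega> \<le> ennreal m) \<or> (ennreal m < T \<omega> \<and> ennreal m < \<rho> \<omega>)"
    using order_less_trans[of "ennreal m" "T \<omega>" "\<rho> \<omega>"] order_less_le_trans[of "ennreal m" "\<rho> \<omega>" "T \<omega>"]
    by (auto simp only: not_less not_le)
  then consider (switch) "T \<omega> < \<rho> \<omega>" "T \<omega> \<le> ennreal m" | (ruin) "\<rho> \<omega> \<le> T \<omega>" "\<rho> \<omega> \<le> ennreal m"
    | (run) "ennreal m < T \<omega>" "ennreal m < \<rho> \<omega>" by blast
  then show ?thesis
  proof cases
    case switch
    then have Te: "T \<omega> = ennreal e" unfolding ee[symmetric] end_time_def by (simp add: min_absorb1 less_imp_le)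
    have Y0: "0 \<le> Y e \<omega>" using before_ruin[OF w e0] switch Te by simp
    have "f (Y e \<omega>) + a \<bullet> L e \<omega> \<le> u (Y e \<omega>) + a \<bullet> L e \<omega>" using f_le_u[of "Y e \<omega>"] Y0 by simp
    also have "\<dots> \<le> (u x + (\<Sum>k = 1..N e \<omega>. jump_gain k \<omega>)) + (LINT r:{0<..e}|lborel. g (Ym r \<omega>))"
      by (rule bound_at[OF w e0]) (use switch Te in simp)
    finally have "discounted_dividends a c L (ennreal e) \<omega> + exp (- c * e) * f (Y e \<omega>) \<le> u x + gain_martingale m \<omega>" by (rule main)
    moreover have "(if \<rho> \<omega> \<le> ennreal m then penalty \<omega> else 0) = 0" using switch(1)[unfolded not_le[symmetric]] by (simp add: penalty_eq[OF w])
    moreover have "switch_reward \<omega> = exp (- c * e) * f (Y e \<omega>)" using switch e0 by (simp add: switch_reward_def Te discount_real)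
    ultimately have "value_upto m \<omega> \<le> u x + gain_martingale m \<omega>" using switch by (simp add: value_upto_def ee)
    moreover have "0 \<le> exp (- c * m) * \<bar>u 0\<bar>" by simp
    ultimately show ?thesis by linarith
  next
    case ruin
    then have Re: "\<rho> \<omega> = ennreal e" unfolding ee[symmetric] end_time_def by (simp add: min_absorb1 min_absorb2)
    have "discounted_dividends a c L (ennreal e) \<omega> + exp (- c * e) * (- \<upsilon> (Ym e \<omega>) (Ym e \<omega> - Y e \<omega>)) \<le> u x + gain_martingale m \<omega>"
      by (rule main[OF bound_at_ruin(1)[OF w Re e0]])
    moreover have "penalty \<omega> = exp (- c * e) * \<upsilon> (Ym e \<omega>) (Ym e \<omega> - Y e \<omega>)"
      using ruin e0 by (simp add: penalty_eq[OF w] Re discount_real)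
    moreover have "switch_reward \<omega> = 0" using ruin by (simp add: switch_reward_def)
    ultimately have "value_upto m \<omega> \<le> u x + gain_martingale m \<omega>" using ruin by (simp add: value_upto_def ee)
    moreover have "0 \<le> exp (- c * m) * \<bar>u 0\<bar>" by simp
    ultimately show ?thesis by linarith
  next
    case run
    then have me: "e = m" unfolding e_def end_time_def using m by (simp add: min_absorb2 less_imp_le)
    have Y0: "0 \<le> Y e \<omega>" using before_ruin[OF w e0] run me by simp
    have "u 0 + a \<bullet> L e \<omega> \<le> u (Y e \<omega>) + a \<bullet> L e \<omega>" using u_mono[of 0 "Y e \<omega>"] Y0 by simp
    also have "\<dots> \<le> (u x + (\<Sum>k = 1..N e \<omega>. jump_gain k \<omega>)) + (LINT r:{0<..e}|lborel. g (Ym r \<omega>))"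
      by (rule bound_at[OF w e0]) (use run me in simp)
    finally have "discounted_dividends a c L (ennreal e) \<omega> + exp (- c * e) * u 0 \<le> u x + gain_martingale m \<omega>" by (rule main)
    moreover have "- (exp (- c * m) * \<bar>u 0\<bar>) \<le> exp (- c * m) * u 0"
      unfolding mult_minus_right[symmetric] by (intro mult_left_mono) auto
    ultimately show ?thesis using run by (simp add: value_upto_def ee me not_le[symmetric])
  qed
qed

lemma discount_measurable [measurable]: "discount c \<in> borel_measurable borel"
  unfolding discount_def[abs_def] by measurable

lemma switch_reward_measurable [measurable]: "switch_reward \<in> borel_measurable M"
proof -
  define S where "S \<omega> = enn2real (T \<omega>)" for \<omega>
  have [measurable]: "S \<in> borel_measurable M" unfolding S_def by measurable
  have [measurable]: "(\<lambda>\<omega>. if 0 \<le> Y (S \<omega>) \<omega> then f (Y (S \<omega>) \<omega>) else 0) \<in> borel_measurable M"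
    by (rule measurable_compose[OF Y_random_time f_measurable]) (auto simp: S_def)
  have "(\<lambda>\<omega>. if T \<omega> < \<rho> \<omega> then discount c (T \<omega>) * (if 0 \<le> Y (S \<omega>) \<omega> then f (Y (S \<omega>) \<omega>) else 0) else 0) \<in> borel_measurable M"
    by measurable
  then show ?thesis
  proof (rule measurable_cong[THEN iffD1, rotated])
    fix \<omega> assume w: "\<omega> \<in> space M"
    have "0 \<le> Y (S \<omega>) \<omega>" if "T \<omega> < \<rho> \<omega>"
    proof (rule before_ruin[OF w])
      have "T \<omega> < top" using that by (rule order_less_le_trans) simp
      then show "ennreal (S \<omega>) < \<rho> \<omega>" using that by (simp add: S_def)
    qed (simp add: S_def)
    then show "(if T \<omega> < \<rho> \<omega> then discount c (T \<omega>) * (if 0 \<le> Y (S \<omega>) \<omega> then f (Y (S \<omega>) \<omega>) else 0) else 0) = switch_reward \<omega>"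
      by (simp add: switch_reward_def S_def)
  qed
qed

lemma penalty_measurable [measurable]: "penalty \<in> borel_measurable M"
proof -
  \<comment> \<open>On paths without ruin the penalty is 0, and 1 is an arbitrary time; it has to be
    positive for \<open>Ym_random_time\<close>.\<close>
  define S where "S \<omega> = (if \<rho> \<omega> = \<infinity> then 1 else enn2real (\<rho> \<omega>))" for \<omega>
  have S [measurable]: "S \<in> borel_measurable M" unfolding S_def by measurable
  have S0: "0 < S \<omega>" if w: "\<omega> \<in> space M" for \<omega>
  proof (cases "\<rho> \<omega>")
    case (real r)
    then show ?thesis using bound_at_ruin(3)[OF w real(2,1)] by (simp add: S_def)
  qed (simp add: S_def)
  have [measurable]: "(\<lambda>\<omega>. Ym (S \<omega>) \<omega>) \<in> borel_measurable M" by (rule Ym_random_time[OF S S0])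
  have [measurable]: "(\<lambda>\<omega>. Y (S \<omega>) \<omega>) \<in> borel_measurable M" by (rule Y_random_time[OF S]) (use S0 in \<open>auto intro: less_imp_le\<close>)
  have "(\<lambda>\<omega>. (Ym (S \<omega>) \<omega>, Ym (S \<omega>) \<omega> - Y (S \<omega>) \<omega>)) \<in> borel_measurable M"
    by (intro borel_measurable_Pair) measurable
  from measurable_compose[OF this penalty_indicator_measurable]
  have [measurable]: "(\<lambda>\<omega>. if (Ym (S \<omega>) \<omega>, Ym (S \<omega>) \<omega> - Y (S \<omega>) \<omega>) \<in> exit_set then \<upsilon> (Ym (S \<omega>) \<omega>) (Ym (S \<omega>) \<omega> - Y (S \<omega>) \<omega>) else 0) \<in> borel_measurable M"
    by (simp only: prod.case)
  have "(\<lambda>\<omega>. if \<rho> \<omega> \<le> T \<omega> \<and> \<rho> \<omega> < \<infinity> then discount c (\<rho> \<omega>) *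
      (if (Ym (S \<omega>) \<omega>, Ym (S \<omega>) \<omega> - Y (S \<omega>) \<omega>) \<in> exit_set then \<upsilon> (Ym (S \<omega>) \<omega>) (Ym (S \<omega>) \<omega> - Y (S \<omega>) \<omega>) else 0) else 0) \<in> borel_measurable M"
    by measurable
  then show ?thesis
  proof (rule measurable_cong[THEN iffD1, rotated])
    fix \<omega> assume w: "\<omega> \<in> space M"
    show "(if \<rho> \<omega> \<le> T \<omega> \<and> \<rho> \<omega> < \<infinity> then discount c (\<rho> \<omega>) *
      (if (Ym (S \<omega>) \<omega>, Ym (S \<omega>) \<omega> - Y (S \<omega>) \<omega>) \<in> exit_set then \<upsilon> (Ym (S \<omega>) \<omega>) (Ym (S \<omega>) \<omega> - Y (S \<omega>) \<omega>) else 0) else 0) = penalty \<omega>"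
    proof (cases "\<rho> \<omega>")
      case (real r)
      have "(Ym r \<omega>, Ym r \<omega> - Y r \<omega>) \<in> exit_set" by (rule bound_at_ruin(2)[OF w real(2,1)])
      then show ?thesis using real by (simp add: penalty_eq[OF w] S_def)
    qed (simp add: penalty_eq[OF w])
  qed
qed

lemma switch_reward_upper:
  obtains C where "\<And>\<omega>. \<omega> \<in> space M \<Longrightarrow> switch_reward \<omega> \<le> C"
proof -
  obtain K where K: "0 \<le> K" "\<And>y. 0 \<le> y \<Longrightarrow> f y \<le> K * growth y" using f_upper by blast
  have "switch_reward \<omega> \<le> K * growth x" if w: "\<omega> \<in> space M" for \<omega>
  proof (cases "T \<omega> < \<rho> \<omega>")
    case True
    then obtain t where t: "0 \<le> t" "T \<omega> = ennreal t" by (cases "T \<omega>") auto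
    have Y0: "0 \<le> Y t \<omega>" using before_ruin[OF w t(1)] True t(2) by simp
    have "switch_reward \<omega> = exp (- c * t) * f (Y t \<omega>)" using True t by (simp add: switch_reward_def discount_real)
    also have "\<dots> \<le> exp (- c * t) * (K * growth (Y t \<omega>))" using K(2)[OF Y0] by (intro mult_left_mono) auto
    also have "\<dots> \<le> K * growth x" by (rule discounted_growth[OF K(1) t(1) Y_upper[OF w t(1)]])
    finally show ?thesis .
  next
    case False
    then show ?thesis using K(1) by (simp add: switch_reward_def growth_def)
  qed
  then show ?thesis using that by blast
qed

lemma exp_time_integrable: "integrable (restrict_space lborel {0<..}) (\<lambda>s. exp (- c * s))"
proof (subst integrable_restrict_space)
  interpret Cl: prob_space clock by (rule prob_space_clock)
  have "integrable clock (\<lambda>_. 1 / c)" by simp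
  then have "integrable lborel (\<lambda>s. exponential_density c s *\<^sub>R (1 / c))" unfolding clock_def
    by (subst (asm) integrable_density) (auto simp: exponential_density_def c_pos less_imp_le)
  then show "integrable lborel (\<lambda>s. indicator {0<..} s *\<^sub>R exp (- c * s))"
  proof (rule Bochner_Integration.integrable_bound)
    show "AE s in lborel. norm (indicator {0<..} s *\<^sub>R exp (- c * s)) \<le> norm (exponential_density c s *\<^sub>R (1 / c))"
      using c_pos by (intro AE_I2) (auto simp: exponential_density_def indicator_def mult.commute)
  qed measurable
qed simp

text \<open>From below the penalty is controlled by the growth condition together with discounting.
  From above, the fatal claim is one of all claims, so its discounted penalty is at most the sum of
  the discounted \<open>penalty_bound\<close> over all claims, whose mean is finite by
  compensation.\<close>

lemma penalty_integrable: "integrable M penalty"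
proof -
  define H where "H z = exp (- c * fst (snd z)) * (0 + penalty_bound (snd (snd z)))" for z :: "'w \<times> real \<times> (real^'n)"
  have Hm: "H \<in> borel_measurable predictable" unfolding H_def
    using measurable_compose[OF predictable_mark penalty_bound_measurable] by measurable
  have Hi: "integrable compensator_space H" unfolding H_def[abs_def] by (rule time_mark_integrable(2)[OF exp_time_integrable])
  note fin = compensation(4)[OF Hm Hi]
  obtain K where K: "0 \<le> K" "\<And>y \<alpha>. (y, \<alpha>) \<in> exit_set \<Longrightarrow> - \<upsilon> y \<alpha> \<le> K * growth y" using penalty_lower by blast
  have bound: "ennreal (norm (penalty \<omega>)) \<le> ennreal (K * growth x) + (\<Sum>k. ennreal (norm (H (claim_mark k \<omega>))))" if w: "\<omega> \<in> space M" for \<omega>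
  proof (cases "\<rho> \<omega> \<le> T \<omega> \<and> \<rho> \<omega> < \<infinity>")
    case True
    then obtain r where r: "0 \<le> r" "\<rho> \<omega> = ennreal r" by (cases "\<rho> \<omega>") auto
    let ?\<alpha> = "Ym r \<omega> - Y r \<omega>"
    have ex: "(Ym r \<omega>, ?\<alpha>) \<in> exit_set" and r0: "0 < r" and "\<exists>k\<ge>1. r = \<tau> k \<omega> \<and> ?\<alpha> = U k \<omega>"
      using bound_at_ruin(2,3,4)[OF w r(2,1)] by auto
    then obtain k where k: "1 \<le> k" "r = \<tau> k \<omega>" "?\<alpha> = U k \<omega>" by blast
    obtain j where j: "k = Suc j" using k(1) by (cases k) auto
    have pe: "penalty \<omega> = exp (- c * r) * \<upsilon> (Ym r \<omega>) ?\<alpha>" using True r by (simp add: penalty_eq[OF w] discount_real)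
    have y0: "0 \<le> Ym r \<omega>" using ex by (simp add: exit_set_iff)
    have "\<not> ?\<alpha> \<le> 0" using ex y0 order_trans by (auto simp: exit_set_iff)
    then have e0: "(0, ?\<alpha>) \<in> exit_set" using ex by (simp add: exit_set_iff)
    have up: "\<upsilon> (Ym r \<omega>) ?\<alpha> \<le> penalty_bound ?\<alpha>" using penalty_antimono[OF e0 ex y0] e0 by (simp add: penalty_bound_def)
    have pb: "0 \<le> penalty_bound ?\<alpha>" by (simp add: penalty_bound_def)
    have Hj: "H (claim_mark j \<omega>) = exp (- c * r) * penalty_bound ?\<alpha>" using k j by (simp add: H_def claim_mark_def)
    have "penalty \<omega> \<le> H (claim_mark j \<omega>)" unfolding pe Hj using up by (intro mult_left_mono) auto
    moreover have "- penalty \<omega> \<le> K * growth x"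
    proof -
      have "- penalty \<omega> = exp (- c * r) * (- \<upsilon> (Ym r \<omega>) ?\<alpha>)" unfolding pe by simp
      also have "\<dots> \<le> exp (- c * r) * (K * growth (Ym r \<omega>))" using K(2)[OF ex] by (intro mult_left_mono) auto
      also have "\<dots> \<le> K * growth x" by (rule discounted_growth[OF K(1) r(1) Ym_upper[OF w r0]])
      finally show ?thesis .
    qed
    moreover have "0 \<le> K * growth x" using K(1) by (simp add: growth_def)
    moreover have H0: "0 \<le> H (claim_mark j \<omega>)" unfolding Hj using pb by simp
    ultimately have "norm (penalty \<omega>) \<le> K * growth x + H (claim_mark j \<omega>)" by (simp add: abs_le_iff)
    then have "ennreal (norm (penalty \<omega>)) \<le> ennreal (K * growth x) + ennreal (H (claim_mark j \<omega>))"
      using \<open>0 \<le> K * growth x\<close> H0 by (simp add: ennreal_plus[symmetric] del: ennreal_plus)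
    moreover have "ennreal (H (claim_mark j \<omega>)) = (\<Sum>k\<in>{j}. ennreal (norm (H (claim_mark k \<omega>))))" using H0 by simp
    moreover have "(\<Sum>k\<in>{j}. ennreal (norm (H (claim_mark k \<omega>)))) \<le> (\<Sum>k. ennreal (norm (H (claim_mark k \<omega>))))"
      by (rule sum_le_suminf) auto
    ultimately show ?thesis by (metis (no_types, lifting) add_left_mono order_trans)
  next
    case False
    then have "penalty \<omega> = 0" unfolding penalty_eq[OF w] by (rule if_not_P)
    then show ?thesis by (simp only: norm_zero ennreal_0 zero_le)
  qed
  have "(\<integral>\<^sup>+\<omega>. ennreal (norm (penalty \<omega>)) \<partial>M) \<le> (\<integral>\<^sup>+\<omega>. ennreal (K * growth x) + (\<Sum>k. ennreal (norm (H (claim_mark k \<omega>)))) \<partial>M)"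
    by (rule nn_integral_mono) (use bound in auto)
  also have "\<dots> = (\<integral>\<^sup>+\<omega>. ennreal (K * growth x) \<partial>M) + (\<integral>\<^sup>+\<omega>. (\<Sum>k. ennreal (norm (H (claim_mark k \<omega>)))) \<partial>M)"
  proof (rule nn_integral_add)
    have [measurable]: "(\<lambda>\<omega>. H (claim_mark k \<omega>)) \<in> borel_measurable M" for k
      using measurable_compose[OF claim_mark_measurable Hm] .
    show "(\<lambda>\<omega>. \<Sum>k. ennreal (norm (H (claim_mark k \<omega>)))) \<in> borel_measurable M" by measurable
  qed simp
  also have "\<dots> < \<infinity>" using fin by (simp add: emeasure_space_1)
  finally show ?thesis by (intro integrableI_bounded penalty_measurable)
qed

text \<open>The bounds on dividends and switch reward give the positive part of the reward a finite
  mean. If the negative part has infinite mean, the value is -\<infinity>. Otherwise the switch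
  reward is integrable, and together with the penalty and the dividend bound it dominates the
  truncated values, so the bound at horizon n passes to the limit.\<close>

theorem strategy_value_le: "strategy_value M p a c \<tau> U \<upsilon> f (L, T) x \<le> ereal (u x)"
proof -
  define R where "R \<omega> = discounted_dividends a c L (min (T \<omega>) (\<rho> \<omega>)) \<omega> + switch_reward \<omega>" for \<omega>
  have rew: "reward p a c \<tau> U f x (L, T) = R"
    by (auto simp: reward_def R_def switch_reward_def)
  have divm: "(\<lambda>\<omega>. discounted_dividends a c L (S \<omega>) \<omega>) \<in> borel_measurable M" if "S \<in> borel_measurable M" for S
    using dividends_measurable[OF that] .
  have [measurable]: "R \<in> borel_measurable M" unfolding R_def
    by (intro borel_measurable_add divm) measurable
  obtain Cd where Cd: "\<And>S \<omega>. \<omega> \<in> space M \<Longrightarrow> 0 \<le> discounted_dividends a c L S \<omega> \<and> discounted_dividends a c L S \<omega> \<le> Cd"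
    using dividends_bounds by blast
  obtain Cs where Cs: "\<And>\<omega>. \<omega> \<in> space M \<Longrightarrow> switch_reward \<omega> \<le> Cs" using switch_reward_upper by blast
  have "(\<integral>\<^sup>+\<omega>. ennreal (R \<omega>) \<partial>M) \<le> (\<integral>\<^sup>+\<omega>. ennreal (Cd + Cs) \<partial>M)"
  proof (rule nn_integral_mono, rule ennreal_leI)
    fix \<omega> assume "\<omega> \<in> space M"
    then show "R \<omega> \<le> Cd + Cs" using Cd[of \<omega> "min (T \<omega>) (\<rho> \<omega>)"] Cs[of \<omega>] by (simp add: R_def)
  qed
  also have "\<dots> < \<infinity>" by (simp add: emeasure_space_1)
  finally have Rp: "(\<integral>\<^sup>+\<omega>. ennreal (R \<omega>) \<partial>M) < \<infinity>" .
  have EP: "extended_expectation M penalty = ereal (\<integral>\<omega>. penalty \<omega> \<partial>M)"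
    by (rule extended_expectation_integrable[OF penalty_integrable])
  show ?thesis
  proof (cases "(\<integral>\<^sup>+\<omega>. ennreal (- R \<omega>) \<partial>M) = \<infinity>")
    case True
    obtain r where "(\<integral>\<^sup>+\<omega>. ennreal (R \<omega>) \<partial>M) = ennreal r" "0 \<le> r" using Rp by (cases "\<integral>\<^sup>+\<omega>. ennreal (R \<omega>) \<partial>M") auto
    then have "extended_expectation M R = - \<infinity>" unfolding extended_expectation_def True by simp
    then show ?thesis unfolding strategy_value_def rew EP by simp
  next
    case False
    then have Ri: "integrable M R" using Rp by (simp add: real_integrable_def)
    have ER: "extended_expectation M R = ereal (\<integral>\<omega>. R \<omega> \<partial>M)" by (rule extended_expectation_integrable[OF Ri])
    have dvi: "integrable M (\<lambda>\<omega>. discounted_dividends a c L (min (T \<omega>) (\<rho> \<omega>)) \<omega>)"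
      by (rule integrable_const_bound[of _ Cd]) (use Cd divm[of "\<lambda>\<omega>. min (T \<omega>) (\<rho> \<omega>)"] in auto)
    have sri: "integrable M switch_reward"
      using Bochner_Integration.integrable_diff[OF Ri dvi] by (simp add: R_def)
    have vm: "value_upto (real n) \<in> borel_measurable M" for n unfolding value_upto_def[abs_def]
    proof (intro borel_measurable_diff borel_measurable_add divm)
      show "end_time (real n) \<in> borel_measurable M" unfolding end_time_def[abs_def] by measurable
    qed measurable
    have lim: "(\<lambda>n. \<integral>\<omega>. value_upto (real n) \<omega> \<partial>M) \<longlonglongrightarrow> (\<integral>\<omega>. R \<omega> - penalty \<omega> \<partial>M)"
    proof (rule integral_dominated_convergence[where w="\<lambda>\<omega>. Cd + norm (switch_reward \<omega>) + norm (penalty \<omega>)"])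
      show "integrable M (\<lambda>\<omega>. Cd + norm (switch_reward \<omega>) + norm (penalty \<omega>))"
        by (intro Bochner_Integration.integrable_add integrable_norm sri penalty_integrable) simp
      show "AE \<omega> in M. norm (value_upto (real n) \<omega>) \<le> Cd + norm (switch_reward \<omega>) + norm (penalty \<omega>)" for n
      proof (rule AE_I2)
        fix \<omega> assume "\<omega> \<in> space M"
        from Cd[OF this, of "end_time (real n) \<omega>"]
        show "norm (value_upto (real n) \<omega>) \<le> Cd + norm (switch_reward \<omega>) + norm (penalty \<omega>)"
          by (auto simp: value_upto_def)
      qed
      show "AE \<omega> in M. (\<lambda>n. value_upto (real n) \<omega>) \<longlonglongrightarrow> R \<omega> - penalty \<omega>"
      proof (rule AE_I2)
        fix \<omega> assume w: "\<omega> \<in> space M"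
        \<comment> \<open>For a finite time the truncation is inactive from some n on; at an
          infinite time the term itself is 0, which covers paths without switch or ruin.\<close>
        have ev: "\<forall>\<^sub>F n in sequentially. (if S \<le> ennreal (real n) then k else 0) = k" if "S = \<infinity> \<Longrightarrow> k = (0::real)" for S k
        proof (cases S)
          case (real s)
          obtain N0 :: nat where "s \<le> real N0" using real_arch_simple by blast
          then show ?thesis using real by (intro eventually_mono[OF eventually_ge_at_top[of N0]]) (auto intro: order_trans)
        qed (use that in simp)
        have l1: "(\<lambda>n. if T \<omega> \<le> ennreal (real n) then switch_reward \<omega> else 0) \<longlonglongrightarrow> switch_reward \<omega>"
          by (rule tendsto_eventually, rule ev) (simp add: switch_reward_def discount_def)
        have l2: "(\<lambda>n. if \<rho> \<omega> \<le> ennreal (real n) then penalty \<omega> else 0) \<longlonglongrightarrow> penalty \<omega>"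
          by (rule tendsto_eventually, rule ev) (simp add: penalty_eq[OF w])
        show "(\<lambda>n. value_upto (real n) \<omega>) \<longlonglongrightarrow> R \<omega> - penalty \<omega>"
          unfolding value_upto_def R_def end_time_def by (intro tendsto_intros dividends_limit[OF w] l1 l2)
      qed
    qed (use vm in measurable)
    have "(\<integral>\<omega>. value_upto (real n) \<omega> \<partial>M) \<le> u x + exp (- c * real n) * \<bar>u 0\<bar>" for n
    proof -
      have vi: "integrable M (value_upto (real n))"
      proof (rule Bochner_Integration.integrable_bound[of _ "\<lambda>\<omega>. Cd + norm (switch_reward \<omega>) + norm (penalty \<omega>)"])
        show "integrable M (\<lambda>\<omega>. Cd + norm (switch_reward \<omega>) + norm (penalty \<omega>))"
          by (intro Bochner_Integration.integrable_add integrable_norm sri penalty_integrable) simp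
        show "AE \<omega> in M. norm (value_upto (real n) \<omega>) \<le> norm (Cd + norm (switch_reward \<omega>) + norm (penalty \<omega>))"
        proof (rule AE_I2)
          fix \<omega> assume "\<omega> \<in> space M"
          from Cd[OF this, of "end_time (real n) \<omega>"]
          show "norm (value_upto (real n) \<omega>) \<le> norm (Cd + norm (switch_reward \<omega>) + norm (penalty \<omega>))"
            by (auto simp: value_upto_def)
        qed
      qed (rule vm)
      have "(\<integral>\<omega>. value_upto (real n) \<omega> \<partial>M) \<le> (\<integral>\<omega>. (u x + exp (- c * real n) * \<bar>u 0\<bar>) + gain_martingale (real n) \<omega> \<partial>M)"
        using value_upto_bound[of _ "real n"]
        by (intro integral_mono vi Bochner_Integration.integrable_add gain_martingale_mean(1)) auto
      also have "\<dots> = (u x + exp (- c * real n) * \<bar>u 0\<bar>) + 0"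
        unfolding gain_martingale_mean(2)[of "real n", symmetric]
        by (subst Bochner_Integration.integral_add[OF _ gain_martingale_mean(1)]) (auto simp: prob_space)
      finally show ?thesis by simp
    qed
    moreover have "(\<lambda>n. u x + exp (- c * real n) * \<bar>u 0\<bar>) \<longlonglongrightarrow> u x + 0 * \<bar>u 0\<bar>"
    proof (intro tendsto_intros)
      have "filterlim (\<lambda>n. - c * real n) at_bot sequentially"
        using c_pos by (intro filterlim_tendsto_neg_mult_at_bot[OF tendsto_const _ filterlim_real_sequentially]) auto
      then show "(\<lambda>n. exp (- c * real n)) \<longlonglongrightarrow> 0" by (rule filterlim_compose[OF exp_at_bot])
    qed
    ultimately have "(\<integral>\<omega>. R \<omega> - penalty \<omega> \<partial>M) \<le> u x" using LIMSEQ_le[OF lim] by auto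
    then show ?thesis unfolding strategy_value_def rew EP ER
      by (simp add: Bochner_Integration.integral_diff[OF Ri penalty_integrable])
  qed
qed

end

section \<open>From single strategies to the optimal value\<close>

lemma optimal_value_le_supersolution:
  assumes "dividend_model M p a c rate \<tau> U \<upsilon> f"
    and "\<And>z. z \<in> interior {0..} \<Longrightarrow> viscosity_supersolution_at p a c rate (distr M borel (U 1)) \<upsilon> f W z"
    and x: "x \<in> {0..}"
  shows "optimal_value M p a c \<tau> U \<upsilon> f x \<le> ereal (W x)"
  unfolding optimal_value_def
proof (rule SUP_least)
  interpret supersolution M p a c rate \<tau> U \<upsilon> f W
    using assms(1,2) by (simp add: supersolution_def supersolution_axioms_def)
  fix \<pi> assume "\<pi> \<in> strategies M p \<tau> U x"
  then obtain L T where \<pi>: "\<pi> = (L, T)" "admissible M p \<tau> U x L" "stopping_time (claim_filtration M \<tau> U) T"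
    unfolding strategies_def by blast
  interpret strategy_bound M p a c rate \<tau> U \<upsilon> f W x L T
    by unfold_locales (use x \<pi> in auto)
  show "strategy_value M p a c \<tau> U \<upsilon> f \<pi> x \<le> ereal (W x)" unfolding \<pi>(1) by (rule strategy_value_le)
qed

theorem theorem3p8:
  fixes M :: "'w measure"
    and p a :: "real^'n" and c rate :: real
    and \<tau> :: "nat \<Rightarrow> 'w \<Rightarrow> real" and U :: "nat \<Rightarrow> 'w \<Rightarrow> real^'n"
    and \<upsilon> :: "real^'n \<Rightarrow> real^'n \<Rightarrow> real" and f :: "real^'n \<Rightarrow> real"
  assumes model: "dividend_model M p a c rate \<tau> U \<upsilon> f"
  shows
    "(\<forall>(\<pi> :: real^'n \<Rightarrow> (real \<Rightarrow> 'w \<Rightarrow> real^'n) \<times> ('w \<Rightarrow> ennreal)) (W :: real^'n \<Rightarrow> real).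
        (\<forall>x\<in>{0..}. \<pi> x \<in> strategies M p \<tau> U x) \<and>
        (\<forall>x\<in>{0..}. ereal (W x) = strategy_value M p a c \<tau> U \<upsilon> f (\<pi> x) x) \<and>
        (\<forall>x\<in>interior {0..}.
           viscosity_supersolution_at p a c rate (distr M borel (U 1)) \<upsilon> f W x)
        \<longrightarrow> (\<forall>x\<in>{0..}. ereal (W x) = optimal_value M p a c \<tau> U \<upsilon> f x))
     \<and>
     (\<forall>(\<pi> :: nat \<Rightarrow> real^'n \<Rightarrow> (real \<Rightarrow> 'w \<Rightarrow> real^'n) \<times> ('w \<Rightarrow> ennreal)) (W :: real^'n \<Rightarrow> real).
        (\<forall>k\<ge>1. \<forall>x\<in>{0..}. \<pi> k x \<in> strategies M p \<tau> U x) \<and>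
        (\<forall>x\<in>{0..}.
           (\<lambda>k. strategy_value M p a c \<tau> U \<upsilon> f (\<pi> k x) x) \<longlonglongrightarrow> ereal (W x)) \<and>
        (\<forall>x\<in>interior {0..}.
           viscosity_supersolution_at p a c rate (distr M borel (U 1)) \<upsilon> f W x)
        \<longrightarrow> (\<forall>x\<in>{0..}. ereal (W x) = optimal_value M p a c \<tau> U \<upsilon> f x))"
proof (intro conjI allI impI ballI; elim conjE)
  fix \<pi> :: "real^'n \<Rightarrow> (real \<Rightarrow> 'w \<Rightarrow> real^'n) \<times> ('w \<Rightarrow> ennreal)" and W :: "real^'n \<Rightarrow> real" and x :: "real^'n"
  assume \<pi>: "\<forall>x\<in>{0..}. \<pi> x \<in> strategies M p \<tau> U x"
    "\<forall>x\<in>{0..}. ereal (W x) = strategy_value M p a c \<tau> U \<upsilon> f (\<pi> x) x"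
    and v: "\<forall>x\<in>interior {0..}. viscosity_supersolution_at p a c rate (distr M borel (U 1)) \<upsilon> f W x" and x: "x \<in> {0..}"
  show "ereal (W x) = optimal_value M p a c \<tau> U \<upsilon> f x"
  proof (rule antisym)
    show "ereal (W x) \<le> optimal_value M p a c \<tau> U \<upsilon> f x"
      unfolding \<pi>(2)[rule_format, OF x] optimal_value_def by (rule SUP_upper) (use \<pi>(1) x in blast)
    show "optimal_value M p a c \<tau> U \<upsilon> f x \<le> ereal (W x)"
      by (rule optimal_value_le_supersolution[OF model _ x]) (use v in blast)
  qed
next
  fix \<pi> :: "nat \<Rightarrow> real^'n \<Rightarrow> (real \<Rightarrow> 'w \<Rightarrow> real^'n) \<times> ('w \<Rightarrow> ennreal)" and W :: "real^'n \<Rightarrow> real" and x :: "real^'n"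
  assume \<pi>: "\<forall>k\<ge>1. \<forall>x\<in>{0..}. \<pi> k x \<in> strategies M p \<tau> U x"
    "\<forall>x\<in>{0..}. (\<lambda>k. strategy_value M p a c \<tau> U \<upsilon> f (\<pi> k x) x) \<longlonglongrightarrow> ereal (W x)"
    and v: "\<forall>x\<in>interior {0..}. viscosity_supersolution_at p a c rate (distr M borel (U 1)) \<upsilon> f W x" and x: "x \<in> {0..}"
  show "ereal (W x) = optimal_value M p a c \<tau> U \<upsilon> f x"
  proof (rule antisym)
    \<comment> \<open>Strategies are given for k \<ge> 1 only, and the limit does not see the
      remaining index.\<close>
    have "strategy_value M p a c \<tau> U \<upsilon> f (\<pi> k x) x \<le> optimal_value M p a c \<tau> U \<upsilon> f x" if "k \<ge> 1" for k
      unfolding optimal_value_def by (rule SUP_upper) (use \<pi>(1) x that in blast)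
    then show "ereal (W x) \<le> optimal_value M p a c \<tau> U \<upsilon> f x"
      by (intro LIMSEQ_le_const2[OF \<pi>(2)[rule_format, OF x]]) blast
    show "optimal_value M p a c \<tau> U \<upsilon> f x \<le> ereal (W x)"
      by (rule optimal_value_le_supersolution[OF model _ x]) (use v in blast)
  qed
qed

end
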